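(* Let $\mathcal{N}$, $R$, $\widetilde{\mathcal{N}}=(\mathcal{N},R)$, $\mathcal{R}$, $\mathcal{F}_N$, $\mathcal{F}_R$, $\lambda$, $\mathcal{F}$ be as described in the context, with $\widetilde{\mathcal{N}}$ a monster model. Then $\widetilde{\mathcal{N}}$ is distal if the following conditions hold: (1) $\mathcal{N}$ and $\mathcal{R}$ are distal. (2) For any (small) $M\subseteq N$ with $\langle M\rangle_{\mathcal{F}}=M$ and any $b,b'\in R$, if $\mathrm{tp}^{\mathcal{R}}(b/M\cap R)=\mathrm{tp}^{\mathcal{R}}(b'/M\cap R)$, then $\mathrm{tp}^{\widetilde{\mathcal{N}}}(b/M)=\mathrm{tp}^{\widetilde{\mathcal{N}}}(b'/M)$. (3) For any (small) $M\subseteq N$ with $\langle M\rangle_{\mathcal{F}}=M$ and any $b,b'\in N$, if $\mathrm{tp}^{\mathcal{N}}(b/M)=\mathrm{tp}^{\mathcal{N}}(b'/M)$ and $\lambda(x)\in M$ for any $x\in\langle bM\rangle_{\mathcal{F}_N}$, then $\mathrm{tp}^{\widetilde{\mathcal{N}}}(b/M)=\mathrm{tp}^{\widetilde{\mathcal{N}}}(b'/M)$. (4) $\widetilde{\mathcal{N}}$ admits variable separation.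
   Context: **Setting.** $\mathcal{N}$ is a structure with universe $N$, $R\subseteq N$ is a unary subset, and $\widetilde{\mathcal{N}}=(\mathcal{N},R)$ is the expansion of $\mathcal{N}$ by a predicate for $R$. $\mathcal{R}$ is a structure with universe $R$ all of whose function and relation symbols are $\emptyset$-definable in $\widetilde{\mathcal{N}}$. $\mathcal{F}_N$ (resp. $\mathcal{F}_R$) is a set of functions $N^n\to N$ (resp. $R^n\to R$), for various $n$, that are $\emptyset$-definable in $\mathcal{N}$ (resp. $\mathcal{R}$). $\lambda:N\to R$ is a function $\emptyset$-definable in $\widetilde{\mathcal{N}}$. Each $h\in\mathcal{F}_R$ is regarded as a function on $N^n$ by $h(\overline{x})=h(\lambda(x_1),\dots,\lambda(x_n))$. Put $\mathcal{F}=\mathcal{F}_N\cup\mathcal{F}_R\cup\{\lambda\}$. For a set of functions $\mathcal{G}$, a $\mathcal{G}$-term is a term built from variables and functions in $\mathcal{G}$, and $\langle X\rangle_{\mathcal{G}}=\{t(\overline a)\mid \overline a\in X,\ t \text{ a } \mathcal{G}\text{-term}\}$. Juxtaposition $bM$ means $\{b\}\cup M$. **Monster models.** $\widetilde{\mathcal{N}}$ is a monster model: every structure interpretable in it (including itself) is $\kappa$-saturated and strongly $\kappa$-homogeneous for a sufficiently large $\kappa$; "small" means of cardinality $<\kappa$, and all tuples and parameter sets are small. **Distality.** For linear orders $I,J$, the cut $(I,J)$ of the concatenation $I+J$ is Dedekind if $I$ has no maximum and $J$ has no minimum. A complete theory $T$ with infinite models is distal if for any sequence $(\overline{a_k})_{k\in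 I+(c)+J}$ of finite tuples of the same length (indexed by $I$, then a point $c$, then $J$) and any singleton $b$ in a monster model of $T$, if ( * ) $(I,J)$ is Dedekind, $(\overline{a_k})_{k\in I+(c)+J}$ is indiscernible, and $(\overline{a_k})_{k\in I+J}$ is indiscernible over $b$, then $(\overline{a_k})_{k\in I+(c)+J}$ is indiscernible over $b$. A structure is distal if its theory is. Throughout, index sets $I,J$ are assumed to be sufficiently saturated dense linear orders without endpoints. **Variable separation.** A truncation of $(I,J)$ is a pair $(I',J')$, written $(I',J')\subset_{\mathrm t}(I,J)$, with $I'$ a nonempty final segment of $I$ and $J'$ a nonempty initial segment of $J$. A parameter set outside $(I',J')$ is a small subset of $\{\overline{a_k}\mid k\in(I\setminus I')\cup(J\setminus J')\}$. $\widetilde{\mathcal{N}}$ admits variable separation if for any sequence $(\overline{a_k})_{k\in I+(c)+J}$ and singleton $b$ in $\widetilde{\mathcal{N}}$ satisfying ( * ) (in $\widetilde{\mathcal N}$), and any $\mathcal{F}$-term $t(\overline{x},y)$, there exist a truncation $(I',J')\subset_{\mathrm t}(I,J)$, an $\mathcal{F}_N$-term $u(\overline{z},\overline{w})$, and tuples of $\mathcal{F}$-terms $\overline{r}(\overline{x})=(r_1(\overline x),\dots,r_m(\overline x))$ and $\overline{s}(y)=(s_1(y),\dots,s_n(y))$ involving parameters outside $(I',J')$, such that $t(\overline{a_k},b)=u(\overline{r}(\overline{a_k}),\overline{s}(b))$ for any $k\in I'+(c)+J'$, and if $t$ is of the form $h(\overline{t})$ for some $h\in\mathcal{F}_R\cup\{\lambda\}$,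 then all components of $\overline{s}(b)$ lie in $R$. *)

theory Defs
  imports Main "HOL-Library.FuncSet"
begin

unbundle cardinal_syntax

section \<open>Terms, formulas and structures\<close>

datatype 'f tm = Var nat | Fn 'f "'f tm list"

datatype ('f, 'r) fm =
    Eq "'f tm" "'f tm"
  | Rel 'r "'f tm list"
  | Neg "('f, 'r) fm"
  | Conj "('f, 'r) fm" "('f, 'r) fm"
  | Ex nat "('f, 'r) fm"

fun tm_vars :: "'f tm \<Rightarrow> nat set" where
  "tm_vars (Var i) = {i}"
| "tm_vars (Fn f ts) = (\<Union>t \<in> set ts. tm_vars t)"

fun fm_free :: "('f, 'r) fm \<Rightarrow> nat set" where
  "fm_free (Eq t u) = tm_vars t \<union> tm_vars u"
| "fm_free (Rel r ts) = (\<Union>t \<in> set ts. tm_vars t)"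
| "fm_free (Neg \<phi>) = fm_free \<phi>"
| "fm_free (Conj \<phi> \<psi>) = fm_free \<phi> \<union> fm_free \<psi>"
| "fm_free (Ex x \<phi>) = fm_free \<phi> - {x}"

text \<open>The symbols of a language form subsets of the symbol types, so that, for instance,
  languages without function symbols are included. Constants are functions of arity 0.\<close>

record ('f, 'r) lang =
  fsyms :: "'f set"
  rsyms :: "'r set"
  farity :: "'f \<Rightarrow> nat"
  rarity :: "'r \<Rightarrow> nat"

record ('f, 'r, 'a) struct = "('f, 'r) lang" +
  univ :: "'a set"
  fint :: "'f \<Rightarrow> 'a list \<Rightarrow> 'a"
  rint :: "'r \<Rightarrow> 'a list \<Rightarrow> bool"

fun wf_tm :: "'f set \<Rightarrow> ('f \<Rightarrow> nat) \<Rightarrow> 'f tm \<Rightarrow> bool" where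
  "wf_tm F ar (Var i) \<longleftrightarrow> True"
| "wf_tm F ar (Fn f ts) \<longleftrightarrow> f \<in> F \<and> length ts = ar f \<and> (\<forall>t \<in> set ts. wf_tm F ar t)"

fun wf_fm :: "('f, 'r, 'z) lang_scheme \<Rightarrow> ('f, 'r) fm \<Rightarrow> bool" where
  "wf_fm L (Eq t u) \<longleftrightarrow> wf_tm (fsyms L) (farity L) t \<and> wf_tm (fsyms L) (farity L) u"
| "wf_fm L (Rel r ts) \<longleftrightarrow>
     r \<in> rsyms L \<and> length ts = rarity L r \<and> (\<forall>t \<in> set ts. wf_tm (fsyms L) (farity L) t)"
| "wf_fm L (Neg \<phi>) \<longleftrightarrow> wf_fm L \<phi>"
| "wf_fm L (Conj \<phi> \<psi>) \<longleftrightarrow> wf_fm L \<phi> \<and> wf_fm L \<psi>"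
| "wf_fm L (Ex x \<phi>) \<longleftrightarrow> wf_fm L \<phi>"

definition tuples :: "nat \<Rightarrow> 'a set \<Rightarrow> 'a list set" where
  "tuples n A = {as. length as = n \<and> set as \<subseteq> A}"

definition structure_ok :: "('f, 'r, 'a) struct \<Rightarrow> bool" where
  "structure_ok M \<longleftrightarrow> univ M \<noteq> {} \<and>
     (\<forall>f \<in> fsyms M. \<forall>as \<in> tuples (farity M f) (univ M). fint M f as \<in> univ M)"

fun eval_tm :: "('f \<Rightarrow> 'a list \<Rightarrow> 'a) \<Rightarrow> (nat \<Rightarrow> 'a) \<Rightarrow> 'f tm \<Rightarrow> 'a" where
  "eval_tm F s (Var i) = s i"
| "eval_tm F s (Fn f ts) = F f (map (eval_tm F s) ts)"

fun satisfies :: "('f, 'r, 'a) struct \<Rightarrow> (nat \<Rightarrow> 'a) \<Rightarrow> ('f, 'r) fm \<Rightarrow> bool" where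
  "satisfies M s (Eq t u) \<longleftrightarrow> eval_tm (fint M) s t = eval_tm (fint M) s u"
| "satisfies M s (Rel r ts) \<longleftrightarrow> rint M r (map (eval_tm (fint M) s) ts)"
| "satisfies M s (Neg \<phi>) \<longleftrightarrow> \<not> satisfies M s \<phi>"
| "satisfies M s (Conj \<phi> \<psi>) \<longleftrightarrow> satisfies M s \<phi> \<and> satisfies M s \<psi>"
| "satisfies M s (Ex x \<phi>) \<longleftrightarrow> (\<exists>a \<in> univ M. satisfies M (s(x := a)) \<phi>)"

text \<open>A formula all of whose free variables are below n is evaluated at an n-tuple, given as a
  list, by the valuation \<^term>\<open>nth as\<close>; the values of \<^term>\<open>nth as\<close> beyond the length of
  the list are then irrelevant.\<close>

definition formulas :: "('f, 'r, 'z) lang_scheme \<Rightarrow> nat \<Rightarrow> ('f, 'r) fm set" where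
  "formulas L n = {\<phi>. wf_fm L \<phi> \<and> fm_free \<phi> \<subseteq> {..<n}}"

definition Th :: "('f, 'r, 'a) struct \<Rightarrow> ('f, 'r) fm set" where
  "Th M = {\<phi> \<in> formulas M 0. satisfies M (nth []) \<phi>}"

definition models :: "('f, 'r, 'a) struct \<Rightarrow> ('f, 'r) fm set \<Rightarrow> bool" where
  "models M T \<longleftrightarrow> structure_ok M \<and> T \<subseteq> Th M"


section \<open>Definable sets, types and indiscernible sequences\<close>

text \<open>Definability is always without parameters.\<close>

definition definable :: "('f, 'r, 'a) struct \<Rightarrow> nat \<Rightarrow> 'a list set \<Rightarrow> bool" where
  "definable M n X \<longleftrightarrow>
     (\<exists>\<phi> \<in> formulas M n. X = {as \<in> tuples n (univ M). satisfies M (nth as) \<phi>})"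

definition graph :: "nat \<Rightarrow> 'a set \<Rightarrow> ('a list \<Rightarrow> 'a) \<Rightarrow> 'a list set" where
  "graph n A f = {as @ [f as] | as. as \<in> tuples n A}"

text \<open>The type of the tuple \<open>bs\<close> over the set \<open>A\<close>; a formula with parameters is a pair of a
  formula and the list of its parameters.\<close>

definition tp :: "('f, 'r, 'a) struct \<Rightarrow> 'a list \<Rightarrow> 'a set \<Rightarrow> (('f, 'r) fm \<times> 'a list) set" where
  "tp M bs A = {(\<phi>, cs). set cs \<subseteq> A \<and> \<phi> \<in> formulas M (length bs + length cs) \<and>
                          satisfies M (nth (bs @ cs)) \<phi>}"

text \<open>Linear orders are reflexive relations, as in \<^const>\<open>linear_order_on\<close>.\<close>

definition lt :: "'k rel \<Rightarrow> 'k \<Rightarrow> 'k \<Rightarrow> bool" where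
  "lt r x y \<longleftrightarrow> (x, y) \<in> r \<and> x \<noteq> y"

definition indiscernible ::
  "('f, 'r, 'a) struct \<Rightarrow> 'k rel \<Rightarrow> 'k set \<Rightarrow> ('k \<Rightarrow> 'a list) \<Rightarrow> 'a set \<Rightarrow> bool" where
  "indiscernible M r K a B \<longleftrightarrow>
     (\<forall>ks ls. set ks \<subseteq> K \<and> set ls \<subseteq> K \<and> length ks = length ls \<and>
        sorted_wrt (lt r) ks \<and> sorted_wrt (lt r) ls \<longrightarrow>
        tp M (concat (map a ks)) B = tp M (concat (map a ls)) B)"


section \<open>Monster models\<close>

definition saturated :: "'k rel \<Rightarrow> ('f, 'r, 'a) struct \<Rightarrow> bool" where
  "saturated \<kappa> M \<longleftrightarrow>
     (\<forall>A p. A \<subseteq> univ M \<and> |A| <o \<kappa> \<and>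
        p \<subseteq> {(\<phi>, cs). set cs \<subseteq> A \<and> \<phi> \<in> formulas M (1 + length cs)} \<and>
        (\<forall>q. finite q \<and> q \<subseteq> p \<longrightarrow>
           (\<exists>b \<in> univ M. \<forall>(\<phi>, cs) \<in> q. satisfies M (nth (b # cs)) \<phi>)) \<longrightarrow>
        (\<exists>b \<in> univ M. \<forall>(\<phi>, cs) \<in> p. satisfies M (nth (b # cs)) \<phi>))"

definition elementary_map ::
  "('f, 'r, 'a) struct \<Rightarrow> 'a set \<Rightarrow> ('a \<Rightarrow> 'a) \<Rightarrow> bool" where
  "elementary_map M A f \<longleftrightarrow> A \<subseteq> univ M \<and> f ` A \<subseteq> univ M \<and>
     (\<forall>as. set as \<subseteq> A \<longrightarrow> (\<forall>\<phi> \<in> formulas M (length as).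
        satisfies M (nth as) \<phi> \<longleftrightarrow> satisfies M (nth (map f as)) \<phi>))"

definition automorphism :: "('f, 'r, 'a) struct \<Rightarrow> ('a \<Rightarrow> 'a) \<Rightarrow> bool" where
  "automorphism M \<sigma> \<longleftrightarrow> bij_betw \<sigma> (univ M) (univ M) \<and>
     (\<forall>f \<in> fsyms M. \<forall>as \<in> tuples (farity M f) (univ M).
        \<sigma> (fint M f as) = fint M f (map \<sigma> as)) \<and>
     (\<forall>r \<in> rsyms M. \<forall>as \<in> tuples (rarity M r) (univ M).
        rint M r as \<longleftrightarrow> rint M r (map \<sigma> as))"

definition strongly_homogeneous :: "'k rel \<Rightarrow> ('f, 'r, 'a) struct \<Rightarrow> bool" where
  "strongly_homogeneous \<kappa> M \<longleftrightarrow>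
     (\<forall>A f. |A| <o \<kappa> \<and> elementary_map M A f \<longrightarrow>
        (\<exists>\<sigma>. automorphism M \<sigma> \<and> (\<forall>x \<in> A. \<sigma> x = f x)))"

text \<open>\<open>S\<close> is interpretable in \<open>M\<close> if there are a coordinate map \<open>\<pi>\<close> from a definable set \<open>D\<close> of
  n-tuples onto the universe of \<open>S\<close> such that the preimages under \<open>\<pi>\<close> of equality and of the
  functions and relations of \<open>S\<close> are definable.\<close>

definition interpretable ::
  "('g, 's, 'u) struct \<Rightarrow> ('f, 'r, 'a) struct \<Rightarrow> bool" where
  "interpretable S M \<longleftrightarrow> structure_ok S \<and>
     (\<exists>n D \<pi>. definable M n D \<and> \<pi> ` D = univ S \<and>
        definable M (2 * n) {x @ y | x y. x \<in> D \<and> y \<in> D \<and> \<pi> x = \<pi> y} \<and>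
        (\<forall>f \<in> fsyms S. definable M ((farity S f + 1) * n)
           {concat xs @ y | xs y. xs \<in> tuples (farity S f) D \<and> y \<in> D \<and>
                                  fint S f (map \<pi> xs) = \<pi> y}) \<and>
        (\<forall>r \<in> rsyms S. definable M (rarity S r * n)
           {concat xs | xs. xs \<in> tuples (rarity S r) D \<and> rint S r (map \<pi> xs)}))"

text \<open>The bound structure \<open>S\<close> must have a fixed HOL type. Its elements can be taken to be
  classes of tuples and its symbols to be pairs of an arity and a defining formula: up to
  isomorphism, renaming of symbols, and identification of symbols with the same arity and
  interpretation, every interpretable structure has this form, and saturation and strong
  homogeneity do not distinguish between such presentations.\<close>

definition monster :: "'k rel \<Rightarrow> ('f, 'r, 'a) struct \<Rightarrow> bool" where
  "monster \<kappa> M \<longleftrightarrow> structure_ok M \<and> saturated \<kappa> M \<and> strongly_homogeneous \<kappa> M \<and>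
     (\<forall>S :: (nat \<times> ('f, 'r) fm, nat \<times> ('f, 'r) fm, 'a list set) struct.
        interpretable S M \<longrightarrow> saturated \<kappa> S \<and> strongly_homogeneous \<kappa> S)"


section \<open>Distality\<close>

definition order_struct :: "'k rel \<Rightarrow> 'k set \<Rightarrow> (unit, unit, 'k) struct" where
  "order_struct r I = \<lparr>fsyms = {}, rsyms = {()}, farity = (\<lambda>_. 0), rarity = (\<lambda>_. 2),
     univ = I, fint = (\<lambda>_. hd), rint = (\<lambda>_ xs. lt r (xs ! 0) (xs ! 1))\<rparr>"

definition dense_no_endpoints :: "'k rel \<Rightarrow> 'k set \<Rightarrow> bool" where
  "dense_no_endpoints r I \<longleftrightarrow> I \<noteq> {} \<and>
     (\<forall>x \<in> I. \<forall>y \<in> I. lt r x y \<longrightarrow> (\<exists>z \<in> I. lt r x z \<and> lt r z y)) \<and>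
     (\<forall>x \<in> I. (\<exists>y \<in> I. lt r y x) \<and> (\<exists>y \<in> I. lt r x y))"

text \<open>The index sets used throughout: \<open>I + (c) + J\<close> is a linear order of cardinality below \<open>\<kappa>\<close>,
  and \<open>I\<close> and \<open>J\<close> are \<open>\<mu>\<close>-saturated dense linear orders without endpoints. Since orders of
  cardinality below \<open>\<kappa>\<close> embed into the field of \<open>\<kappa>\<close>, indices can be taken from its type.
  Sufficient saturation means that \<open>\<mu>\<close> is uncountable and exceeds the number of symbols of the
  language, and then \<open>\<kappa>\<close> is sufficiently large if it exceeds \<open>2\<^sup>\<mu>\<close>, which ensures that such
  orders of cardinality below \<open>\<kappa>\<close> exist.\<close>

definition index_cut ::
  "'k rel \<Rightarrow> 'm rel \<Rightarrow> 'k rel \<Rightarrow> 'k set \<Rightarrow> 'k \<Rightarrow> 'k set \<Rightarrow> bool" where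
  "index_cut \<kappa> \<mu> r I c J \<longleftrightarrow>
     linear_order_on (I \<union> {c} \<union> J) r \<and> |I \<union> {c} \<union> J| <o \<kappa> \<and>
     (\<forall>i \<in> I. lt r i c) \<and> (\<forall>j \<in> J. lt r c j) \<and>
     dense_no_endpoints r I \<and> saturated \<mu> (order_struct r I) \<and>
     dense_no_endpoints r J \<and> saturated \<mu> (order_struct r J)"

definition Dedekind_cut :: "'k rel \<Rightarrow> 'k set \<Rightarrow> 'k set \<Rightarrow> bool" where
  "Dedekind_cut r I J \<longleftrightarrow>
     \<not> (\<exists>m \<in> I. \<forall>i \<in> I. (i, m) \<in> r) \<and> \<not> (\<exists>m \<in> J. \<forall>j \<in> J. (m, j) \<in> r)"

definition star_condition ::
  "('f, 'r, 'a) struct \<Rightarrow> 'k rel \<Rightarrow> 'k set \<Rightarrow> 'k \<Rightarrow> 'k set \<Rightarrow> ('k \<Rightarrow> 'a list) \<Rightarrow> 'a \<Rightarrow> bool" where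
  "star_condition M r I c J a b \<longleftrightarrow>
     Dedekind_cut r I J \<and> indiscernible M r (I \<union> {c} \<union> J) a {} \<and>
     indiscernible M r (I \<union> J) a {b}"

text \<open>A structure is distal if its complete theory is; that theory has infinite models if and
  only if \<open>M\<close> is infinite. The sequences range over all monster models of the theory whose
  universe is a set of elements of the same HOL type.\<close>

definition distal :: "'k rel \<Rightarrow> 'm rel \<Rightarrow> ('f, 'r, 'a) struct \<Rightarrow> bool" where
  "distal \<kappa> \<mu> M \<longleftrightarrow> infinite (univ M) \<and>
     (\<forall>M' :: ('f, 'r, 'a) struct.
        lang.truncate M' = lang.truncate M \<and> models M' (Th M) \<and> monster \<kappa> M' \<longrightarrow>
        (\<forall>r I c J p a. \<forall>b \<in> univ M'.
           index_cut \<kappa> \<mu> r I c J \<and> (\<forall>k \<in> I \<union> {c} \<union> J. a k \<in> tuples p (univ M')) \<and>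
           star_condition M' r I c J a b \<longrightarrow>
           indiscernible M' r (I \<union> {c} \<union> J) a {b}))"


section \<open>The expansion by a predicate and the closure under terms\<close>

text \<open>The new predicate symbol is \<^const>\<open>None\<close>.\<close>

definition expand :: "('f, 'r, 'a) struct \<Rightarrow> 'a set \<Rightarrow> ('f, 'r option, 'a) struct" where
  "expand M R = \<lparr>fsyms = fsyms M, rsyms = insert None (Some ` rsyms M), farity = farity M,
     rarity = case_option 1 (rarity M), univ = univ M, fint = fint M,
     rint = case_option (\<lambda>xs. hd xs \<in> R) (rint M)\<rparr>"

text \<open>A function \<open>A\<^sup>n \<rightarrow> A\<close> is a pair of its arity and an extensional function on lists of
  length n; such pairs serve as their own symbols in terms.\<close>

type_synonym 'a nfun = "nat \<times> ('a list \<Rightarrow> 'a)"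

definition definable_functions :: "('f, 'r, 'a) struct \<Rightarrow> 'a nfun set" where
  "definable_functions M =
     {(n, f). f \<in> tuples n (univ M) \<rightarrow>\<^sub>E univ M \<and> definable M (n + 1) (graph n (univ M) f)}"

definition symbols_definable_in ::
  "('g, 's, 'a) struct \<Rightarrow> ('f, 'r, 'a) struct \<Rightarrow> bool" where
  "symbols_definable_in S M \<longleftrightarrow>
     (\<forall>f \<in> fsyms S. definable M (farity S f + 1) (graph (farity S f) (univ S) (fint S f))) \<and>
     (\<forall>r \<in> rsyms S. definable M (rarity S r) {as \<in> tuples (rarity S r) (univ S). rint S r as})"

definition lam_fun :: "'a set \<Rightarrow> ('a \<Rightarrow> 'a) \<Rightarrow> 'a nfun" where
  "lam_fun N lam = (1, \<lambda>xs \<in> tuples 1 N. lam (hd xs))"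

definition lift_fun :: "'a set \<Rightarrow> ('a \<Rightarrow> 'a) \<Rightarrow> 'a nfun \<Rightarrow> 'a nfun" where
  "lift_fun N lam h = (fst h, \<lambda>xs \<in> tuples (fst h) N. snd h (map lam xs))"

definition R_funs :: "'a set \<Rightarrow> ('a \<Rightarrow> 'a) \<Rightarrow> 'a nfun set \<Rightarrow> 'a nfun set" where
  "R_funs N lam FR = insert (lam_fun N lam) (lift_fun N lam ` FR)"

definition all_funs :: "'a set \<Rightarrow> ('a \<Rightarrow> 'a) \<Rightarrow> 'a nfun set \<Rightarrow> 'a nfun set \<Rightarrow> 'a nfun set" where
  "all_funs N lam FN FR = FN \<union> R_funs N lam FR"

definition fun_terms :: "'a nfun set \<Rightarrow> nat \<Rightarrow> 'a nfun tm set" where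
  "fun_terms G n = {t. wf_tm G fst t \<and> tm_vars t \<subseteq> {..<n}}"

definition app_term :: "'a nfun tm \<Rightarrow> 'a list \<Rightarrow> 'a" where
  "app_term t as = eval_tm snd (nth as) t"

definition generated :: "'a nfun set \<Rightarrow> 'a set \<Rightarrow> 'a set" where
  "generated G X = {app_term t as | t as. set as \<subseteq> X \<and> t \<in> fun_terms G (length as)}"


section \<open>Variable separation\<close>

definition truncation ::
  "'k rel \<Rightarrow> 'k set \<Rightarrow> 'k set \<Rightarrow> 'k set \<Rightarrow> 'k set \<Rightarrow> bool" where
  "truncation r I' J' I J \<longleftrightarrow>
     I' \<noteq> {} \<and> I' \<subseteq> I \<and> (\<forall>x \<in> I'. \<forall>y \<in> I. lt r x y \<longrightarrow> y \<in> I') \<and>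
     J' \<noteq> {} \<and> J' \<subseteq> J \<and> (\<forall>x \<in> J'. \<forall>y \<in> J. lt r y x \<longrightarrow> y \<in> J')"

text \<open>In \<open>t\<close> the variables below \<open>p\<close> stand for the tuple \<open>x\<close> and the variable \<open>p\<close> for \<open>y\<close>.
  The list \<open>ps\<close> contains the parameters, which are entries of tuples in the parameter set \<open>P\<close>;
  they are substituted for the last variables of the terms in \<open>rs\<close> and \<open>ss\<close>.\<close>

definition variable_separation ::
  "'k rel \<Rightarrow> 'm rel \<Rightarrow> ('f, 'r, 'a) struct \<Rightarrow> 'a set \<Rightarrow> ('a \<Rightarrow> 'a) \<Rightarrow> 'a nfun set \<Rightarrow> 'a nfun set \<Rightarrow> bool"
  where
  "variable_separation \<kappa> \<mu> M R lam FN FR \<longleftrightarrow>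
     (\<forall>r I c J p a. \<forall>b \<in> univ M. \<forall>t \<in> fun_terms (all_funs (univ M) lam FN FR) (p + 1).
        index_cut \<kappa> \<mu> r I c J \<and> (\<forall>k \<in> I \<union> {c} \<union> J. a k \<in> tuples p (univ M)) \<and>
        star_condition M r I c J a b \<longrightarrow>
        (\<exists>I' J' P ps rs ss. \<exists>u \<in> fun_terms FN (length rs + length ss).
           truncation r I' J' I J \<and>
           P \<subseteq> a ` ((I - I') \<union> (J - J')) \<and> |P| <o \<kappa> \<and> set ps \<subseteq> (\<Union>x \<in> P. set x) \<and>
           set rs \<subseteq> fun_terms (all_funs (univ M) lam FN FR) (p + length ps) \<and>
           set ss \<subseteq> fun_terms (all_funs (univ M) lam FN FR) (1 + length ps) \<and>
           (\<forall>k \<in> I' \<union> {c} \<union> J'.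
              app_term t (a k @ [b]) =
              app_term u (map (\<lambda>q. app_term q (a k @ ps)) rs @
                          map (\<lambda>q. app_term q (b # ps)) ss)) \<and>
           ((\<exists>h ts. h \<in> R_funs (univ M) lam FR \<and> t = Fn h ts) \<longrightarrow>
              (\<forall>q \<in> set ss. app_term q (b # ps) \<in> R))))"

end

theory Submission
  imports Defs "HOL-Library.Countable"
begin

text \<open>
  Let \<open>a\<close> be an indiscernible sequence on \<open>I + (c) + J\<close> that is indiscernible over the
  singleton \<open>b\<close> away from \<open>c\<close>. The argument is carried out with automorphisms instead of types:
  by strong homogeneity, two tuples have the same type over a small set if and only if an
  automorphism over that set moves one to the other (\<open>tp_eq_automorphism\<close>). Automorphisms of the
  expansion \<open>NR\<close> are also automorphisms of every structure definable in it, in particular of \<open>NN\<close>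
  and \<open>RR\<close>, and they commute with the functions in \<open>F\<close>. So the values of terms at the tuples
  \<open>a k\<close> form indiscernible sequences of \<open>NN\<close> and \<open>RR\<close>, to which distality applies
  (\<open>distal_terms\<close>).

  It suffices to find, for every such sequence, a \<open>d\<close> in \<open>I\<close> or \<open>J\<close> and an automorphism that
  fixes \<open>b\<close> and moves \<open>a d\<close> to \<open>a c\<close>: the other entries of a tuple from the sequence can be
  appended as constants to the entries near \<open>c\<close> (\<open>indiscernible_if_one_point\<close>). Indiscernibility
  gives an automorphism \<open>\<sigma>\<close> from \<open>a d\<close> to \<open>a c\<close>, and if \<open>b\<close> and \<open>\<sigma> b\<close> have the same \<open>NR\<close>-type
  over \<open>a c\<close>, then \<open>\<sigma> b\<close> can be moved back to \<open>b\<close> over \<open>a c\<close>.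

  If \<open>b\<close> lies in \<open>R\<close>, take \<open>M\<close> to be the closure of \<open>a c\<close> under \<open>F\<close>. Distality of \<open>RR\<close>, applied
  to the terms with values in \<open>R\<close>, shows that \<open>b\<close> and \<open>\<sigma> b\<close> have the same \<open>RR\<close>-type over the
  trace of \<open>M\<close> on \<open>R\<close>, and hypothesis \<open>two\<close> lifts this to \<open>NR\<close> (\<open>indiscernible_over_R\<close>).

  For general \<open>b\<close>, hypothesis \<open>three\<close> needs an \<open>F\<close>-closed set \<open>M\<close> that contains \<open>lam x\<close> for all \<open>x\<close>
  generated by \<open>b\<close> and \<open>M\<close>. Variable separation writes such a value as a term in \<open>a c\<close>, in some
  further entries of the sequence, and in elements of \<open>R\<close> that are generated by \<open>b\<close> and those
  entries. There are fewer than \<open>\<mu>\<close> terms, so the indices of the entries needed for all terms can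
  be closed off to a set \<open>K\<close> with fewer than \<open>\<mu>\<close> elements (\<open>closed_index_set\<close>), and saturation
  leaves room between \<open>K\<close> and \<open>c\<close>. Let \<open>E\<close> consist of the entries at \<open>K\<close>, let \<open>W\<close> be \<open>E\<close> together
  with the elements of \<open>R\<close> generated by \<open>b\<close> and \<open>E\<close>, and let \<open>M\<close> be generated by \<open>a c\<close> and \<open>W\<close>. By
  the case of \<open>R\<close>, finitely many elements of \<open>W\<close> can be appended to the sequence as constants
  (\<open>Star_adjoin\<close>). Hence \<open>\<sigma>\<close> can be chosen to fix \<open>W\<close>, and distality of \<open>NN\<close> shows that \<open>b\<close> and
  \<open>\<sigma> b\<close> have the same \<open>NN\<close>-type over \<open>M\<close>, which is what hypothesis \<open>three\<close> requires
  (\<open>conjugate_point\<close>).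

  Three general facts prepare the ground. The structures \<open>NN\<close> and \<open>RR\<close> are monster models, since
  they are definable in \<open>NR\<close> (\<open>monster_definable_structure\<close>). Distality quantifies over all
  monster models of a theory, but small configurations embed elementarily into \<open>NR\<close>
  (\<open>distal_if_in_model\<close>). Finally, passing closer to \<open>c\<close> leads to index sets that are again
  saturated (\<open>index_cut_segment\<close>).
\<close>

section \<open>Renaming variables and moving parameters\<close>

lemma eval_tm_cong: "(\<And>i. i \<in> tm_vars t \<Longrightarrow> s i = s' i) \<Longrightarrow> eval_tm F s t = eval_tm F s' t"
proof (induction t)
  case (Fn f ts)
  then have "map (eval_tm F s) ts = map (eval_tm F s') ts" by auto
  then show ?case by (simp only: eval_tm.simps)
qed simp

lemma satisfies_cong:
  "(\<And>i. i \<in> fm_free \<phi> \<Longrightarrow> s i = s' i) \<Longrightarrow> satisfies M s \<phi> \<longleftrightarrow> satisfies M s' \<phi>"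
proof (induction \<phi> arbitrary: s s')
  case (Eq t u)
  then show ?case using eval_tm_cong[of t s s'] eval_tm_cong[of u s s'] by simp
next
  case (Rel r ts)
  then have "map (eval_tm (fint M) s) ts = map (eval_tm (fint M) s') ts"
    by (auto intro!: eval_tm_cong)
  then show ?case by (simp only: satisfies.simps)
next
  case (Neg \<phi>)
  then show ?case by (metis fm_free.simps(3) satisfies.simps(3))
next
  case (Conj \<phi> \<psi>)
  then show ?case by (metis UnCI fm_free.simps(4) satisfies.simps(4))
next
  case (Ex x \<phi>)
  have "satisfies M (s(x := a)) \<phi> \<longleftrightarrow> satisfies M (s'(x := a)) \<phi>" for a
    using Ex.prems by (intro Ex.IH) auto
  then show ?case by simp
qed

lemma finite_tm_vars [simp]: "finite (tm_vars t)"
  by (induction t) auto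

lemma finite_fm_free [simp]: "finite (fm_free \<phi>)"
  by (induction \<phi>) auto

fun subst_tm :: "(nat \<Rightarrow> 'f tm) \<Rightarrow> 'f tm \<Rightarrow> 'f tm" where
  "subst_tm \<tau> (Var i) = \<tau> i"
| "subst_tm \<tau> (Fn f ts) = Fn f (map (subst_tm \<tau>) ts)"

lemma eval_subst_tm: "eval_tm F s (subst_tm \<tau> t) = eval_tm F (\<lambda>i. eval_tm F s (\<tau> i)) t"
proof (induction t)
  case (Fn f ts)
  then have "map (eval_tm F s \<circ> subst_tm \<tau>) ts = map (eval_tm F (\<lambda>i. eval_tm F s (\<tau> i))) ts"
    by auto
  then show ?case by (simp only: eval_tm.simps subst_tm.simps map_map)
qed simp

lemma tm_vars_subst: "tm_vars (subst_tm \<tau> t) = (\<Union>i \<in> tm_vars t. tm_vars (\<tau> i))"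
  by (induction t) auto

lemma wf_subst_tm:
  "wf_tm G ar t \<Longrightarrow> (\<And>i. i \<in> tm_vars t \<Longrightarrow> wf_tm G ar (\<tau> i)) \<Longrightarrow> wf_tm G ar (subst_tm \<tau> t)"
  by (induction t) auto

lemma wf_subst_Var [simp]: "wf_tm G ar (subst_tm (\<lambda>i. Var (\<rho> i)) t) \<longleftrightarrow> wf_tm G ar t"
  by (induction t) auto

definition fresh :: "nat set \<Rightarrow> nat" where
  "fresh A = (SOME x. x \<notin> A)"

lemma fresh: "finite A \<Longrightarrow> fresh A \<notin> A"
  unfolding fresh_def by (rule someI_ex) (rule ex_new_if_finite, auto)

fun ren_fm :: "(nat \<Rightarrow> nat) \<Rightarrow> ('f, 'r) fm \<Rightarrow> ('f, 'r) fm" where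
  "ren_fm \<rho> (Eq t u) = Eq (subst_tm (\<lambda>i. Var (\<rho> i)) t) (subst_tm (\<lambda>i. Var (\<rho> i)) u)"
| "ren_fm \<rho> (Rel r ts) = Rel r (map (subst_tm (\<lambda>i. Var (\<rho> i))) ts)"
| "ren_fm \<rho> (Neg \<phi>) = Neg (ren_fm \<rho> \<phi>)"
| "ren_fm \<rho> (Conj \<phi> \<psi>) = Conj (ren_fm \<rho> \<phi>) (ren_fm \<rho> \<psi>)"
| "ren_fm \<rho> (Ex x \<phi>) =
     (let y = fresh (\<rho> ` (fm_free \<phi> - {x})) in Ex y (ren_fm (\<rho>(x := y)) \<phi>))"

lemma wf_ren_fm [simp]: "wf_fm L (ren_fm \<rho> \<phi>) \<longleftrightarrow> wf_fm L \<phi>"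
  by (induction \<phi> arbitrary: \<rho>) (auto simp: Let_def)

lemma free_ren_fm: "fm_free (ren_fm \<rho> \<phi>) \<subseteq> \<rho> ` fm_free \<phi>"
proof (induction \<phi> arbitrary: \<rho>)
  case (Ex x \<phi>)
  define y where "y = fresh (\<rho> ` (fm_free \<phi> - {x}))"
  have "fm_free (ren_fm (\<rho>(x := y)) \<phi>) \<subseteq> (\<rho>(x := y)) ` fm_free \<phi>" by (rule Ex.IH)
  then show ?case by (auto simp: Let_def y_def[symmetric])
next
  case (Conj \<phi> \<psi>)
  then show ?case by (simp add: image_Un le_supI1 le_supI2)
qed (auto simp: tm_vars_subst)

lemma satisfies_ren_fm: "satisfies M s (ren_fm \<rho> \<phi>) \<longleftrightarrow> satisfies M (s \<circ> \<rho>) \<phi>"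
proof (induction \<phi> arbitrary: \<rho> s)
  case (Ex x \<phi>)
  define y where "y = fresh (\<rho> ` (fm_free \<phi> - {x}))"
  have y: "y \<notin> \<rho> ` (fm_free \<phi> - {x})" unfolding y_def by (rule fresh) simp
  have "satisfies M (s(y := a) \<circ> \<rho>(x := y)) \<phi> \<longleftrightarrow> satisfies M ((s \<circ> \<rho>)(x := a)) \<phi>" for a
    using y by (intro satisfies_cong) auto
  then show ?case by (simp only: Let_def y_def[symmetric] Ex.IH ren_fm.simps satisfies.simps)
qed (auto simp: eval_subst_tm comp_def)

lemma formulas_mono: "m \<le> n \<Longrightarrow> \<phi> \<in> formulas L m \<Longrightarrow> \<phi> \<in> formulas L n"
  unfolding formulas_def by auto

lemma satisfies_formulas_cong:
  "\<phi> \<in> formulas L n \<Longrightarrow> (\<And>i. i < n \<Longrightarrow> s i = s' i) \<Longrightarrow> satisfies M s \<phi> \<longleftrightarrow> satisfies M s' \<phi>"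
  by (rule satisfies_cong) (auto simp: formulas_def)

lemma ren_formulas:
  "\<phi> \<in> formulas L m \<Longrightarrow> (\<And>i. i < m \<Longrightarrow> \<rho> i < n) \<Longrightarrow> ren_fm \<rho> \<phi> \<in> formulas L n"
  using free_ren_fm[of \<rho> \<phi>] unfolding formulas_def by fastforce

lemma satisfies_reindex:
  assumes "\<phi> \<in> formulas L (length is)"
  shows "satisfies M (nth xs) (ren_fm (nth is) \<phi>) \<longleftrightarrow> satisfies M (nth (map (nth xs) is)) \<phi>"
  unfolding satisfies_ren_fm by (rule satisfies_formulas_cong[OF assms]) simp

text \<open>A closed formula, so that it also serves as the conjunction of no formulas without
  parameters.\<close>

definition True_fm :: "('f, 'r) fm" where
  "True_fm = Neg (Ex 0 (Neg (Eq (Var 0) (Var 0))))"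

lemma True_fm [simp]: "satisfies M s True_fm" "True_fm \<in> formulas L n" "fm_free True_fm = {}"
    "wf_fm L True_fm"
  by (auto simp: True_fm_def formulas_def)

text \<open>The quantified first variable is moved behind the others, so that the remaining
  variables get the numbers that they have in a shorter list of arguments.\<close>

definition Ex_first :: "nat \<Rightarrow> ('f, 'r) fm \<Rightarrow> ('f, 'r) fm" where
  "Ex_first n \<phi> = Ex n (ren_fm (case_nat n (\<lambda>i. i)) \<phi>)"

lemma Ex_first:
  assumes "\<phi> \<in> formulas L (Suc n)"
  shows "Ex_first n \<phi> \<in> formulas L n"
    and "length ds = n \<Longrightarrow>
      satisfies M (nth ds) (Ex_first n \<phi>) \<longleftrightarrow> (\<exists>x \<in> univ M. satisfies M (nth (x # ds)) \<phi>)"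
proof -
  have "ren_fm (case_nat n (\<lambda>i. i)) \<phi> \<in> formulas L (Suc n)"
    by (rule ren_formulas[OF assms]) (auto split: nat.splits)
  then show "Ex_first n \<phi> \<in> formulas L n"
    unfolding Ex_first_def formulas_def by (auto simp: less_Suc_eq)
next
  assume "length ds = n"
  then have "satisfies M ((nth ds)(n := x) \<circ> case_nat n (\<lambda>i. i)) \<phi> \<longleftrightarrow>
      satisfies M (nth (x # ds)) \<phi>" for x
    by (intro satisfies_formulas_cong[OF assms]) (auto split: nat.splits simp: nth_Cons)
  then show "satisfies M (nth ds) (Ex_first n \<phi>) \<longleftrightarrow> (\<exists>x \<in> univ M. satisfies M (nth (x # ds)) \<phi>)"
    by (simp add: Ex_first_def satisfies_ren_fm)
qed

text \<open>Saturation speaks about finitely many formulas, each with its own list of parameters.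
  Concatenating these lists turns them into a single formula with a single list.\<close>

lemma merge_formulas:
  fixes L :: "('f, 'r, 'z) lang_scheme" and A :: "'a set"
  assumes "finite q" and "q \<subseteq> {(\<phi>, cs). set cs \<subseteq> A \<and> \<phi> \<in> formulas L (1 + length cs)}"
  shows "\<exists>\<psi> ds. set ds \<subseteq> A \<and> \<psi> \<in> formulas L (1 + length ds) \<and> (\<forall>(M :: ('f, 'r, 'b) struct) f x.
       satisfies M (nth (x # map f ds)) \<psi> \<longleftrightarrow> (\<forall>(\<phi>, cs) \<in> q. satisfies M (nth (x # map f cs)) \<phi>))"
  using assms
proof (induction q rule: finite_induct)
    case empty
    show ?case by (rule exI[of _ True_fm], rule exI[of _ "[]"]) simp
  next
    case (insert z q)
    obtain \<psi> ds where IH: "set ds \<subseteq> A" "\<psi> \<in> formulas L (1 + length ds)"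
      "\<And>(M :: ('f, 'r, 'b) struct) f x.
       satisfies M (nth (x # map f ds)) \<psi> \<longleftrightarrow> (\<forall>(\<phi>, cs) \<in> q. satisfies M (nth (x # map f cs)) \<phi>)"
      using insert by blast
    obtain \<phi> cs where z: "z = (\<phi>, cs)" "set cs \<subseteq> A" "\<phi> \<in> formulas L (1 + length cs)"
      using insert.prems by auto
    define \<rho> where "\<rho> = case_nat 0 (\<lambda>i. Suc (length ds + i))"
    have "ren_fm \<rho> \<phi> \<in> formulas L (1 + length (ds @ cs))"
      by (rule ren_formulas[OF z(3)]) (auto simp: \<rho>_def split: nat.splits)
    moreover have "\<psi> \<in> formulas L (1 + length (ds @ cs))"
      by (rule formulas_mono[OF _ IH(2)]) simp
    ultimately have 1: "Conj \<psi> (ren_fm \<rho> \<phi>) \<in> formulas L (1 + length (ds @ cs))"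
      by (simp add: formulas_def)
    have 2: "satisfies M (nth (x # map f (ds @ cs))) (Conj \<psi> (ren_fm \<rho> \<phi>)) \<longleftrightarrow>
        (\<forall>(\<phi>, cs) \<in> insert z q. satisfies M (nth (x # map f cs)) \<phi>)"
      for M :: "('f, 'r, 'b) struct" and f x
    proof -
      have "satisfies M (nth (x # map f (ds @ cs))) \<psi> \<longleftrightarrow> satisfies M (nth (x # map f ds)) \<psi>"
        by (rule satisfies_formulas_cong[OF IH(2)]) (auto simp: nth_Cons nth_append split: nat.splits)
      moreover have "satisfies M (nth (x # map f (ds @ cs)) \<circ> \<rho>) \<phi> \<longleftrightarrow>
          satisfies M (nth (x # map f cs)) \<phi>"
        by (rule satisfies_formulas_cong[OF z(3)])
          (auto simp: \<rho>_def nth_Cons nth_append split: nat.splits)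
      ultimately show ?thesis using IH(3) z by (auto simp: satisfies_ren_fm)
    qed
    show ?case
      by (rule exI[of _ "Conj \<psi> (ren_fm \<rho> \<phi>)"], rule exI[of _ "ds @ cs"])
        (use 1 2 z IH in auto)
qed

section \<open>Types and automorphisms\<close>

lemma tp_eq_iff:
  assumes "length as = length bs"
  shows "tp M as B = tp M bs B \<longleftrightarrow>
    (\<forall>cs. set cs \<subseteq> B \<longrightarrow> (\<forall>\<phi> \<in> formulas M (length as + length cs).
       satisfies M (nth (as @ cs)) \<phi> \<longleftrightarrow> satisfies M (nth (bs @ cs)) \<phi>))"
  unfolding tp_def using assms by (auto simp: set_eq_iff)

text \<open>Isomorphisms respect valuations in the universe, while \<open>nth as\<close> has unknown values beyond the
  length of \<open>as\<close>.\<close>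

definition pad :: "('f, 'r, 'a) struct \<Rightarrow> 'a list \<Rightarrow> nat \<Rightarrow> 'a" where
  "pad M as i = (if i < length as then as ! i else SOME u. u \<in> univ M)"

lemma pad_univ: "structure_ok M \<Longrightarrow> set as \<subseteq> univ M \<Longrightarrow> pad M as i \<in> univ M"
  unfolding pad_def structure_ok_def by (auto simp: some_in_eq intro: nth_mem[THEN subsetD[rotated]])

lemma satisfies_pad:
  "\<phi> \<in> formulas L (length as) \<Longrightarrow> satisfies M (pad M as) \<phi> \<longleftrightarrow> satisfies M (nth as) \<phi>"
  by (rule satisfies_formulas_cong) (auto simp: pad_def)

lemma eval_tm_univ:
  assumes "\<And>f as. f \<in> G \<Longrightarrow> as \<in> tuples (ar f) U \<Longrightarrow> F f as \<in> U"
    and "wf_tm G ar t" and "\<And>i. i \<in> tm_vars t \<Longrightarrow> s i \<in> U"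
  shows "eval_tm F s t \<in> U"
  using assms(2,3)
proof (induction t)
  case (Fn f ts)
  then have "map (eval_tm F s) ts \<in> tuples (ar f) U" by (auto simp: tuples_def)
  with Fn assms(1)[of f] show ?case by simp
qed simp

text \<open>Isomorphisms that also change the symbols; maps between the symbols that are not injective
  identify symbols with the same interpretation.\<close>

definition iso_along ::
  "('g, 's, 'u) struct \<Rightarrow> ('f, 'r, 'v) struct \<Rightarrow> ('u \<Rightarrow> 'v) \<Rightarrow> ('g \<Rightarrow> 'f) \<Rightarrow> ('s \<Rightarrow> 'r) \<Rightarrow> bool" where
  "iso_along S S' h cf cr \<longleftrightarrow> bij_betw h (univ S) (univ S') \<and>
     (\<forall>f \<in> fsyms S. cf f \<in> fsyms S' \<and> farity S' (cf f) = farity S f \<and>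
        (\<forall>as \<in> tuples (farity S f) (univ S). h (fint S f as) = fint S' (cf f) (map h as))) \<and>
     (\<forall>r \<in> rsyms S. cr r \<in> rsyms S' \<and> rarity S' (cr r) = rarity S r \<and>
        (\<forall>as \<in> tuples (rarity S r) (univ S). rint S r as \<longleftrightarrow> rint S' (cr r) (map h as)))"

lemma tm_vars_map [simp]: "tm_vars (map_tm cf t) = tm_vars t"
  by (induction t) auto

lemma fm_free_map [simp]: "fm_free (map_fm cf cr \<phi>) = fm_free \<phi>"
  by (induction \<phi>) auto

lemma iso_along_wf_tm:
  "iso_along S S' h cf cr \<Longrightarrow> wf_tm (fsyms S) (farity S) t \<Longrightarrow>
     wf_tm (fsyms S') (farity S') (map_tm cf t)"
  by (induction t) (auto simp: iso_along_def)

lemma iso_along_wf_fm: "iso_along S S' h cf cr \<Longrightarrow> wf_fm S \<phi> \<Longrightarrow> wf_fm S' (map_fm cf cr \<phi>)"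
proof (induction \<phi>)
  case (Rel r ts)
  then have "cr r \<in> rsyms S'" "rarity S' (cr r) = rarity S r" by (simp_all add: iso_along_def)
  with Rel iso_along_wf_tm[OF Rel.prems(1)] show ?case by simp
qed (auto intro: iso_along_wf_tm)

lemma iso_along_formulas:
  "iso_along S S' h cf cr \<Longrightarrow> \<phi> \<in> formulas S n \<Longrightarrow> map_fm cf cr \<phi> \<in> formulas S' n"
  by (auto simp: formulas_def iso_along_wf_fm)

lemma eval_tm_hom:
  assumes "\<And>f as. f \<in> G \<Longrightarrow> as \<in> tuples (ar f) U \<Longrightarrow> F f as \<in> U"
    and hom: "\<And>f as. f \<in> G \<Longrightarrow> as \<in> tuples (ar f) U \<Longrightarrow> \<sigma> (F f as) = F' (c f) (map \<sigma> as)"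
    and "wf_tm G ar t" and "\<And>i. i \<in> tm_vars t \<Longrightarrow> s i \<in> U"
  shows "\<sigma> (eval_tm F s t) = eval_tm F' (\<sigma> \<circ> s) (map_tm c t)"
  using assms(3,4)
proof (induction t)
  case (Fn f ts)
  have "eval_tm F s t \<in> U" if "t \<in> set ts" for t
    using that Fn.prems by (intro eval_tm_univ[of G ar]) (auto intro: assms(1))
  then have "map (eval_tm F s) ts \<in> tuples (ar f) U" using Fn.prems by (auto simp: tuples_def)
  moreover have "map (\<sigma> \<circ> eval_tm F s) ts = map (eval_tm F' (\<sigma> \<circ> s) \<circ> map_tm c) ts"
    using Fn by (auto simp: comp_def)
  ultimately show ?case
    using hom[of f "map (eval_tm F s) ts"] Fn.prems
    by (simp only: eval_tm.simps wf_tm.simps map_map tm.map)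
qed simp

lemma iso_along_satisfies:
  assumes S: "structure_ok S" and iso: "iso_along S S' h cf cr"
    and "wf_fm S \<phi>" and "\<And>i. s i \<in> univ S"
  shows "satisfies S' (h \<circ> s) (map_fm cf cr \<phi>) \<longleftrightarrow> satisfies S s \<phi>"
  using assms(3,4)
proof (induction \<phi> arbitrary: s)
  case (Eq t u)
  have 1: "eval_tm (fint S') (h \<circ> s) (map_tm cf t) = h (eval_tm (fint S) s t)"
    if "wf_tm (fsyms S) (farity S) t" for t
    by (rule eval_tm_hom[OF _ _ that, of "univ S", symmetric])
      (use S iso Eq in \<open>auto simp: structure_ok_def iso_along_def\<close>)
  have 2: "eval_tm (fint S) s t \<in> univ S" if "wf_tm (fsyms S) (farity S) t" for t
    by (rule eval_tm_univ[OF _ that]) (use S Eq in \<open>auto simp: structure_ok_def\<close>)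
  have "inj_on h (univ S)" using iso by (auto simp: iso_along_def bij_betw_def)
  then have "h (eval_tm (fint S) s t) = h (eval_tm (fint S) s u) \<longleftrightarrow>
      eval_tm (fint S) s t = eval_tm (fint S) s u"
    using Eq.prems 2[of t] 2[of u] by (intro inj_on_eq_iff) auto
  with 1 Eq.prems show ?case by (simp only: satisfies.simps fm.map wf_fm.simps)
next
  case (Rel r ts)
  have 1: "h (eval_tm (fint S) s t) = eval_tm (fint S') (h \<circ> s) (map_tm cf t)"
    if "wf_tm (fsyms S) (farity S) t" for t
    by (rule eval_tm_hom[OF _ _ that, of "univ S"])
      (use S iso Rel in \<open>auto simp: structure_ok_def iso_along_def\<close>)
  have "eval_tm (fint S) s t \<in> univ S" if "wf_tm (fsyms S) (farity S) t" for t
    by (rule eval_tm_univ[OF _ that]) (use S Rel in \<open>auto simp: structure_ok_def\<close>)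
  then have "map (eval_tm (fint S) s) ts \<in> tuples (rarity S r) (univ S)"
    using Rel.prems by (auto simp: tuples_def)
  moreover have "map h (map (eval_tm (fint S) s) ts) = map (eval_tm (fint S') (h \<circ> s)) (map (map_tm cf) ts)"
    using 1 Rel.prems by auto
  moreover have "r \<in> rsyms S" using Rel.prems by simp
  ultimately have "rint S r (map (eval_tm (fint S) s) ts) \<longleftrightarrow>
      rint S' (cr r) (map (eval_tm (fint S') (h \<circ> s)) (map (map_tm cf) ts))"
    using iso unfolding iso_along_def by metis
  then show ?case by (simp only: satisfies.simps fm.map)
next
  case (Ex x \<phi>)
  let ?\<phi> = "map_fm cf cr \<phi>"
  have "h ` univ S = univ S'" using iso by (auto simp: iso_along_def bij_betw_def)
  then have "(\<exists>a \<in> univ S'. satisfies S' ((h \<circ> s)(x := a)) ?\<phi>) \<longleftrightarrow>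
      (\<exists>a \<in> univ S. satisfies S' ((h \<circ> s)(x := h a)) ?\<phi>)"
    by (simp flip: \<open>h ` univ S = univ S'\<close>)
  also have "\<dots> \<longleftrightarrow> (\<exists>a \<in> univ S. satisfies S' (h \<circ> s(x := a)) ?\<phi>)"
    by (simp add: fun_upd_comp)
  also have "\<dots> \<longleftrightarrow> (\<exists>a \<in> univ S. satisfies S (s(x := a)) \<phi>)"
    using Ex by (intro bex_cong Ex.IH) auto
  finally show ?case by (simp only: satisfies.simps fm.map)
qed auto

lemma iso_along_satisfies_list:
  assumes "structure_ok S" "iso_along S S' h cf cr" "set as \<subseteq> univ S" "\<phi> \<in> formulas S (length as)"
  shows "satisfies S' (nth (map h as)) (map_fm cf cr \<phi>) \<longleftrightarrow> satisfies S (nth as) \<phi>"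
proof -
  have "satisfies S' (nth (map h as)) (map_fm cf cr \<phi>) \<longleftrightarrow>
      satisfies S' (h \<circ> pad S as) (map_fm cf cr \<phi>)"
    by (rule satisfies_formulas_cong[OF iso_along_formulas[OF assms(2,4)]]) (simp add: pad_def)
  also have "\<dots> \<longleftrightarrow> satisfies S (pad S as) \<phi>"
    using assms by (intro iso_along_satisfies pad_univ) (auto simp: formulas_def)
  finally show ?thesis using assms satisfies_pad by blast
qed

lemma automorphism_iso_along: "automorphism M \<sigma> \<Longrightarrow> iso_along M M \<sigma> id id"
  by (auto simp: automorphism_def iso_along_def)

lemma automorphism_satisfies_list:
  assumes "structure_ok M" "automorphism M \<sigma>" "set as \<subseteq> univ M" "\<phi> \<in> formulas M (length as)"
  shows "satisfies M (nth (map \<sigma> as)) \<phi> \<longleftrightarrow> satisfies M (nth as) \<phi>"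
  using iso_along_satisfies_list[OF assms(1) automorphism_iso_along[OF assms(2)] assms(3,4)]
  by (simp add: fm.map_id)

lemma automorphism_comp:
  assumes "automorphism M \<sigma>" "automorphism M \<tau>"
  shows "automorphism M (\<tau> \<circ> \<sigma>)"
proof -
  have *: "map \<sigma> as \<in> tuples n (univ M)" if "as \<in> tuples n (univ M)" for n as
    using that assms(1) unfolding tuples_def automorphism_def bij_betw_def by auto
  show ?thesis
    using assms * unfolding automorphism_def by (auto intro: bij_betw_trans simp flip: map_map)
qed

lemma automorphism_id: "automorphism M id"
  by (auto simp: automorphism_def)

lemma automorphism_univ: "automorphism M \<sigma> \<Longrightarrow> x \<in> univ M \<Longrightarrow> \<sigma> x \<in> univ M"
  by (auto simp: automorphism_def bij_betw_def)

lemma automorphism_tp: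
  assumes "structure_ok M" "automorphism M \<sigma>" "set as \<subseteq> univ M" "B \<subseteq> univ M"
    "\<And>x. x \<in> B \<Longrightarrow> \<sigma> x = x"
  shows "tp M (map \<sigma> as) B = tp M as B"
proof -
  have "satisfies M (nth (map \<sigma> as @ cs)) \<phi> \<longleftrightarrow> satisfies M (nth (as @ cs)) \<phi>"
    if "set cs \<subseteq> B" "\<phi> \<in> formulas M (length as + length cs)" for cs \<phi>
  proof -
    have "map \<sigma> cs = cs" using that assms(5) by (intro map_idI) auto
    then show ?thesis
      using automorphism_satisfies_list[OF assms(1,2), of "as @ cs" \<phi>] that assms by auto
  qed
  then show ?thesis by (subst tp_eq_iff) auto
qed

text \<open>Under strong homogeneity, having the same type over a small set means being conjugate
  over it. A tuple may have repeated entries and may meet the set \<open>B\<close>; the equations between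
  entries belong to the type, which makes the map below well defined.\<close>

lemma tp_eq_automorphism:
  assumes hom: "strongly_homogeneous \<kappa> M" and small: "|B \<union> set as| <o \<kappa>"
    and len: "length as = length bs" and tp: "tp M as B = tp M bs B"
    and U: "set as \<subseteq> univ M" "set bs \<subseteq> univ M" "B \<subseteq> univ M"
  shows "\<exists>\<sigma>. automorphism M \<sigma> \<and> (\<forall>x \<in> B. \<sigma> x = x) \<and> map \<sigma> as = bs"
proof -
  have tp': "satisfies M (nth (as @ cs)) \<phi> \<longleftrightarrow> satisfies M (nth (bs @ cs)) \<phi>"
    if "set cs \<subseteq> B" "\<phi> \<in> formulas M (length as + length cs)" for cs \<phi>
    using tp that unfolding tp_eq_iff[OF len] by blast
  define f where "f x = (if x \<in> set as then bs ! (SOME i. i < length as \<and> as ! i = x) else x)" for x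
  have f1: "f (as ! i) = bs ! i" if i: "i < length as" for i
  proof -
    define j where "j = (SOME j. j < length as \<and> as ! j = as ! i)"
    have j: "j < length as \<and> as ! j = as ! i" unfolding j_def by (rule someI[of _ i]) (use i in simp)
    have "Eq (Var j) (Var i) \<in> formulas M (length as + length [])"
      using i j by (simp add: formulas_def)
    from tp'[OF _ this] have "bs ! j = bs ! i" using j by simp
    then show ?thesis using i unfolding f_def j_def by simp
  qed
  have f2: "f x = x" if x: "x \<in> B" for x
  proof (cases "x \<in> set as")
    case True
    then obtain i where i: "i < length as" "as ! i = x" by (auto simp: in_set_conv_nth)
    have "Eq (Var i) (Var (length as)) \<in> formulas M (length as + length [x])"
      using i by (simp add: formulas_def)
    from tp'[OF _ this] have "bs ! i = x" using i x len by (simp add: nth_append)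
    then show ?thesis using f1[of i] i by simp
  qed (simp add: f_def)
  have "elementary_map M (B \<union> set as) f"
    unfolding elementary_map_def
  proof (intro conjI allI impI ballI)
    show "B \<union> set as \<subseteq> univ M" using U by auto
    show "f ` (B \<union> set as) \<subseteq> univ M"
      using U f2 f1 len by (auto simp: in_set_conv_nth) (metis nth_mem subsetD)
  next
    fix xs \<phi> assume xs: "set xs \<subseteq> B \<union> set as" and \<phi>: "\<phi> \<in> formulas M (length xs)"
    \<comment> \<open>Every entry of \<open>xs\<close> is an entry of \<open>as @ cs\<close>, and \<open>f\<close> sends it to the entry of
      \<open>bs @ cs\<close> at the same position.\<close>
    define cs where "cs = filter (\<lambda>x. x \<in> B) xs"
    have "\<forall>x \<in> set xs. \<exists>j. j < length (as @ cs) \<and> (as @ cs) ! j = x \<and> (bs @ cs) ! j = f x"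
    proof
      fix x assume x: "x \<in> set xs"
      show "\<exists>j. j < length (as @ cs) \<and> (as @ cs) ! j = x \<and> (bs @ cs) ! j = f x"
      proof (cases "x \<in> B")
        case True
        then have "x \<in> set cs" using x by (simp add: cs_def)
        then obtain i where i: "i < length cs" "cs ! i = x" by (auto simp: in_set_conv_nth)
        show ?thesis
          by (rule exI[of _ "length as + i"]) (use i True f2 len in \<open>auto simp: nth_append\<close>)
      next
        case False
        then have "x \<in> set as" using x xs by auto
        then obtain i where i: "i < length as" "as ! i = x" by (auto simp: in_set_conv_nth)
        then show ?thesis using f1[of i] len by (intro exI[of _ i]) (auto simp: nth_append)
      qed
    qed
    then obtain j where j: "\<And>x. x \<in> set xs \<Longrightarrow>
        j x < length (as @ cs) \<and> (as @ cs) ! j x = x \<and> (bs @ cs) ! j x = f x" by metis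
    have 1: "map (nth (as @ cs)) (map j xs) = xs" using j by (auto intro!: map_idI)
    have 2: "map (nth (bs @ cs)) (map j xs) = map f xs" using j by auto
    have \<psi>: "ren_fm (nth (map j xs)) \<phi> \<in> formulas M (length as + length cs)"
      by (rule ren_formulas[OF \<phi>]) (use j in force)
    have "satisfies M (nth xs) \<phi> \<longleftrightarrow> satisfies M (nth (as @ cs)) (ren_fm (nth (map j xs)) \<phi>)"
      using satisfies_reindex[of \<phi> M "map j xs" M "as @ cs"] \<phi> unfolding 1 by simp
    also have "\<dots> \<longleftrightarrow> satisfies M (nth (bs @ cs)) (ren_fm (nth (map j xs)) \<phi>)"
      by (rule tp'[OF _ \<psi>]) (auto simp: cs_def)
    also have "\<dots> \<longleftrightarrow> satisfies M (nth (map f xs)) \<phi>"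
      using satisfies_reindex[of \<phi> M "map j xs" M "bs @ cs"] \<phi> unfolding 2 by simp
    finally show "satisfies M (nth xs) \<phi> \<longleftrightarrow> satisfies M (nth (map f xs)) \<phi>" .
  qed
  then obtain \<sigma> where \<sigma>: "automorphism M \<sigma>" "\<forall>x \<in> B \<union> set as. \<sigma> x = f x"
    using hom small unfolding strongly_homogeneous_def by blast
  have "map \<sigma> as = bs" using \<sigma> f1 len by (intro nth_equalityI) auto
  then show ?thesis using \<sigma> f2 by (intro exI[of _ \<sigma>]) auto
qed

text \<open>Each formula of a type has finitely many parameters, so conjugacy over a small set can be
  tested on finite subsets. The automorphisms for the finite subsets need not be compatible with
  each other; only the equalities of types obtained from them are used.\<close>

lemma automorphism_from_finite:
  assumes M: "structure_ok M" "strongly_homogeneous \<kappa> M" and small: "|B \<union> set as| <o \<kappa>"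
    and U: "set as \<subseteq> univ M" "B \<subseteq> univ M"
    and fin: "\<And>X. finite X \<Longrightarrow> X \<subseteq> B \<Longrightarrow>
      \<exists>\<sigma>. automorphism M \<sigma> \<and> (\<forall>x \<in> X. \<sigma> x = x) \<and> map \<sigma> as = bs"
  shows "\<exists>\<sigma>. automorphism M \<sigma> \<and> (\<forall>x \<in> B. \<sigma> x = x) \<and> map \<sigma> as = bs"
proof -
  obtain \<sigma>' where "automorphism M \<sigma>'" "map \<sigma>' as = bs" using fin[of "{}"] by auto
  then have *: "set bs \<subseteq> univ M" "length as = length bs"
    using U automorphism_univ[of M \<sigma>'] by (auto dest!: subsetD[OF U(1)])
  have "tp M as B = tp M bs B"
    unfolding tp_eq_iff[OF *(2)]
  proof (intro allI impI ballI)
    fix cs \<phi> assume cs: "set cs \<subseteq> B" "\<phi> \<in> formulas M (length as + length cs)"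
    obtain \<sigma> where \<sigma>: "automorphism M \<sigma>" "\<forall>x \<in> set cs. \<sigma> x = x" "map \<sigma> as = bs"
      using fin[of "set cs"] cs by auto
    have "map \<sigma> (as @ cs) = bs @ cs" using \<sigma> by (auto intro: map_idI)
    then show "satisfies M (nth (as @ cs)) \<phi> \<longleftrightarrow> satisfies M (nth (bs @ cs)) \<phi>"
      using automorphism_satisfies_list[OF M(1) \<sigma>(1), of "as @ cs" \<phi>] U cs by auto
  qed
  then show ?thesis by (rule tp_eq_automorphism[OF M(2) small *(2) _ U(1) *(1) U(2)])
qed

section \<open>Structures interpretable in a monster model\<close>

text \<open>Saturation passes from \<open>S'\<close> to \<open>S\<close> by translating the formulas of \<open>S\<close>. Homogeneity also
  needs the converse translation, because an elementary map has to preserve all formulas of the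
  structure that it lives in; this is where the maps between the symbols must be onto.\<close>

lemma iso_along_lift_formula:
  assumes iso: "iso_along S S' h cf cr"
    and onto: "fsyms S' \<subseteq> cf ` fsyms S" "rsyms S' \<subseteq> cr ` rsyms S" and \<phi>: "\<phi>' \<in> formulas S' n"
  obtains \<phi> where "\<phi> \<in> formulas S n" "\<phi>' = map_fm cf cr \<phi>"
proof -
  define kf where "kf = inv_into (fsyms S) cf"
  define kr where "kr = inv_into (rsyms S) cr"
  have kf: "kf f \<in> fsyms S" "cf (kf f) = f" "farity S (kf f) = farity S' f" if "f \<in> fsyms S'" for f
  proof -
    have "f \<in> cf ` fsyms S" using that onto(1) by blast
    then show 1: "kf f \<in> fsyms S" "cf (kf f) = f"
      unfolding kf_def by (auto simp: f_inv_into_f inv_into_into)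
    then show "farity S (kf f) = farity S' f" using iso unfolding iso_along_def by metis
  qed
  have kr: "kr r \<in> rsyms S" "cr (kr r) = r" "rarity S (kr r) = rarity S' r" if "r \<in> rsyms S'" for r
  proof -
    have "r \<in> cr ` rsyms S" using that onto(2) by blast
    then show 1: "kr r \<in> rsyms S" "cr (kr r) = r"
      unfolding kr_def by (auto simp: f_inv_into_f inv_into_into)
    then show "rarity S (kr r) = rarity S' r" using iso unfolding iso_along_def by metis
  qed
  have tm: "wf_tm (fsyms S) (farity S) (map_tm kf t) \<and> map_tm cf (map_tm kf t) = t"
    if "wf_tm (fsyms S') (farity S') t" for t
    using that by (induction t) (auto simp: kf intro!: map_idI)
  have "wf_fm S (map_fm kf kr \<phi>) \<and> map_fm cf cr (map_fm kf kr \<phi>) = \<phi>" if "wf_fm S' \<phi>" for \<phi>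
    using that
  proof (induction \<phi>)
    case (Rel r ts)
    then have "map_tm cf (map_tm kf t) = t" if "t \<in> set ts" for t using tm that by simp
    then have "map (map_tm cf) (map (map_tm kf) ts) = ts" by (induction ts) auto
    with Rel tm kr show ?case by auto
  qed (auto simp: tm)
  then show ?thesis using that[of "map_fm kf kr \<phi>'"] \<phi> by (auto simp: formulas_def)
qed

lemma saturated_iso_along:
  fixes S :: "('g, 's, 'u) struct" and S' :: "('f, 'r, 'v) struct"
  assumes S: "structure_ok S" and iso: "iso_along S S' h cf cr" and sat: "saturated \<kappa> S'"
  shows "saturated \<kappa> S"
  unfolding saturated_def
proof (intro allI impI, elim conjE)
  fix A and p :: "(('g, 's) fm \<times> 'u list) set"
  assume A: "A \<subseteq> univ S" "|A| <o \<kappa>"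
    and p: "p \<subseteq> {(\<phi>, cs). set cs \<subseteq> A \<and> \<phi> \<in> formulas S (1 + length cs)}"
    and fin: "\<forall>q. finite q \<and> q \<subseteq> p \<longrightarrow>
        (\<exists>b\<in>univ S. \<forall>(\<phi>, cs)\<in>q. satisfies S (nth (b # cs)) \<phi>)"
  define H where "H = (\<lambda>(\<phi>, cs). (map_fm cf cr \<phi>, map h cs))"
  have h: "h ` univ S = univ S'" using iso by (auto simp: iso_along_def bij_betw_def)
  have H: "satisfies S' (nth (h b # snd (H z))) (fst (H z)) \<longleftrightarrow> satisfies S (nth (b # snd z)) (fst z)"
    if "z \<in> p" "b \<in> univ S" for z b
    using iso_along_satisfies_list[OF S iso, of "b # snd z" "fst z"] that p A
    by (auto simp: H_def split: prod.splits)
  have "|h ` A| <o \<kappa>" by (rule ordLeq_ordLess_trans[OF card_of_image A(2)])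
  moreover have "h ` A \<subseteq> univ S'" using A h by auto
  moreover have "H ` p \<subseteq> {(\<phi>, cs). set cs \<subseteq> h ` A \<and> \<phi> \<in> formulas S' (1 + length cs)}"
    using p by (fastforce simp: H_def intro: iso_along_formulas[OF iso])
  moreover have "\<exists>b\<in>univ S'. \<forall>(\<phi>, cs)\<in>q. satisfies S' (nth (b # cs)) \<phi>"
    if q: "finite q" "q \<subseteq> H ` p" for q
  proof -
    obtain q0 where q0: "finite q0" "q0 \<subseteq> p" "q = H ` q0" using finite_subset_image[OF q] by blast
    have "\<exists>b\<in>univ S. \<forall>(\<phi>, cs)\<in>q0. satisfies S (nth (b # cs)) \<phi>"
      by (rule fin[THEN spec, THEN mp]) (use q0 in simp)
    then obtain b where b: "b \<in> univ S" "\<forall>(\<phi>, cs)\<in>q0. satisfies S (nth (b # cs)) \<phi>"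
      by (rule bexE)
    have "satisfies S' (nth (h b # snd (H z))) (fst (H z))" if "z \<in> q0" for z
      using H[of z b] b that q0 by (auto split: prod.splits)
    then show ?thesis using b h unfolding q0(3) by (intro bexI[of _ "h b"]) (auto simp: case_prod_beta)
  qed
  ultimately have "\<exists>b\<in>univ S'. \<forall>(\<phi>, cs)\<in>H ` p. satisfies S' (nth (b # cs)) \<phi>"
    by (intro sat[unfolded saturated_def, rule_format, of "h ` A"] conjI) auto
  then obtain b' where "b' \<in> univ S'" and b': "\<forall>(\<phi>, cs)\<in>H ` p. satisfies S' (nth (b' # cs)) \<phi>"
    by (rule bexE)
  then obtain b where "b \<in> univ S" "b' = h b" using h by auto
  with b' have b: "b \<in> univ S" "\<forall>(\<phi>, cs)\<in>H ` p. satisfies S' (nth (h b # cs)) \<phi>"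
    by simp_all
  have "satisfies S (nth (b # snd z)) (fst z)" if "z \<in> p" for z
    using H[OF that b(1)] b that by (auto simp: case_prod_beta)
  then show "\<exists>b\<in>univ S. \<forall>(\<phi>, cs)\<in>p. satisfies S (nth (b # cs)) \<phi>" using b(1) by (intro bexI[of _ b]) auto
qed

lemma strongly_homogeneous_iso_along:
  fixes S :: "('g, 's, 'u) struct" and S' :: "('f, 'r, 'v) struct"
  assumes S: "structure_ok S" and iso: "iso_along S S' h cf cr"
    and onto: "fsyms S' \<subseteq> cf ` fsyms S" "rsyms S' \<subseteq> cr ` rsyms S"
    and hom: "strongly_homogeneous \<kappa> S'"
  shows "strongly_homogeneous \<kappa> S"
  unfolding strongly_homogeneous_def
proof (intro allI impI, elim conjE)
  fix A f assume A: "|A| <o \<kappa>" and f: "elementary_map S A f"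
  have bij: "bij_betw h (univ S) (univ S')" using iso by (simp add: iso_along_def)
  then have inj: "inj_on h (univ S)" and im: "h ` univ S = univ S'" by (auto simp: bij_betw_def)
  define g where "g = inv_into (univ S) h"
  have gh: "g (h x) = x" if "x \<in> univ S" for x using that inj by (simp add: g_def)
  have hg: "h (g y) = y" "g y \<in> univ S" if "y \<in> univ S'" for y
    using that im by (auto simp: g_def f_inv_into_f inv_into_into)
  have bijg: "bij_betw g (univ S') (univ S)" unfolding g_def by (rule bij_betw_inv_into[OF bij])
  have AU: "A \<subseteq> univ S" "f ` A \<subseteq> univ S" using f by (auto simp: elementary_map_def)
  have "elementary_map S' (h ` A) (h \<circ> f \<circ> g)"
    unfolding elementary_map_def
  proof (intro conjI allI impI ballI)
    show "h ` A \<subseteq> univ S'" using AU im by auto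
    have "h (f x) \<in> univ S'" if "x \<in> A" for x using AU im that by blast
    moreover have "g (h x) = x" if "x \<in> A" for x using AU gh that by blast
    ultimately show "(h \<circ> f \<circ> g) ` h ` A \<subseteq> univ S'" by auto
  next
    fix as' \<phi>' assume as': "set as' \<subseteq> h ` A" and \<phi>': "\<phi>' \<in> formulas S' (length as')"
    define as where "as = map g as'"
    have as: "set as \<subseteq> A" using as' AU gh by (fastforce simp: as_def)
    have 1: "map h as = as'" using as' AU hg im unfolding as_def map_map by (intro map_idI) (auto dest!: subsetD[OF as'] simp: gh subsetD[OF AU(1)])
    have 2: "map (h \<circ> f \<circ> g) as' = map h (map f as)" by (simp add: as_def)
    obtain \<phi> where \<phi>: "\<phi> \<in> formulas S (length as)" "\<phi>' = map_fm cf cr \<phi>"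
      using iso_along_lift_formula[OF iso onto \<phi>'] by (auto simp: as_def)
    have "satisfies S' (nth as') \<phi>' \<longleftrightarrow> satisfies S (nth as) \<phi>"
      using iso_along_satisfies_list[OF S iso _ \<phi>(1)] as AU unfolding 1 \<phi>(2) by blast
    also have "\<dots> \<longleftrightarrow> satisfies S (nth (map f as)) \<phi>"
      using f as \<phi> unfolding elementary_map_def by blast
    also have "\<dots> \<longleftrightarrow> satisfies S' (nth (map (h \<circ> f \<circ> g) as')) \<phi>'"
      using iso_along_satisfies_list[OF S iso, of "map f as" \<phi>] as AU \<phi> unfolding 2 by auto
    finally show "satisfies S' (nth as') \<phi>' \<longleftrightarrow> satisfies S' (nth (map (h \<circ> f \<circ> g) as')) \<phi>'" .
  qed
  moreover have "|h ` A| <o \<kappa>" by (rule ordLeq_ordLess_trans[OF card_of_image A])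
  ultimately obtain \<sigma>' where \<sigma>': "automorphism S' \<sigma>'" "\<forall>x \<in> h ` A. \<sigma>' x = (h \<circ> f \<circ> g) x"
    using hom unfolding strongly_homogeneous_def by blast
  define \<sigma> where "\<sigma> = g \<circ> \<sigma>' \<circ> h"
  have bij': "bij_betw \<sigma>' (univ S') (univ S')" using \<sigma>' by (simp add: automorphism_def)
  have h\<sigma>: "h (\<sigma> x) = \<sigma>' (h x)" if "x \<in> univ S" for x
    using that bij' im by (auto simp: \<sigma>_def bij_betw_def intro!: hg)
  have maps: "map h (map \<sigma> as) = map \<sigma>' (map h as)" "map h as \<in> tuples n (univ S')"
    "map \<sigma> as \<in> tuples n (univ S)"
    if "as \<in> tuples n (univ S)" for as n
  proof -
    have 1: "x \<in> univ S" if "x \<in> set as" for x using that \<open>as \<in> _\<close> by (auto simp: tuples_def)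
    then show "map h (map \<sigma> as) = map \<sigma>' (map h as)" using h\<sigma> by simp
    show 2: "map h as \<in> tuples n (univ S')" using that im by (auto simp: tuples_def)
    have "\<sigma> x \<in> univ S" if "x \<in> univ S" for x
      using that bij' bijg im by (auto simp: \<sigma>_def bij_betw_def)
    then show "map \<sigma> as \<in> tuples n (univ S)" using that by (auto simp: tuples_def)
  qed
  have "automorphism S \<sigma>"
    unfolding automorphism_def
  proof (intro conjI ballI)
    show "bij_betw \<sigma> (univ S) (univ S)"
      unfolding \<sigma>_def by (intro bij_betw_trans[OF bij] bij_betw_trans[OF bij'] bijg) 
  next
    fix s as assume s: "s \<in> fsyms S" "as \<in> tuples (farity S s) (univ S)"
    have [simp]: "cf s \<in> fsyms S'" "farity S' (cf s) = farity S s" using iso s by (auto simp: iso_along_def)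
    have eq: "h (fint S s xs) = fint S' (cf s) (map h xs)" if "xs \<in> tuples (farity S s) (univ S)" for xs
      using iso s that by (simp add: iso_along_def)
    have "h (fint S s (map \<sigma> as)) = fint S' (cf s) (map \<sigma>' (map h as))"
      using eq[OF maps(3)[OF s(2)]] by (simp only: maps(1)[OF s(2)])
    also have "\<dots> = \<sigma>' (fint S' (cf s) (map h as))"
      using \<sigma>'(1) maps(2)[OF s(2)] unfolding automorphism_def by simp
    also have "\<dots> = \<sigma>' (h (fint S s as))" using eq[OF s(2)] by simp
    finally have "g (h (fint S s (map \<sigma> as))) = \<sigma> (fint S s as)" by (simp add: \<sigma>_def)
    then show "\<sigma> (fint S s as) = fint S s (map \<sigma> as)"
      using gh[of "fint S s (map \<sigma> as)"] S s maps(3)[OF s(2)] by (simp add: structure_ok_def)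
  next
    fix s as assume s: "s \<in> rsyms S" "as \<in> tuples (rarity S s) (univ S)"
    have [simp]: "cr s \<in> rsyms S'" "rarity S' (cr s) = rarity S s" using iso s by (auto simp: iso_along_def)
    have eq: "rint S s xs \<longleftrightarrow> rint S' (cr s) (map h xs)" if "xs \<in> tuples (rarity S s) (univ S)" for xs
      using iso s that by (simp add: iso_along_def)
    have "rint S s (map \<sigma> as) \<longleftrightarrow> rint S' (cr s) (map \<sigma>' (map h as))"
      using eq[OF maps(3)[OF s(2)]] by (simp only: maps(1)[OF s(2)])
    also have "\<dots> \<longleftrightarrow> rint S' (cr s) (map h as)"
      using \<sigma>'(1) maps(2)[OF s(2)] unfolding automorphism_def by simp
    also have "\<dots> \<longleftrightarrow> rint S s as" using eq[OF s(2)] by simp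
    finally show "rint S s as \<longleftrightarrow> rint S s (map \<sigma> as)" by simp
  qed
  moreover have "\<sigma> x = f x" if "x \<in> A" for x
  proof -
    have "x \<in> univ S" "f x \<in> univ S" using that AU by auto
    then show ?thesis using \<sigma>'(2) that gh by (simp add: \<sigma>_def)
  qed
  ultimately show "\<exists>\<sigma>. automorphism S \<sigma> \<and> (\<forall>x \<in> A. \<sigma> x = f x)" by blast
qed

lemma concat_tuples_inj:
  assumes "length xs = length xs'" "\<And>x. x \<in> set xs \<union> set xs' \<Longrightarrow> length x = n" "concat xs = concat xs'"
  shows "xs = xs'"
  by (rule concat_injective[OF assms(3,1)]) (use assms(2) in \<open>auto dest: set_zip_leftD set_zip_rightD\<close>)

text \<open>An element of an interpretable structure is replaced by the set of tuples that represent
  it, and a symbol by its arity and a formula defining its preimage. Symbols that get the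
  same pair have the same interpretation.\<close>

lemma interpretable_monster:
  fixes S :: "('g, 's, 'u) struct" and M :: "('f, 'r, 'a) struct"
  assumes int: "interpretable S M" and mon: "monster \<kappa> M"
  shows "saturated \<kappa> S" "strongly_homogeneous \<kappa> S"
proof -
  obtain n D \<pi> where D: "definable M n D" "\<pi> ` D = univ S"
    and eqd: "definable M (2 * n) {x @ y | x y. x \<in> D \<and> y \<in> D \<and> \<pi> x = \<pi> y}"
    and fd: "\<And>f. f \<in> fsyms S \<Longrightarrow> definable M ((farity S f + 1) * n)
           {concat xs @ y | xs y. xs \<in> tuples (farity S f) D \<and> y \<in> D \<and> fint S f (map \<pi> xs) = \<pi> y}"
    and rd: "\<And>r. r \<in> rsyms S \<Longrightarrow> definable M (rarity S r * n)
           {concat xs | xs. xs \<in> tuples (rarity S r) D \<and> rint S r (map \<pi> xs)}"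
    and S: "structure_ok S"
    using int unfolding interpretable_def by auto
  have len: "length x = n" if "x \<in> D" for x using that D(1) by (auto simp: definable_def tuples_def)
  define Gf where "Gf f = {concat xs @ y | xs y. xs \<in> tuples (farity S f) D \<and> y \<in> D \<and> fint S f (map \<pi> xs) = \<pi> y}" for f
  define Gr where "Gr r = {concat xs | xs. xs \<in> tuples (rarity S r) D \<and> rint S r (map \<pi> xs)}" for r
  define dfm where "dfm m X = (SOME \<phi>. \<phi> \<in> formulas M m \<and> X = {as \<in> tuples m (univ M). satisfies M (nth as) \<phi>})"
    for m X
  have dfm: "X = Y" if "definable M m X" "definable M m Y" "dfm m X = dfm m Y" for m X Y
  proof -
    have "X = {as \<in> tuples m (univ M). satisfies M (nth as) (dfm m X)}" if "definable M m X" for X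
    proof -
      have "\<exists>\<phi>. \<phi> \<in> formulas M m \<and> X = {as \<in> tuples m (univ M). satisfies M (nth as) \<phi>}"
        using that unfolding definable_def by blast
      from someI_ex[OF this] show ?thesis unfolding dfm_def by blast
    qed
    then show ?thesis using that by metis
  qed
  define cf where "cf f = (farity S f, dfm ((farity S f + 1) * n) (Gf f))" for f
  define cr where "cr r = (rarity S r, dfm (rarity S r * n) (Gr r))" for r
  have sur: "\<exists>xs \<in> tuples m D. us = map \<pi> xs" if "us \<in> tuples m (univ S)" for us m
  proof -
    have "set us \<subseteq> \<pi> ` D" using that D by (auto simp: tuples_def)
    then have "us \<in> lists (\<pi> ` D)" by (simp add: in_lists_conv_set subset_iff)
    then obtain xs where "xs \<in> lists D" "us = map \<pi> xs" by (auto simp: lists_image)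
    then show ?thesis using that by (auto simp: tuples_def in_lists_conv_set)
  qed
  have cf: "farity S f = farity S f'" "us \<in> tuples (farity S f) (univ S) \<Longrightarrow> fint S f us = fint S f' us"
    if f: "f \<in> fsyms S" "f' \<in> fsyms S" "cf f = cf f'" for f f' us
  proof -
    show 1: "farity S f = farity S f'" using f by (simp add: cf_def)
    have "definable M ((farity S f + 1) * n) (Gf f)" "definable M ((farity S f + 1) * n) (Gf f')"
      using fd[OF f(1)] fd[OF f(2)] unfolding Gf_def 1 by auto
    then have G: "Gf f = Gf f'" by (rule dfm) (use f 1 in \<open>auto simp: cf_def\<close>)
    assume us: "us \<in> tuples (farity S f) (univ S)"
    then obtain xs where xs: "xs \<in> tuples (farity S f) D" "us = map \<pi> xs" using sur by blast
    have "fint S f us \<in> univ S" using S f us by (auto simp: structure_ok_def)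
    then obtain y where y: "y \<in> D" "fint S f us = \<pi> y" using D by auto
    have "concat xs @ y \<in> Gf f" using xs y by (auto simp: Gf_def)
    then obtain xs' y' where xs': "concat xs @ y = concat xs' @ y'" "xs' \<in> tuples (farity S f) D" "y' \<in> D"
      "fint S f' (map \<pi> xs') = \<pi> y'" unfolding G using 1 by (auto simp: Gf_def)
    have "length y = length y'" using xs' y len by simp
    with xs' have "y = y'" "concat xs = concat xs'" by auto
    moreover have "xs = xs'" by (rule concat_tuples_inj[OF _ _ calculation(2)]) (use xs xs' len in \<open>auto simp: tuples_def\<close>)
    ultimately show "fint S f us = fint S f' us" using xs' xs y by simp
  qed
  have cr: "rarity S r = rarity S r'" "us \<in> tuples (rarity S r) (univ S) \<Longrightarrow> rint S r us \<Longrightarrow> rint S r' us"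
    if r: "r \<in> rsyms S" "r' \<in> rsyms S" "cr r = cr r'" for r r' us
  proof -
    show 1: "rarity S r = rarity S r'" using r by (simp add: cr_def)
    have "definable M (rarity S r * n) (Gr r)" "definable M (rarity S r * n) (Gr r')"
      using rd[OF r(1)] rd[OF r(2)] unfolding Gr_def 1 by auto
    then have G: "Gr r = Gr r'" by (rule dfm) (use r 1 in \<open>auto simp: cr_def\<close>)
    assume us: "us \<in> tuples (rarity S r) (univ S)" "rint S r us"
    then obtain xs where xs: "xs \<in> tuples (rarity S r) D" "us = map \<pi> xs" using sur by blast
    have "concat xs \<in> Gr r" using xs us by (auto simp: Gr_def)
    then obtain xs' where xs': "concat xs = concat xs'" "xs' \<in> tuples (rarity S r) D" 
      "rint S r' (map \<pi> xs')" unfolding G using 1 by (auto simp: Gr_def)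
    have "xs = xs'" by (rule concat_tuples_inj[OF _ _ xs'(1)]) (use xs xs' len in \<open>auto simp: tuples_def\<close>)
    then show "rint S r' us" using xs' xs by simp
  qed
  \<comment> \<open>From here on \<open>S\<close> is replaced by the copy \<open>S'\<close>, of the type required by \<^const>\<open>monster\<close>.\<close>
  define h where "h u = {x \<in> D. \<pi> x = u}" for u
  have inj: "inj_on h (univ S)"
  proof (rule inj_onI)
    fix u v assume "u \<in> univ S" "v \<in> univ S" and eq: "h u = h v"
    then obtain x where "x \<in> D" "u = \<pi> x" using D(2) by blast
    then have "x \<in> h v" using eq by (auto simp: h_def)
    then show "u = v" using \<open>u = \<pi> x\<close> by (simp add: h_def)
  qed
  define k where "k = inv_into (univ S) h"
  have kh: "k (h u) = u" if "u \<in> univ S" for u using that inj by (simp add: k_def)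
  have mapkh: "map k (map h us) = us" if "us \<in> tuples m (univ S)" for us m
    using that kh by (auto simp: tuples_def intro!: map_idI)
  define kf where "kf = inv_into (fsyms S) cf"
  define kr where "kr = inv_into (rsyms S) cr"
  have kf: "kf (cf f) \<in> fsyms S" "cf (kf (cf f)) = cf f" if "f \<in> fsyms S" for f
    using that unfolding kf_def by (auto simp: f_inv_into_f inv_into_into)
  have kr: "kr (cr r) \<in> rsyms S" "cr (kr (cr r)) = cr r" if "r \<in> rsyms S" for r
    using that unfolding kr_def by (auto simp: f_inv_into_f inv_into_into)
  define S' :: "(nat \<times> ('f, 'r) fm, nat \<times> ('f, 'r) fm, 'a list set) struct" where
    "S' = \<lparr>fsyms = cf ` fsyms S, rsyms = cr ` rsyms S, farity = fst, rarity = fst, univ = h ` univ S,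
       fint = (\<lambda>c us. h (fint S (kf c) (map k us))), rint = (\<lambda>c us. rint S (kr c) (map k us))\<rparr>"
  have kfint: "fint S (kf (cf f)) us = fint S f us" if "f \<in> fsyms S" "us \<in> tuples (farity S f) (univ S)" for f us
    using cf(2)[of f "kf (cf f)" us] kf[OF that(1)] that by simp
  have krint: "rint S (kr (cr r)) us \<longleftrightarrow> rint S r us" if "r \<in> rsyms S" "us \<in> tuples (rarity S r) (univ S)" for r us
    using cr(1)[of r "kr (cr r)"] cr(2)[of r "kr (cr r)" us] cr(2)[of "kr (cr r)" r us] kr[OF that(1)] that by auto
  have iso: "iso_along S S' h cf cr"
    unfolding iso_along_def
  proof (intro conjI ballI)
    fix f as assume "f \<in> fsyms S" "as \<in> tuples (farity S f) (univ S)"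
    then show "h (fint S f as) = fint S' (cf f) (map h as)" 
      unfolding S'_def struct.simps mapkh[OF \<open>as \<in> _\<close>] by (simp add: kfint)
  next
    fix r as assume "r \<in> rsyms S" "as \<in> tuples (rarity S r) (univ S)"
    then show "rint S r as \<longleftrightarrow> rint S' (cr r) (map h as)" 
      unfolding S'_def struct.simps mapkh[OF \<open>as \<in> _\<close>] by (simp add: krint)
  qed (use inj in \<open>auto simp: S'_def cf_def cr_def bij_betw_def\<close>)
  have isof: "fint S' (cf f) (map h us) = h (fint S f us)"
    if "f \<in> fsyms S" "us \<in> tuples (farity S f) (univ S)" for f us
    using iso that unfolding iso_along_def by metis
  have isor: "rint S' (cr r) (map h us) \<longleftrightarrow> rint S r us"
    if "r \<in> rsyms S" "us \<in> tuples (rarity S r) (univ S)" for r us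
    using iso that unfolding iso_along_def by metis
  have \<pi>: "(h \<circ> \<pi>) x = h u \<longleftrightarrow> \<pi> x = u" if "x \<in> D" "u \<in> univ S" for x u
    using that inj D(2) by (auto simp: inj_on_def)
  have map\<pi>: "map \<pi> xs \<in> tuples m (univ S)" if "xs \<in> tuples m D" for xs m
    using that D(2) by (auto simp: tuples_def)
  have "interpretable S' M"
    unfolding interpretable_def
  proof (intro conjI)
    have "h (fint S (kf (cf f)) (map k us)) \<in> h ` univ S"
      if f: "f \<in> fsyms S" and us: "us \<in> tuples (farity S f) (h ` univ S)" for f us
    proof -
      have "map k us \<in> tuples (farity S f) (univ S)" using us kh by (auto simp: tuples_def subset_iff image_iff)
      moreover have "farity S (kf (cf f)) = farity S f" using cf(1) kf f by blast
      ultimately show ?thesis using S kf f unfolding structure_ok_def by simp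
    qed
    then show "structure_ok S'" using S by (auto simp: structure_ok_def S'_def cf_def)
    show "\<exists>n D \<pi>. definable M n D \<and> \<pi> ` D = univ S' \<and>
        definable M (2 * n) {x @ y | x y. x \<in> D \<and> y \<in> D \<and> \<pi> x = \<pi> y} \<and>
        (\<forall>f \<in> fsyms S'. definable M ((farity S' f + 1) * n)
           {concat xs @ y | xs y. xs \<in> tuples (farity S' f) D \<and> y \<in> D \<and> fint S' f (map \<pi> xs) = \<pi> y}) \<and>
        (\<forall>r \<in> rsyms S'. definable M (rarity S' r * n)
           {concat xs | xs. xs \<in> tuples (rarity S' r) D \<and> rint S' r (map \<pi> xs)})"
    proof (intro exI[of _ n] exI[of _ D] exI[of _ "h \<circ> \<pi>"] conjI ballI)
      show "definable M n D" by (rule D)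
      show "(h \<circ> \<pi>) ` D = univ S'" unfolding S'_def D(2)[symmetric] image_comp by simp
      have "{x @ y | x y. x \<in> D \<and> y \<in> D \<and> (h \<circ> \<pi>) x = (h \<circ> \<pi>) y} =
          {x @ y | x y. x \<in> D \<and> y \<in> D \<and> \<pi> x = \<pi> y}"
      proof -
        have "h (\<pi> x) = h (\<pi> y) \<longleftrightarrow> \<pi> x = \<pi> y" if "x \<in> D" "y \<in> D" for x y
          using \<pi>[of x "\<pi> y"] D(2) that by auto
        then show ?thesis by (simp cong: conj_cong)
      qed
      then show "definable M (2 * n) {x @ y | x y. x \<in> D \<and> y \<in> D \<and> (h \<circ> \<pi>) x = (h \<circ> \<pi>) y}"
        using eqd by simp
    next
      fix c assume "c \<in> fsyms S'"
      then obtain f where f: "f \<in> fsyms S" "c = cf f" by (auto simp: S'_def)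
      have ar [simp]: "farity S' c = farity S f" by (simp add: S'_def f cf_def)
      have "fint S' c (map (h \<circ> \<pi>) xs) = (h \<circ> \<pi>) y \<longleftrightarrow> fint S f (map \<pi> xs) = \<pi> y"
        if "xs \<in> tuples (farity S f) D" "y \<in> D" for xs y
      proof -
        have "fint S' c (map (h \<circ> \<pi>) xs) = h (fint S f (map \<pi> xs))"
          using isof[OF f(1) map\<pi>[OF that(1)]] by (simp only: f(2) map_map)
        moreover have "fint S f (map \<pi> xs) \<in> univ S" using S f map\<pi>[OF that(1)] by (auto simp: structure_ok_def)
        ultimately show ?thesis using \<pi>[OF that(2), of "fint S f (map \<pi> xs)"] by metis
      qed
      then have "{concat xs @ y | xs y. xs \<in> tuples (farity S' c) D \<and> y \<in> D \<and> fint S' c (map (h \<circ> \<pi>) xs) = (h \<circ> \<pi>) y}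
         = Gf f" unfolding Gf_def ar by (intro Collect_cong ex_cong1 conj_cong refl)
      then show "definable M ((farity S' c + 1) * n)
         {concat xs @ y | xs y. xs \<in> tuples (farity S' c) D \<and> y \<in> D \<and> fint S' c (map (h \<circ> \<pi>) xs) = (h \<circ> \<pi>) y}"
        using fd[OF f(1)] by (simp add: Gf_def)
    next
      fix c assume "c \<in> rsyms S'"
      then obtain r where r: "r \<in> rsyms S" "c = cr r" by (auto simp: S'_def)
      have ar [simp]: "rarity S' c = rarity S r" by (simp add: S'_def r cr_def)
      have "rint S' c (map (h \<circ> \<pi>) xs) \<longleftrightarrow> rint S r (map \<pi> xs)"
        if "xs \<in> tuples (rarity S r) D" for xs
      proof -
        show ?thesis
          using isor[OF r(1) map\<pi>[OF that]] by (simp only: r(2) map_map)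
      qed
      then have "{concat xs | xs. xs \<in> tuples (rarity S' c) D \<and> rint S' c (map (h \<circ> \<pi>) xs)} = Gr r"
        unfolding Gr_def ar by (intro Collect_cong ex_cong1 conj_cong refl)
      then show "definable M (rarity S' c * n)
         {concat xs | xs. xs \<in> tuples (rarity S' c) D \<and> rint S' c (map (h \<circ> \<pi>) xs)}"
        using rd[OF r(1)] by (simp add: Gr_def)
    qed
  qed
  then have "saturated \<kappa> S'" "strongly_homogeneous \<kappa> S'" using mon unfolding monster_def by auto
  then show "saturated \<kappa> S" "strongly_homogeneous \<kappa> S"
    using saturated_iso_along[OF S iso] strongly_homogeneous_iso_along[OF S iso] by (auto simp: S'_def)
qed

section \<open>Definable structures\<close>

text \<open>Formulas for relations between valuations with values in a definable set \<open>U\<close>. Working with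
  valuations instead of tuples makes the substitution of terms a matter of quantifying over a
  fresh variable.\<close>

definition expressible ::
  "('f, 'r, 'a) struct \<Rightarrow> 'a set \<Rightarrow> nat set \<Rightarrow> ((nat \<Rightarrow> 'a) \<Rightarrow> bool) \<Rightarrow> bool" where
  "expressible M U V X \<longleftrightarrow> (\<exists>\<phi>. wf_fm M \<phi> \<and> fm_free \<phi> \<subseteq> V \<and>
     (\<forall>s. (\<forall>i. s i \<in> U) \<longrightarrow> (X s \<longleftrightarrow> satisfies M s \<phi>)))"

lemma expressible_Neg: "expressible M U V X \<Longrightarrow> expressible M U V (\<lambda>s. \<not> X s)"
  unfolding expressible_def by (metis fm_free.simps(3) satisfies.simps(3) wf_fm.simps(3))

lemma expressible_Conj:
  assumes "expressible M U V X" "expressible M U W Y"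
  shows "expressible M U (V \<union> W) (\<lambda>s. X s \<and> Y s)"
proof -
  obtain \<phi> \<psi> where "wf_fm M \<phi>" "fm_free \<phi> \<subseteq> V" "\<forall>s. (\<forall>i. s i \<in> U) \<longrightarrow> (X s \<longleftrightarrow> satisfies M s \<phi>)"
    "wf_fm M \<psi>" "fm_free \<psi> \<subseteq> W" "\<forall>s. (\<forall>i. s i \<in> U) \<longrightarrow> (Y s \<longleftrightarrow> satisfies M s \<psi>)"
    using assms unfolding expressible_def by blast
  then show ?thesis unfolding expressible_def by (intro exI[of _ "Conj \<phi> \<psi>"]) auto
qed

lemma expressible_mono: "expressible M U V X \<Longrightarrow> V \<subseteq> W \<Longrightarrow> expressible M U W X"
  unfolding expressible_def by blast

lemma expressible_cong:
  "expressible M U V X \<Longrightarrow> (\<And>s. (\<And>i. s i \<in> U) \<Longrightarrow> X s \<longleftrightarrow> Y s) \<Longrightarrow> expressible M U V Y"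
  unfolding expressible_def by metis

lemma expressible_definable:
  assumes "definable M n X" "U \<subseteq> univ M" "length zs = n"
  shows "expressible M U (set zs) (\<lambda>s. map s zs \<in> X)"
proof -
  obtain \<phi> where \<phi>: "\<phi> \<in> formulas M n" "X = {as \<in> tuples n (univ M). satisfies M (nth as) \<phi>}"
    using assms(1) unfolding definable_def by blast
  have "map s zs \<in> X \<longleftrightarrow> satisfies M s (ren_fm (nth zs) \<phi>)" if "\<forall>i. s i \<in> U" for s
  proof -
    have "map s zs \<in> tuples n (univ M)" using that assms by (auto simp: tuples_def)
    moreover have "satisfies M (nth (map s zs)) \<phi> \<longleftrightarrow> satisfies M (s \<circ> nth zs) \<phi>"
      by (rule satisfies_formulas_cong[OF \<phi>(1)]) (simp add: assms)
    ultimately show ?thesis by (simp add: \<phi>(2) satisfies_ren_fm)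
  qed
  moreover have "fm_free (ren_fm (nth zs) \<phi>) \<subseteq> set zs"
    using free_ren_fm[of "nth zs" \<phi>] \<phi>(1) assms(3) by (fastforce simp: formulas_def)
  ultimately show ?thesis using \<phi>(1) unfolding expressible_def
    by (intro exI[of _ "ren_fm (nth zs) \<phi>"]) (auto simp: formulas_def)
qed

lemma expressible_Ex:
  assumes "expressible M U V X" and U: "definable M 1 {[x] | x. x \<in> U}" "U \<subseteq> univ M"
  shows "expressible M U (V - {x}) (\<lambda>s. \<exists>a \<in> U. X (s(x := a)))"
proof -
  obtain \<phi> where \<phi>: "wf_fm M \<phi>" "fm_free \<phi> \<subseteq> V" "\<And>s. (\<forall>i. s i \<in> U) \<Longrightarrow> (X s \<longleftrightarrow> satisfies M s \<phi>)"
    using assms unfolding expressible_def by blast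
  have "expressible M (univ M) {x} (\<lambda>s. s x \<in> U)"
    using expressible_definable[OF U(1) order.refl, of "[x]"] by simp
  then obtain \<psi> where \<psi>: "wf_fm M \<psi>" "fm_free \<psi> \<subseteq> {x}"
      "\<And>s. (\<forall>i. s i \<in> univ M) \<Longrightarrow> (s x \<in> U \<longleftrightarrow> satisfies M s \<psi>)"
    unfolding expressible_def by blast
  have "(\<exists>a \<in> U. X (s(x := a))) \<longleftrightarrow> satisfies M s (Ex x (Conj \<psi> \<phi>))" if s: "\<forall>i. s i \<in> U" for s
  proof -
    have "satisfies M (s(x := a)) \<psi> \<longleftrightarrow> a \<in> U" if "a \<in> univ M" for a
    proof -
      have "\<forall>i. (s(x := a)) i \<in> univ M" using that s U(2) by auto
      from \<psi>(3)[of "s(x := a)", OF this] show ?thesis by simp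
    qed
    moreover have "satisfies M (s(x := a)) \<phi> \<longleftrightarrow> X (s(x := a))" if "a \<in> U" for a
    proof -
      have "\<forall>i. (s(x := a)) i \<in> U" using that s by auto
      from \<phi>(3)[of "s(x := a)", OF this] show ?thesis by simp
    qed
    ultimately show ?thesis using U(2) unfolding satisfies.simps by blast
  qed
  then show ?thesis unfolding expressible_def
    using \<phi> \<psi> by (intro exI[of _ "Ex x (Conj \<psi> \<phi>)"]) auto
qed

lemma definable_expressible:
  assumes X: "expressible M U {..<n} (\<lambda>s. P (map s [0..<n]))"
    and U: "definable M 1 {[x] | x. x \<in> U}" "U \<subseteq> univ M" "U \<noteq> {}"
  shows "definable M n {as \<in> tuples n U. P as}"
proof -
  obtain \<phi> where \<phi>: "wf_fm M \<phi>" "fm_free \<phi> \<subseteq> {..<n}"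
    "\<And>s. (\<forall>i. s i \<in> U) \<Longrightarrow> (P (map s [0..<n]) \<longleftrightarrow> satisfies M s \<phi>)"
    using X unfolding expressible_def by blast
  have "expressible M (univ M) {..<k} (\<lambda>s. \<forall>i < k. s i \<in> U)" for k
  proof (induction k)
    case 0
    show ?case unfolding expressible_def by (rule exI[of _ True_fm]) simp
  next
    case (Suc k)
    have "expressible M (univ M) {k} (\<lambda>s. s k \<in> U)"
      using expressible_definable[OF U(1) order.refl, of "[k]"] by simp
    from expressible_Conj[OF Suc this] show ?case
      by (rule expressible_cong[OF expressible_mono]) (auto simp: less_Suc_eq)
  qed
  then obtain \<psi> where \<psi>: "wf_fm M \<psi>" "fm_free \<psi> \<subseteq> {..<n}"
    "\<And>s. (\<forall>i. s i \<in> univ M) \<Longrightarrow> ((\<forall>i < n. s i \<in> U) \<longleftrightarrow> satisfies M s \<psi>)"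
    unfolding expressible_def by blast
  obtain u where u: "u \<in> U" using U(3) by blast
  have "as \<in> tuples n U \<and> P as \<longleftrightarrow> as \<in> tuples n (univ M) \<and> satisfies M (nth as) (Conj \<psi> \<phi>)" for as
  proof (cases "as \<in> tuples n (univ M)")
    case True
    define s where "s i = (if i < n then as ! i else u)" for i
    have len: "length as = n" using True by (simp add: tuples_def)
    have s: "s i \<in> univ M" for i using True u U(2) by (auto simp: s_def tuples_def)
    have "satisfies M (nth as) \<psi> \<longleftrightarrow> satisfies M s \<psi>"
      using \<psi>(2) by (intro satisfies_cong) (auto simp: s_def)
    moreover have "satisfies M (nth as) \<phi> \<longleftrightarrow> satisfies M s \<phi>"
      using \<phi>(2) by (intro satisfies_cong) (auto simp: s_def)
    moreover have "as \<in> tuples n U \<longleftrightarrow> (\<forall>i < n. s i \<in> U)"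
      using len by (auto simp: s_def tuples_def subset_iff in_set_conv_nth)
    moreover have "map s [0..<n] = as" using len by (intro nth_equalityI) (auto simp: s_def)
    moreover have "\<forall>i. s i \<in> U" if "\<forall>i < n. s i \<in> U" using that u by (auto simp: s_def)
    ultimately show ?thesis using \<psi>(3)[of s] \<phi>(3)[of s] s True by auto
  next
    case False
    then show ?thesis using U(2) by (auto simp: tuples_def)
  qed
  then show ?thesis unfolding definable_def using \<phi> \<psi>
    by (intro bexI[of _ "Conj \<psi> \<phi>"]) (auto simp: formulas_def)
qed

definition definable_structure :: "('g, 's, 'a) struct \<Rightarrow> ('f, 'r, 'a) struct \<Rightarrow> bool" where
  "definable_structure S M \<longleftrightarrow> structure_ok S \<and> univ S \<subseteq> univ M \<and>
     definable M 1 {[x] | x. x \<in> univ S} \<and> symbols_definable_in S M"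

text \<open>Terms of \<open>S\<close> are eliminated from a list of arguments one at a time: a fresh variable stands
  for the value of the first term and joins the variables in front of it. The variables \<open>ws\<close> at
  the end leave room for the value of a function.\<close>

lemma expressible_terms:
  fixes S :: "('g, 's, 'a) struct" and M :: "('f, 'r, 'a) struct"
  assumes S: "structure_ok S" and U: "definable M 1 {[x] | x. x \<in> univ S}" "univ S \<subseteq> univ M"
    and ts: "\<And>t y. t \<in> set ts \<Longrightarrow> wf_tm (fsyms S) (farity S) t \<and>
        expressible M (univ S) (insert y (tm_vars t)) (\<lambda>s. s y = eval_tm (fint S) s t)"
    and X: "definable M n X" "length zs + length ts + length ws = n"
  shows "expressible M (univ S) (set zs \<union> (\<Union>t \<in> set ts. tm_vars t) \<union> set ws)
     (\<lambda>s. map s zs @ map (eval_tm (fint S) s) ts @ map s ws \<in> X)"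
  using ts X(2)
proof (induction ts arbitrary: zs)
  case Nil
  show ?case using expressible_definable[OF X(1) U(2), of "zs @ ws"] Nil by simp
next
  case (Cons t ts)
  let ?V = "set zs \<union> (\<Union>t \<in> set (t # ts). tm_vars t) \<union> set ws"
  define y where "y = fresh ?V"
  have y: "y \<notin> ?V" unfolding y_def by (rule fresh) simp
  have "expressible M (univ S) (set (zs @ [y]) \<union> (\<Union>t \<in> set ts. tm_vars t) \<union> set ws)
     (\<lambda>s. map s (zs @ [y]) @ map (eval_tm (fint S) s) ts @ map s ws \<in> X)"
    using Cons.prems by (intro Cons.IH) auto
  moreover have "expressible M (univ S) (insert y (tm_vars t)) (\<lambda>s. s y = eval_tm (fint S) s t)"
    using Cons.prems(1)[of t y] by simp
  ultimately have "expressible M (univ S) (insert y ?V) (\<lambda>s. s y = eval_tm (fint S) s t \<and>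
      map s (zs @ [y]) @ map (eval_tm (fint S) s) ts @ map s ws \<in> X)"
    by (intro expressible_mono[OF expressible_Conj]) auto
  from expressible_Ex[OF this U, of y]
  have "expressible M (univ S) ?V (\<lambda>s. \<exists>a \<in> univ S. (s(y := a)) y = eval_tm (fint S) (s(y := a)) t \<and>
      map (s(y := a)) (zs @ [y]) @ map (eval_tm (fint S) (s(y := a))) ts @ map (s(y := a)) ws \<in> X)"
    by (rule expressible_mono) auto
  then show ?case
  proof (rule expressible_cong)
    fix s :: "nat \<Rightarrow> 'a" assume s: "\<And>i. s i \<in> univ S"
    have t: "eval_tm (fint S) s t \<in> univ S"
      by (rule eval_tm_univ[of "fsyms S" "farity S"])
        (use S s Cons.prems(1)[of t] in \<open>auto simp: structure_ok_def\<close>)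
    have "eval_tm (fint S) (s(y := a)) t' = eval_tm (fint S) s t'" if "t' \<in> set (t # ts)" for t' a
      by (rule eval_tm_cong) (use y that in auto)
    moreover have "map (s(y := a)) zs = map s zs" "map (s(y := a)) ws = map s ws" for a
      using y by auto
    ultimately show "(\<exists>a \<in> univ S. (s(y := a)) y = eval_tm (fint S) (s(y := a)) t \<and>
      map (s(y := a)) (zs @ [y]) @ map (eval_tm (fint S) (s(y := a))) ts @ map (s(y := a)) ws \<in> X) \<longleftrightarrow>
      map s zs @ map (eval_tm (fint S) s) (t # ts) @ map s ws \<in> X"
      using t by (simp cong: map_cong)
  qed
qed

lemma expressible_term_graph:
  fixes S :: "('g, 's, 'a) struct" and M :: "('f, 'r, 'a) struct"
  assumes S: "definable_structure S M" and "wf_tm (fsyms S) (farity S) t"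
  shows "expressible M (univ S) (insert y (tm_vars t)) (\<lambda>s. s y = eval_tm (fint S) s t)"
  using assms(2)
proof (induction t arbitrary: y)
  case (Var i)
  show ?case unfolding expressible_def by (rule exI[of _ "Eq (Var y) (Var i)"]) auto
next
  case (Fn f ts)
  let ?X = "graph (farity S f) (univ S) (fint S f)"
  have X: "definable M (farity S f + 1) ?X"
    using S Fn.prems by (auto simp: definable_structure_def symbols_definable_in_def)
  have "expressible M (univ S) (set [] \<union> (\<Union>t \<in> set ts. tm_vars t) \<union> set [y])
     (\<lambda>s. map s [] @ map (eval_tm (fint S) s) ts @ map s [y] \<in> ?X)"
    by (rule expressible_terms[OF _ _ _ _ X])
      (use S Fn in \<open>auto simp: definable_structure_def\<close>)
  then show ?case
  proof (rule expressible_cong[OF expressible_mono])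
    fix s :: "nat \<Rightarrow> 'a" assume s: "\<And>i. s i \<in> univ S"
    have "eval_tm (fint S) s t \<in> univ S" if "t \<in> set ts" for t
      by (rule eval_tm_univ[of "fsyms S" "farity S"])
        (use S s Fn.prems that in \<open>auto simp: definable_structure_def structure_ok_def\<close>)
    then have "map (eval_tm (fint S) s) ts \<in> tuples (farity S f) (univ S)"
      using Fn.prems by (auto simp: tuples_def)
    then show "(map s [] @ map (eval_tm (fint S) s) ts @ map s [y] \<in> ?X) \<longleftrightarrow>
        s y = eval_tm (fint S) s (Fn f ts)"
      by (auto simp: graph_def)
  qed auto
qed

lemma expressible_formula:
  fixes S :: "('g, 's, 'a) struct" and M :: "('f, 'r, 'a) struct"
  assumes S: "definable_structure S M" and "wf_fm S \<phi>"
  shows "expressible M (univ S) (fm_free \<phi>) (\<lambda>s. satisfies S s \<phi>)"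
proof -
  have U: "structure_ok S" "definable M 1 {[x] | x. x \<in> univ S}" "univ S \<subseteq> univ M"
    using S by (auto simp: definable_structure_def)
  show ?thesis using assms(2)
  proof (induction \<phi>)
    case (Eq t u)
    define y where "y = fresh (tm_vars t \<union> tm_vars u)"
    have y: "y \<notin> tm_vars t \<union> tm_vars u" unfolding y_def by (rule fresh) simp
    from expressible_Ex[OF expressible_Conj[OF expressible_term_graph[OF S, of t y] expressible_term_graph[OF S, of u y]] U(2,3), of y]
    have "expressible M (univ S) (tm_vars t \<union> tm_vars u)
        (\<lambda>s. \<exists>a \<in> univ S. (s(y := a)) y = eval_tm (fint S) (s(y := a)) t \<and>
                         (s(y := a)) y = eval_tm (fint S) (s(y := a)) u)"
      by (rule expressible_mono) (use Eq in auto)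
    then show ?case unfolding fm_free.simps
    proof (rule expressible_cong)
      fix s :: "nat \<Rightarrow> 'a" assume s: "\<And>i. s i \<in> univ S"
      have t: "eval_tm (fint S) s t \<in> univ S"
        by (rule eval_tm_univ[of "fsyms S" "farity S"]) (use U s Eq in \<open>auto simp: structure_ok_def\<close>)
      have "eval_tm (fint S) (s(y := a)) t = eval_tm (fint S) s t"
           "eval_tm (fint S) (s(y := a)) u = eval_tm (fint S) s u" for a
        by (rule eval_tm_cong; use y in auto)+
      then show "(\<exists>a \<in> univ S. (s(y := a)) y = eval_tm (fint S) (s(y := a)) t \<and>
                         (s(y := a)) y = eval_tm (fint S) (s(y := a)) u) \<longleftrightarrow> satisfies S s (Eq t u)"
        using t by auto
    qed
  next
    case (Rel r ts)
    let ?X = "{as \<in> tuples (rarity S r) (univ S). rint S r as}"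
    have X: "definable M (rarity S r) ?X"
      using S Rel.prems by (auto simp: definable_structure_def symbols_definable_in_def)
    have "expressible M (univ S) (set [] \<union> (\<Union>t \<in> set ts. tm_vars t) \<union> set [])
       (\<lambda>s. map s [] @ map (eval_tm (fint S) s) ts @ map s [] \<in> ?X)"
      by (rule expressible_terms[OF _ _ _ _ X])
        (use U Rel expressible_term_graph[OF S] in auto)
    then show ?case
    proof (rule expressible_cong[OF expressible_mono])
      fix s :: "nat \<Rightarrow> 'a" assume s: "\<And>i. s i \<in> univ S"
      have "eval_tm (fint S) s t \<in> univ S" if "t \<in> set ts" for t
        by (rule eval_tm_univ[of "fsyms S" "farity S"])
          (use U s Rel.prems that in \<open>auto simp: structure_ok_def\<close>)
      then have "map (eval_tm (fint S) s) ts \<in> tuples (rarity S r) (univ S)"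
        using Rel.prems by (auto simp: tuples_def)
      then show "(map s [] @ map (eval_tm (fint S) s) ts @ map s [] \<in> ?X) \<longleftrightarrow>
          satisfies S s (Rel r ts)"
        by auto
    qed auto
  next
    case (Neg \<phi>)
    then show ?case using expressible_Neg by fastforce
  next
    case (Conj \<phi> \<psi>)
    then show ?case using expressible_Conj by fastforce
  next
    case (Ex x \<phi>)
    then show ?case using expressible_Ex[OF _ U(2,3)] by fastforce
  qed
qed

lemma definable_trans:
  assumes S: "definable_structure S M" and X: "definable S n X"
  shows "definable M n X"
proof -
  obtain \<phi> where \<phi>: "\<phi> \<in> formulas S n" "X = {as \<in> tuples n (univ S). satisfies S (nth as) \<phi>}"
    using X unfolding definable_def by blast
  have "expressible M (univ S) {..<n} (\<lambda>s. satisfies S (nth (map s [0..<n])) \<phi>)"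
  proof (rule expressible_cong[OF expressible_mono[OF expressible_formula[OF S]]])
    show "satisfies S s \<phi> \<longleftrightarrow> satisfies S (nth (map s [0..<n])) \<phi>" for s
      by (rule satisfies_formulas_cong[OF \<phi>(1)]) simp
  qed (use \<phi>(1) in \<open>auto simp: formulas_def\<close>)
  then show ?thesis unfolding \<phi>(2)
    by (rule definable_expressible) (use S in \<open>auto simp: definable_structure_def structure_ok_def\<close>)
qed

lemma automorphism_definable:
  assumes M: "structure_ok M" "automorphism M \<sigma>" and X: "definable M n X"
    and as: "as \<in> tuples n (univ M)"
  shows "map \<sigma> as \<in> X \<longleftrightarrow> as \<in> X"
proof -
  obtain \<phi> where \<phi>: "\<phi> \<in> formulas M n" "X = {as \<in> tuples n (univ M). satisfies M (nth as) \<phi>}"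
    using X unfolding definable_def by blast
  have "map \<sigma> as \<in> tuples n (univ M)" using as automorphism_univ[OF M(2)] by (auto simp: tuples_def)
  then show ?thesis using automorphism_satisfies_list[OF M, of as \<phi>] as \<phi> by (auto simp: tuples_def)
qed

lemma automorphism_definable_structure:
  fixes S :: "('g, 's, 'a) struct" and M :: "('f, 'r, 'a) struct"
  assumes M: "structure_ok M" and \<sigma>: "automorphism M \<sigma>" and S: "definable_structure S M"
  shows "automorphism S \<sigma>"
proof -
  have U: "univ S \<subseteq> univ M" using S by (simp add: definable_structure_def)
  have iff: "\<sigma> x \<in> univ S \<longleftrightarrow> x \<in> univ S" if "x \<in> univ M" for x
    using automorphism_definable[OF M \<sigma>, of 1 "{[x] | x. x \<in> univ S}" "[x]"] S that
    by (auto simp: definable_structure_def tuples_def)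
  have tup: "as \<in> tuples n (univ M)" "map \<sigma> as \<in> tuples n (univ S)" if "as \<in> tuples n (univ S)" for as n
    using that U iff by (auto simp: tuples_def)
  have inj: "inj_on \<sigma> (univ M)" and im: "\<sigma> ` univ M = univ M"
    using \<sigma> by (auto simp: automorphism_def bij_betw_def)
  show ?thesis
    unfolding automorphism_def
  proof (intro conjI ballI)
    have "univ S \<subseteq> \<sigma> ` univ S"
    proof
      fix y assume y: "y \<in> univ S"
      then obtain x where "x \<in> univ M" "y = \<sigma> x" using im U by blast
      then show "y \<in> \<sigma> ` univ S" using iff y by blast
    qed
    moreover have "\<sigma> ` univ S \<subseteq> univ S" using iff U by auto
    ultimately show "bij_betw \<sigma> (univ S) (univ S)"
      using inj_on_subset[OF inj U] by (simp add: bij_betw_def)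
  next
    fix f as assume f: "f \<in> fsyms S" "as \<in> tuples (farity S f) (univ S)"
    let ?X = "graph (farity S f) (univ S) (fint S f)"
    have X: "definable M (farity S f + 1) ?X"
      using S f by (auto simp: definable_structure_def symbols_definable_in_def)
    have "fint S f as \<in> univ S" using S f by (auto simp: definable_structure_def structure_ok_def)
    then have "as @ [fint S f as] \<in> tuples (farity S f + 1) (univ M)"
      using f U by (auto simp: tuples_def)
    moreover have "as @ [fint S f as] \<in> ?X" using f by (auto simp: graph_def)
    ultimately have "map \<sigma> (as @ [fint S f as]) \<in> ?X"
      using automorphism_definable[OF M \<sigma> X] by blast
    then show "\<sigma> (fint S f as) = fint S f (map \<sigma> as)" by (auto simp: graph_def)
  next
    fix r as assume r: "r \<in> rsyms S" "as \<in> tuples (rarity S r) (univ S)"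
    have "definable M (rarity S r) {as \<in> tuples (rarity S r) (univ S). rint S r as}"
      using S r by (auto simp: definable_structure_def symbols_definable_in_def)
    from automorphism_definable[OF M \<sigma> this, of as] tup[OF r(2)] r(2)
    show "rint S r as \<longleftrightarrow> rint S r (map \<sigma> as)" by auto
  qed
qed

lemma interpretable_definable_structure:
  fixes S :: "('g, 's, 'a) struct" and M :: "('f, 'r, 'a) struct"
  assumes S: "definable_structure S M"
  shows "interpretable S M"
proof -
  let ?D = "{[x] | x. x \<in> univ S}"
  have U: "structure_ok S" "definable M 1 ?D" "univ S \<subseteq> univ M" "univ S \<noteq> {}"
    using S by (auto simp: definable_structure_def structure_ok_def)
  have tup: "concat xs \<in> tuples m (univ S) \<and> map hd xs = concat xs" if "xs \<in> tuples m ?D" for xs m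
  proof -
    have "length xs = m" "set xs \<subseteq> ?D" using that by (auto simp: tuples_def)
    then show ?thesis by (induction xs arbitrary: m) (auto simp: tuples_def)
  qed
  have tup': "\<exists>xs \<in> tuples m ?D. as = concat xs" if "as \<in> tuples m (univ S)" for as m
    using that by (intro bexI[of _ "map (\<lambda>x. [x]) as"]) (auto simp: tuples_def)
  have eqd: "definable M (2 * 1) {x @ y | x y. x \<in> ?D \<and> y \<in> ?D \<and> hd x = hd y}"
  proof -
    have "expressible M (univ S) {..<2} (\<lambda>s. (map s [0..<2]) ! 0 = (map s [0..<2]) ! 1)"
      unfolding expressible_def by (rule exI[of _ "Eq (Var 0) (Var 1)"]) auto
    from definable_expressible[OF this U(2,3,4)]
    have "definable M 2 {as \<in> tuples 2 (univ S). as ! 0 = as ! 1}" .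
    moreover have "{as \<in> tuples 2 (univ S). as ! 0 = as ! 1} =
        {x @ y | x y. x \<in> ?D \<and> y \<in> ?D \<and> hd x = hd y}"
    proof (intro set_eqI iffI)
      fix z assume "z \<in> {as \<in> tuples 2 (univ S). as ! 0 = as ! 1}"
      then obtain x where "z = [x] @ [x]" "x \<in> univ S"
        by (auto simp: tuples_def length_Suc_conv numeral_2_eq_2)
      then show "z \<in> {x @ y | x y. x \<in> ?D \<and> y \<in> ?D \<and> hd x = hd y}"
        by (intro CollectI exI[of _ "[x]"]) auto
    qed (auto simp: tuples_def)
    ultimately show ?thesis by simp
  qed
  have fd: "definable M ((farity S f + 1) * 1)
           {concat xs @ y | xs y. xs \<in> tuples (farity S f) ?D \<and> y \<in> ?D \<and> fint S f (map hd xs) = hd y}"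
    if f: "f \<in> fsyms S" for f
  proof -
    have "{concat xs @ y | xs y. xs \<in> tuples (farity S f) ?D \<and> y \<in> ?D \<and> fint S f (map hd xs) = hd y}
        = graph (farity S f) (univ S) (fint S f)" (is "?L = ?R")
    proof
      show "?L \<subseteq> ?R" using tup by (fastforce simp: graph_def)
      show "?R \<subseteq> ?L"
      proof
        fix z assume "z \<in> ?R"
        then obtain as where as: "z = as @ [fint S f as]" "as \<in> tuples (farity S f) (univ S)"
          by (auto simp: graph_def)
        then obtain xs where xs: "xs \<in> tuples (farity S f) ?D" "as = concat xs" using tup' by blast
        have "fint S f as \<in> univ S" using U f as by (auto simp: structure_ok_def)
        then show "z \<in> ?L" using xs as tup[OF xs(1)] by fastforce
      qed
    qed
    then show ?thesis using S f by (auto simp: definable_structure_def symbols_definable_in_def)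
  qed
  have rd: "definable M (rarity S r * 1) {concat xs | xs. xs \<in> tuples (rarity S r) ?D \<and> rint S r (map hd xs)}"
    if r: "r \<in> rsyms S" for r
  proof -
    have "{concat xs | xs. xs \<in> tuples (rarity S r) ?D \<and> rint S r (map hd xs)}
        = {as \<in> tuples (rarity S r) (univ S). rint S r as}"
      using tup tup' by fastforce
    then show ?thesis using S r by (auto simp: definable_structure_def symbols_definable_in_def)
  qed
  have "hd ` ?D = univ S" by force
  then show ?thesis unfolding interpretable_def using U(1,2) eqd fd rd
    by (intro conjI exI[of _ 1] exI[of _ ?D] exI[of _ hd]) blast+
qed

text \<open>What is interpretable in \<open>S\<close> is interpretable in \<open>M\<close> by the same coordinate map.\<close>

lemma monster_definable_structure:
  fixes S :: "('g, 's, 'a) struct" and M :: "('f, 'r, 'a) struct"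
  assumes S: "definable_structure S M" and M: "monster \<kappa> M"
  shows "monster \<kappa> S"
proof -
  have "interpretable T M" if "interpretable T S" for T :: "('h, 't, 'u) struct"
    using that definable_trans[OF S] unfolding interpretable_def by meson
  then show ?thesis
    using interpretable_monster[OF interpretable_definable_structure[OF S] M]
      interpretable_monster[OF _ M] S
    unfolding monster_def definable_structure_def by blast
qed

lemma definable_structure_reduct:
  assumes "structure_ok NN" "R \<subseteq> univ NN"
  shows "definable_structure NN (expand NN R)"
proof -
  let ?M = "expand NN R"
  have [simp]: "fsyms ?M = fsyms NN" "farity ?M = farity NN" "univ ?M = univ NN" "fint ?M = fint NN"
     "rsyms ?M = insert None (Some ` rsyms NN)" "rarity ?M (Some r) = rarity NN r"
     "rint ?M (Some r) = rint NN r" for r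
    by (auto simp: expand_def)
  have "definable ?M 1 {[x] | x. x \<in> univ NN}"
    unfolding definable_def
    by (rule bexI[of _ True_fm]) (auto simp: tuples_def length_Suc_conv)
  moreover have "definable ?M (farity NN f + 1) (graph (farity NN f) (univ NN) (fint NN f))"
    if f: "f \<in> fsyms NN" for f
  proof -
    let ?n = "farity NN f"
    let ?\<phi> = "Eq (Fn f (map Var [0..<?n])) (Var ?n) :: ('a, 'b option) fm"
    have sat: "satisfies ?M (nth (as @ [x])) ?\<phi> \<longleftrightarrow> fint NN f as = x" if "length as = ?n" for as x
    proof -
      have "map (nth (as @ [x])) [0..<?n] = as"
        using that by (intro nth_equalityI) (auto simp: nth_append)
      moreover have "(as @ [x]) ! ?n = x" using that by (simp flip: that)
      ultimately show ?thesis by (simp add: comp_def)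
    qed
    have "as \<in> graph ?n (univ NN) (fint NN f) \<longleftrightarrow> as \<in> tuples (?n + 1) (univ NN) \<and> satisfies ?M (nth as) ?\<phi>" for as
    proof
      assume "as \<in> graph ?n (univ NN) (fint NN f)"
      then obtain xs where xs: "xs \<in> tuples ?n (univ NN)" "as = xs @ [fint NN f xs]" by (auto simp: graph_def)
      then show "as \<in> tuples (?n + 1) (univ NN) \<and> satisfies ?M (nth as) ?\<phi>"
        using assms(1) f sat[of xs] by (auto simp: tuples_def structure_ok_def)
    next
      assume as: "as \<in> tuples (?n + 1) (univ NN) \<and> satisfies ?M (nth as) ?\<phi>"
      then obtain xs x where xs: "as = xs @ [x]" "length xs = ?n"
        by (auto simp: tuples_def length_Suc_conv_rev)
      then have "fint NN f xs = x" using as sat[of xs x] by blast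
      then show "as \<in> graph ?n (univ NN) (fint NN f)" using as xs by (auto simp: graph_def tuples_def)
    qed
    moreover have "?\<phi> \<in> formulas ?M (?n + 1)" using f by (auto simp: formulas_def)
    ultimately show ?thesis unfolding definable_def by (intro bexI[of _ ?\<phi>]) auto
  qed
  moreover have "definable ?M (rarity NN r) {as \<in> tuples (rarity NN r) (univ NN). rint NN r as}"
    if r: "r \<in> rsyms NN" for r
  proof -
    let ?n = "rarity NN r"
    let ?\<phi> = "Rel (Some r) (map Var [0..<?n]) :: ('a, 'b option) fm"
    have "satisfies ?M (nth as) ?\<phi> \<longleftrightarrow> rint NN r as" if "length as = ?n" for as
    proof -
      have "map (nth as) [0..<?n] = as" using that by (intro nth_equalityI) auto
      then show ?thesis by (simp add: comp_def)
    qed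
    moreover have "?\<phi> \<in> formulas ?M ?n" using r by (auto simp: formulas_def)
    ultimately show ?thesis unfolding definable_def by (intro bexI[of _ ?\<phi>]) (auto simp: tuples_def)
  qed
  ultimately show ?thesis
    using assms unfolding definable_structure_def symbols_definable_in_def by auto
qed

section \<open>Cardinalities of sets of terms and formulas\<close>

lemma finite_ordLeq_infinite:
  assumes "finite A" "infinite C"
  shows "|A| \<le>o |C|"
  using ordLeq_total[OF card_of_Well_order card_of_Well_order, of A C] assms card_of_ordLeq_finite by blast

lemma card_of_lists_infinite:
  assumes C: "infinite C"
  shows "|lists C| \<le>o |C|"
proof -
  have C': "infinite (Field |C| )" "Card_order |C|" by (simp add: Field_card_of C) (rule card_of_Card_order)
  define L where "L n = {xs \<in> lists C. length xs = n}" for n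
  have "|L n| \<le>o |C|" for n
  proof (induction n)
    case 0
    have "L 0 = {[]}" by (auto simp: L_def)
    then have "finite (L 0)" by simp
    then show ?case using C by (rule finite_ordLeq_infinite)
  next
    case (Suc n)
    have "L (Suc n) \<subseteq> (\<lambda>(x, xs). x # xs) ` (C \<times> L n)"
      by (auto simp: L_def length_Suc_conv)
    then have "|L (Suc n)| \<le>o |C \<times> L n|" using surj_imp_ordLeq by blast
    also have "|C \<times> L n| \<le>o |C|"
      by (rule card_of_Times_ordLeq_infinite_Field[OF C'(1) ordLeq_refl[OF C'(2)] Suc C'(2)])
    finally show ?case .
  qed
  moreover have "|UNIV :: nat set| \<le>o |C|"
    using C by (simp add: infinite_iff_card_of_nat)
  moreover have "lists C = (\<Union>n. L n)" by (auto simp: L_def)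
  ultimately show ?thesis using card_of_UNION_ordLeq_infinite[OF C, of UNIV L] by simp
qed

lemma infinite_Field:
  assumes "Card_order \<kappa>" "natLeq <o \<kappa>"
  shows "infinite (Field \<kappa>)"
proof
  assume "finite (Field \<kappa>)"
  then have "|Field \<kappa>| <o natLeq" by (simp add: finite_iff_ordLess_natLeq)
  then have "\<kappa> <o natLeq"
    using card_of_Field_ordIso[OF assms(1)] ordIso_ordLess_trans ordIso_symmetric by blast
  then show False using assms(2) ordLess_transitive ordLess_irreflexive by blast
qed

text \<open>Below an uncountable cardinal, two sets and the natural numbers can be absorbed into one
  infinite set, whose cardinality then bounds everything built from them finitarily.\<close>

lemma infinite_bound:
  assumes \<kappa>: "Card_order \<kappa>" "natLeq <o \<kappa>" and A: "|A| <o \<kappa>" "|B| <o \<kappa>"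
  obtains C :: "(('a + 'b) + nat) set" where "infinite C" "|C| <o \<kappa>" "|A :: 'a set| \<le>o |C|"
    "|B :: 'b set| \<le>o |C|" "|UNIV :: nat set| \<le>o |C|"
proof -
  have inf: "infinite (Field \<kappa>)" by (rule infinite_Field[OF \<kappa>])
  let ?C = "(A <+> B) <+> (UNIV :: nat set)"
  have nat: "|UNIV :: nat set| <o \<kappa>" by (rule ordIso_ordLess_trans[OF card_of_nat \<kappa>(2)])
  have "|?C| <o \<kappa>"
    by (intro card_of_Plus_ordLess_infinite_Field[OF inf \<kappa>(1)] A nat)
  moreover have "infinite ?C" by (simp add: finite_Plus_iff)
  moreover have "|A| \<le>o |?C|" by (rule ordLeq_transitive[OF card_of_Plus1 card_of_Plus1])
  moreover have "|B| \<le>o |?C|" by (rule ordLeq_transitive[OF card_of_Plus2 card_of_Plus1])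
  moreover have "|UNIV :: nat set| \<le>o |?C|" by (rule card_of_Plus2)
  ultimately show ?thesis using that by blast
qed

lemma small_Un: "Card_order \<kappa> \<Longrightarrow> natLeq <o \<kappa> \<Longrightarrow> |A| <o \<kappa> \<Longrightarrow> |B| <o \<kappa> \<Longrightarrow> |A \<union> B| <o \<kappa>"
  by (rule card_of_Un_ordLess_infinite_Field[OF infinite_Field])

lemma small_finite: "natLeq <o \<kappa> \<Longrightarrow> finite A \<Longrightarrow> |A| <o \<kappa>"
  by (rule ordLess_transitive[OF iffD1[OF finite_iff_ordLess_natLeq]])

lemma small_subset: "|A| <o \<kappa> \<Longrightarrow> B \<subseteq> A \<Longrightarrow> |B| <o \<kappa>"
  by (rule ordLeq_ordLess_trans[OF card_of_mono1])

lemma small_image: "|A| <o \<kappa> \<Longrightarrow> |f ` A| <o \<kappa>"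
  by (rule ordLeq_ordLess_trans[OF card_of_image])

lemma small_Times:
  fixes A :: "'a set" and B :: "'b set"
  assumes "Card_order \<kappa>" "natLeq <o \<kappa>" "|A| <o \<kappa>" "|B| <o \<kappa>"
  shows "|A \<times> B| <o \<kappa>"
proof -
  obtain C :: "(('a + 'b) + nat) set" where C: "infinite C" "|C| <o \<kappa>" "|A| \<le>o |C|" "|B| \<le>o |C|"
    using infinite_bound[OF assms] by metis
  have "|A \<times> B| \<le>o |C|"
    by (rule card_of_Times_ordLeq_infinite_Field[OF _ C(3,4) card_of_Card_order])
      (simp add: Field_card_of C(1))
  then show ?thesis using C(2) by (rule ordLeq_ordLess_trans)
qed

lemma small_lists:
  fixes A :: "'a set"
  assumes "Card_order \<kappa>" "natLeq <o \<kappa>" "|A| <o \<kappa>"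
  shows "|lists A| <o \<kappa>"
proof -
  obtain C :: "(('a + 'a) + nat) set" where C: "infinite C" "|C| <o \<kappa>" "|A| \<le>o |C|"
    using infinite_bound[OF assms assms(3)] by metis
  then obtain f where f: "inj_on f A" "f ` A \<subseteq> C" using card_of_ordLeq[of A C] by auto
  have "inj_on (map f) (lists A)"
    by (rule inj_on_mapI, rule inj_on_subset[OF f(1)]) auto
  moreover have "map f ` lists A \<subseteq> lists C"
    unfolding lists_image[symmetric] by (rule lists_mono[OF f(2)])
  ultimately have "|lists A| \<le>o |lists C|" by (intro iffD1[OF card_of_ordLeq] exI[of _ "map f"] conjI)
  also have "|lists C| \<le>o |C|" by (rule card_of_lists_infinite[OF C(1)])
  finally show ?thesis using C(2) by (rule ordLeq_ordLess_trans)
qed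

lemma small_countable:
  assumes "natLeq <o \<kappa>"
  shows "|UNIV :: 'x :: countable set| <o \<kappa>"
proof -
  have "|UNIV :: 'x set| \<le>o |UNIV :: nat set|"
    by (rule iffD1[OF card_of_ordLeq], rule exI[of _ to_nat]) simp
  then show ?thesis
    by (rule ordLeq_ordLess_trans[OF _ ordIso_ordLess_trans[OF card_of_nat assms]])
qed

lemma small_UNION:
  fixes I :: "'a set"
  assumes "Card_order \<kappa>" "natLeq <o \<kappa>" "|I| <o \<kappa>" "\<And>i. i \<in> I \<Longrightarrow> finite (A i)"
  shows "|\<Union>i \<in> I. A i| <o \<kappa>"
proof -
  obtain C :: "(('a + 'a) + nat) set" where C: "infinite C" "|C| <o \<kappa>" "|I| \<le>o |C|"
    using infinite_bound[OF assms(1-3) assms(3)] by metis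
  have "|A i| \<le>o |C|" if "i \<in> I" for i
    using assms(4)[OF that] C(1) by (rule finite_ordLeq_infinite)
  then have "|\<Union>i \<in> I. A i| \<le>o |C|" by (intro card_of_UNION_ordLeq_infinite[OF C(1,3)] ballI)
  then show ?thesis using C(2) by (rule ordLeq_ordLess_trans)
qed

text \<open>A term is a term over natural numbers, of which there are countably many, together with
  the list of the symbols that these numbers stand for.\<close>

instance tm :: (countable) countable by countable_datatype
instance fm :: (countable, countable) countable by countable_datatype

lemma finite_set_tm: "finite (set_tm t)"
  by (induction t) auto

lemma finite_set1_fm: "finite (set1_fm \<phi>)"
  by (induction \<phi>) (auto simp: finite_set_tm)

lemma finite_set2_fm: "finite (set2_fm \<phi>)"
  by (induction \<phi>) auto

lemma finite_subset_nth_list: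
  assumes "finite X" "X \<subseteq> A"
  shows "\<exists>xs k. xs \<in> lists A \<and> (\<forall>x \<in> X. xs ! k x = x)"
proof -
  obtain xs where xs: "set xs = X" using finite_list[OF assms(1)] by blast
  then have "\<forall>x \<in> X. \<exists>i. xs ! i = x" by (metis in_set_conv_nth)
  then obtain k where "\<forall>x \<in> X. xs ! k x = x" by metis
  moreover have "xs \<in> lists A" using xs assms by auto
  ultimately show ?thesis by blast
qed

lemma small_tm:
  assumes \<kappa>: "Card_order \<kappa>" "natLeq <o \<kappa>" and G: "|G :: 'f set| <o \<kappa>"
  shows "|{t. set_tm t \<subseteq> G}| <o \<kappa>"
proof -
  have "{t. set_tm t \<subseteq> G} \<subseteq> (\<lambda>(t, xs). map_tm (nth xs) t) ` ((UNIV :: nat tm set) \<times> lists G)"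
  proof
    fix t assume "t \<in> {t. set_tm t \<subseteq> G}"
    then have t: "set_tm t \<subseteq> G" by simp
    obtain xs k where xs: "xs \<in> lists G" "\<And>x. x \<in> set_tm t \<Longrightarrow> xs ! k x = x"
      using finite_subset_nth_list[OF finite_set_tm t] by blast
    have "map_tm (nth xs) (map_tm k t) = t"
      unfolding tm.map_comp by (rule tm.map_ident_strong) (simp add: xs)
    then show "t \<in> (\<lambda>(t, xs). map_tm (nth xs) t) ` ((UNIV :: nat tm set) \<times> lists G)"
      using xs(1) by (auto intro!: rev_image_eqI[of "(map_tm k t, xs)"])
  qed
  moreover have "|(UNIV :: nat tm set) \<times> lists G| <o \<kappa>"
    by (intro small_Times small_lists small_countable assms)
  ultimately show ?thesis by (rule small_subset[OF small_image, rotated])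
qed

lemma set_tm_wf: "wf_tm G ar t \<Longrightarrow> set_tm t \<subseteq> G"
  by (induction t) auto

lemma set_fm_wf: "wf_fm L \<phi> \<Longrightarrow> set1_fm \<phi> \<subseteq> fsyms L \<and> set2_fm \<phi> \<subseteq> rsyms L"
proof (induction \<phi>)
  case (Rel r ts)
  then have "set_tm t \<subseteq> fsyms L" if "t \<in> set ts" for t using that set_tm_wf[of "fsyms L" "farity L" t] by simp
  then show ?case using Rel by auto
qed (auto dest: set_tm_wf)

lemma small_formulas:
  assumes \<kappa>: "Card_order \<kappa>" "natLeq <o \<kappa>" and L: "|fsyms L| <o \<kappa>" "|rsyms L| <o \<kappa>"
  shows "|{\<phi>. wf_fm L \<phi>}| <o \<kappa>"
proof -
  let ?F = "\<lambda>(\<phi>, xs, ys). map_fm (nth xs) (nth ys) \<phi>"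
  let ?A = "(UNIV :: (nat, nat) fm set) \<times> lists (fsyms L) \<times> lists (rsyms L)"
  have "{\<phi>. wf_fm L \<phi>} \<subseteq> ?F ` ?A"
  proof
    fix \<phi> assume "\<phi> \<in> {\<phi>. wf_fm L \<phi>}"
    then have \<phi>: "set1_fm \<phi> \<subseteq> fsyms L" "set2_fm \<phi> \<subseteq> rsyms L" using set_fm_wf[of L \<phi>] by simp_all
    obtain xs k where xs: "xs \<in> lists (fsyms L)" "\<And>x. x \<in> set1_fm \<phi> \<Longrightarrow> xs ! k x = x"
      using finite_subset_nth_list[OF finite_set1_fm \<phi>(1)] by blast
    obtain ys l where ys: "ys \<in> lists (rsyms L)" "\<And>x. x \<in> set2_fm \<phi> \<Longrightarrow> ys ! l x = x"
      using finite_subset_nth_list[OF finite_set2_fm \<phi>(2)] by blast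
    have "map_fm (nth xs) (nth ys) (map_fm k l \<phi>) = \<phi>"
      unfolding fm.map_comp by (rule fm.map_ident_strong) (simp_all add: xs ys)
    then show "\<phi> \<in> ?F ` ?A" using xs(1) ys(1) by (auto intro!: rev_image_eqI[of "(map_fm k l \<phi>, xs, ys)"])
  qed
  moreover have "|?A| <o \<kappa>"
    by (intro small_Times small_lists small_countable assms)
  ultimately show ?thesis by (rule small_subset[OF small_image, rotated])
qed

lemma small_generated:
  assumes \<kappa>: "Card_order \<kappa>" "natLeq <o \<kappa>" and G: "|G| <o \<kappa>" "|X| <o \<kappa>"
  shows "|generated G X| <o \<kappa>"
proof -
  have "generated G X \<subseteq> (\<lambda>(t, as). app_term t as) ` ({t. set_tm t \<subseteq> G} \<times> lists X)"
    unfolding generated_def fun_terms_def using set_tm_wf[of G fst]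
    by (fastforce simp: in_lists_conv_set)
  moreover have "|{t. set_tm t \<subseteq> G} \<times> lists X| <o \<kappa>"
    by (intro small_Times small_lists small_tm assms)
  ultimately show ?thesis by (rule small_subset[OF small_image, rotated])
qed

text \<open>An extensional function is determined by its arity and its graph, hence by its arity and a
  formula of \<open>M\<close> that defines the graph. Formulas of \<open>M\<close> serve for this
  because it is the symbols of \<open>M\<close> whose number is bounded.\<close>

lemma small_definable_functions:
  fixes S :: "('g, 's, 'a) struct" and M :: "('f, 'r, 'a) struct"
  assumes \<kappa>: "Card_order \<kappa>" "natLeq <o \<kappa>" and M: "|fsyms M| <o \<kappa>" "|rsyms M| <o \<kappa>"
    and S: "definable_structure S M"
  shows "|definable_functions S| <o \<kappa>"
proof -
  define code where "code = (\<lambda>(n, f). (n :: nat, SOME \<phi>. \<phi> \<in> formulas M (n + 1) \<and>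
      graph n (univ S) f = {as \<in> tuples (n + 1) (univ M). satisfies M (nth as) \<phi>}))"
  have code: "snd (code (n, f)) \<in> formulas M (n + 1) \<and>
      graph n (univ S) f = {as \<in> tuples (n + 1) (univ M). satisfies M (nth as) (snd (code (n, f)))}"
    if "(n, f) \<in> definable_functions S" for n f
  proof -
    have "definable M (n + 1) (graph n (univ S) f)"
      using that definable_trans[OF S] by (auto simp: definable_functions_def)
    then have "\<exists>\<phi>. \<phi> \<in> formulas M (n + 1) \<and>
      graph n (univ S) f = {as \<in> tuples (n + 1) (univ M). satisfies M (nth as) \<phi>}"
      unfolding definable_def by blast
    from someI_ex[OF this] show ?thesis by (simp add: code_def)
  qed
  have "inj_on code (definable_functions S)"
  proof (rule inj_onI)
    fix h h' assume h: "h \<in> definable_functions S" "h' \<in> definable_functions S" "code h = code h'"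
    obtain n f n' f' where nf: "h = (n, f)" "h' = (n', f')" by (cases h, cases h')
    have n: "n' = n" using h(3) by (simp add: nf code_def)
    have g: "graph n (univ S) f = graph n (univ S) f'"
      using code[of n f] code[of n f'] h nf n by simp
    have "f xs = f' xs" if "xs \<in> tuples n (univ S)" for xs
    proof -
      have "xs @ [f xs] \<in> graph n (univ S) f'" using that g by (auto simp: graph_def)
      then show ?thesis by (auto simp: graph_def)
    qed
    then have "f = f'" using h nf n by (intro extensionalityI[of _ "tuples n (univ S)"])
        (auto simp: definable_functions_def PiE_def)
    then show "h = h'" using nf n by simp
  qed
  moreover have "code ` definable_functions S \<subseteq> UNIV \<times> {\<phi>. wf_fm M \<phi>}"
  proof
    fix z assume "z \<in> code ` definable_functions S"
    then obtain n f where "(n, f) \<in> definable_functions S" "z = code (n, f)" by auto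
    then have "wf_fm M (snd z)" using code[of n f] by (simp add: formulas_def)
    then show "z \<in> UNIV \<times> {\<phi>. wf_fm M \<phi>}" by (simp add: mem_Times_iff)
  qed
  ultimately have "|definable_functions S| \<le>o |(UNIV :: nat set) \<times> {\<phi>. wf_fm M \<phi>}|"
    by (intro iffD1[OF card_of_ordLeq] exI[of _ code] conjI)
  moreover have "|(UNIV :: nat set) \<times> {\<phi>. wf_fm M \<phi>}| <o \<kappa>"
    by (intro small_Times small_formulas small_countable assms)
  ultimately show ?thesis by (rule ordLeq_ordLess_trans)
qed

section \<open>Passing to another monster model of the theory\<close>

lemma truncate_eq_iff:
  "lang.truncate M' = lang.truncate M \<longleftrightarrow> fsyms M' = fsyms M \<and> rsyms M' = rsyms M \<and>
     farity M' = farity M \<and> rarity M' = rarity M"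
  by (auto simp: lang.truncate_def)

lemma wf_fm_truncate: "lang.truncate M' = lang.truncate M \<Longrightarrow> wf_fm M' \<phi> \<longleftrightarrow> wf_fm M \<phi>"
  by (induction \<phi>) (auto simp: truncate_eq_iff)

text \<open>A set of pairs instead of an elementary map, so that Zorn's lemma applies to inclusion.\<close>

definition elementary_relation ::
  "('f, 'r, 'a) struct \<Rightarrow> ('f, 'r, 'a) struct \<Rightarrow> ('a \<times> 'a) set \<Rightarrow> bool" where
  "elementary_relation M' M G \<longleftrightarrow> (\<forall>ps. set ps \<subseteq> G \<longrightarrow> (\<forall>\<phi> \<in> formulas M (length ps).
     satisfies M' (nth (map fst ps)) \<phi> \<longleftrightarrow> satisfies M (nth (map snd ps)) \<phi>))"

text \<open>The type of \<open>a\<close> over the domain of \<open>G\<close> is moved along \<open>G\<close>. A finite part of it is one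
  formula, whose existential closure is preserved by \<open>G\<close>.\<close>

lemma elementary_relation_extend:
  fixes M' :: "('f, 'r, 'a) struct" and M :: "('f, 'r, 'a) struct"
  assumes G: "elementary_relation M' M G" "snd ` G \<subseteq> univ M" "|snd ` G| <o \<kappa>"
    and sat: "saturated \<kappa> M" and a: "a \<in> univ M'"
  obtains b where "b \<in> univ M" "elementary_relation M' M (insert (a, b) G)"
proof -
  define P where "P = {(\<phi>, ps). set ps \<subseteq> G \<and> \<phi> \<in> formulas M (1 + length ps) \<and>
      satisfies M' (nth (a # map fst ps)) \<phi>}"
  define H where "H = (\<lambda>(\<phi> :: ('f, 'r) fm, ps :: ('a \<times> 'a) list). (\<phi>, map snd ps))"
  have fin: "\<exists>b\<in>univ M. \<forall>(\<phi>, cs)\<in>q. satisfies M (nth (b # cs)) \<phi>"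
    if q: "finite q" "q \<subseteq> H ` P" for q
  proof -
    obtain q0 where q0: "finite q0" "q0 \<subseteq> P" "q = H ` q0" using finite_subset_image[OF q] by blast
    have q0': "q0 \<subseteq> {(\<phi>, ps). set ps \<subseteq> G \<and> \<phi> \<in> formulas M (1 + length ps)}"
      using q0(2) by (auto simp: P_def)
    obtain \<psi> ds where \<psi>: "set ds \<subseteq> G" "\<psi> \<in> formulas M (1 + length ds)"
      "\<And>(K :: ('f, 'r, 'a) struct) f x.
        satisfies K (nth (x # map f ds)) \<psi> \<longleftrightarrow> (\<forall>(\<phi>, cs) \<in> q0. satisfies K (nth (x # map f cs)) \<phi>)"
      using merge_formulas[OF q0(1) q0', where ?'b = 'a] by blast
    have "satisfies M' (nth (a # map fst ds)) \<psi>"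
      unfolding \<psi>(3) using q0(2) by (auto simp: P_def)
    then have "satisfies M' (nth (map fst ds)) (Ex_first (length ds) \<psi>)"
      using Ex_first(2)[of \<psi> M "length ds" "map fst ds" M'] \<psi>(2) a by auto
    moreover have "Ex_first (length ds) \<psi> \<in> formulas M (length ds)"
      using Ex_first(1)[of \<psi> M "length ds"] \<psi>(2) by simp
    ultimately have "satisfies M (nth (map snd ds)) (Ex_first (length ds) \<psi>)"
      using G(1) \<psi>(1) unfolding elementary_relation_def by blast
    then obtain b where b: "b \<in> univ M" "satisfies M (nth (b # map snd ds)) \<psi>"
      using Ex_first(2)[of \<psi> M "length ds" "map snd ds" M] \<psi>(2) by auto
    from b(2) have "\<forall>(\<phi>, cs)\<in>q. satisfies M (nth (b # cs)) \<phi>"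
      unfolding \<psi>(3) q0(3) H_def by auto
    with b(1) show ?thesis by blast
  qed
  have sub: "H ` P \<subseteq> {(\<phi>, cs). set cs \<subseteq> snd ` G \<and> \<phi> \<in> formulas M (1 + length cs)}"
  proof
    fix z assume "z \<in> H ` P"
    then obtain \<phi> ps where "z = (\<phi>, map snd ps)" "set ps \<subseteq> G" "\<phi> \<in> formulas M (1 + length ps)"
      by (auto simp: H_def P_def)
    then show "z \<in> {(\<phi>, cs). set cs \<subseteq> snd ` G \<and> \<phi> \<in> formulas M (1 + length cs)}"
      by (simp add: image_mono)
  qed
  have "\<exists>b\<in>univ M. \<forall>(\<phi>, cs)\<in>H ` P. satisfies M (nth (b # cs)) \<phi>"
    by (rule sat[unfolded saturated_def, rule_format, of "snd ` G"])
      (use G(2,3) fin sub in simp)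
  then obtain b where b: "b \<in> univ M" "\<forall>(\<phi>, cs)\<in>H ` P. satisfies M (nth (b # cs)) \<phi>" by (rule bexE)
  have b1: "satisfies M (nth (b # map snd ps)) \<phi>"
    if "set ps \<subseteq> G" "\<phi> \<in> formulas M (1 + length ps)" "satisfies M' (nth (a # map fst ps)) \<phi>" for ps \<phi>
  proof -
    have "(\<phi>, ps) \<in> P" using that by (simp add: P_def)
    then have "(\<phi>, map snd ps) \<in> H ` P" unfolding H_def by force
    then show ?thesis using b(2) by blast
  qed
  have b2: "satisfies M' (nth (a # map fst ps)) \<phi> \<longleftrightarrow> satisfies M (nth (b # map snd ps)) \<phi>"
    if "set ps \<subseteq> G" "\<phi> \<in> formulas M (1 + length ps)" for ps \<phi>
  proof -
    have "Neg \<phi> \<in> formulas M (1 + length ps)" using that by (simp add: formulas_def)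
    then show ?thesis using b1[of ps \<phi>] b1[of ps "Neg \<phi>"] that by auto
  qed
  have "elementary_relation M' M (insert (a, b) G)"
    unfolding elementary_relation_def
  proof (intro allI impI ballI)
    fix ps \<phi> assume ps: "set ps \<subseteq> insert (a, b) G" and \<phi>: "\<phi> \<in> formulas M (length ps)"
    define qs where "qs = filter (\<lambda>z. z \<in> G) ps"
    have "\<forall>z \<in> set ps. \<exists>j < length ((a, b) # qs). ((a, b) # qs) ! j = z"
    proof
      fix z assume "z \<in> set ps"
      then have "z \<in> set ((a, b) # qs)" using ps by (auto simp: qs_def)
      then show "\<exists>j < length ((a, b) # qs). ((a, b) # qs) ! j = z" by (simp only: in_set_conv_nth)
    qed
    then obtain j where j: "\<And>z. z \<in> set ps \<Longrightarrow> j z < length ((a, b) # qs) \<and> ((a, b) # qs) ! j z = z"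
      by metis
    have ps_eq: "map (nth (map h ((a, b) # qs))) (map j ps) = map h ps" for h :: "('a \<times> 'a) \<Rightarrow> 'c"
      using j by (auto simp del: list.map nth_Cons_0 simp add: nth_map)
    have \<psi>: "ren_fm (nth (map j ps)) \<phi> \<in> formulas M (1 + length qs)"
      by (rule ren_formulas[OF \<phi>]) (use j[OF nth_mem] in simp)
    have "satisfies M' (nth (map fst ps)) \<phi> \<longleftrightarrow>
        satisfies M' (nth (a # map fst qs)) (ren_fm (nth (map j ps)) \<phi>)"
      using satisfies_reindex[of \<phi> M "map j ps" M' "map fst ((a, b) # qs)"] \<phi> unfolding ps_eq by simp
    also have "\<dots> \<longleftrightarrow> satisfies M (nth (b # map snd qs)) (ren_fm (nth (map j ps)) \<phi>)"
      by (rule b2[OF _ \<psi>]) (auto simp: qs_def)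
    also have "\<dots> \<longleftrightarrow> satisfies M (nth (map snd ps)) \<phi>"
      using satisfies_reindex[of \<phi> M "map j ps" M "map snd ((a, b) # qs)"] \<phi> unfolding ps_eq by simp
    finally show "satisfies M' (nth (map fst ps)) \<phi> \<longleftrightarrow> satisfies M (nth (map snd ps)) \<phi>" .
  qed
  with b(1) show ?thesis using that by blast
qed

text \<open>A maximal elementary correspondence with domain inside a small set is total on it, by
  saturation.\<close>

lemma elementary_embedding:
  fixes M' :: "('f, 'r, 'a) struct" and M :: "('f, 'r, 'a) struct"
  assumes L: "fsyms M' = fsyms M" "rsyms M' = rsyms M" "farity M' = farity M" "rarity M' = rarity M"
    and th: "\<And>\<phi>. \<phi> \<in> formulas M 0 \<Longrightarrow> satisfies M (nth []) \<phi> \<Longrightarrow> satisfies M' (nth []) \<phi>"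
    and sat: "saturated \<kappa> M" and A: "A \<subseteq> univ M'" "|A| <o \<kappa>"
  obtains g where "g ` A \<subseteq> univ M"
    "\<And>as \<phi>. set as \<subseteq> A \<Longrightarrow> \<phi> \<in> formulas M (length as) \<Longrightarrow>
       satisfies M' (nth as) \<phi> \<longleftrightarrow> satisfies M (nth (map g as)) \<phi>"
proof -
  define \<A> where "\<A> = {G. G \<subseteq> A \<times> univ M \<and> elementary_relation M' M G}"
  have "\<exists>G\<in>\<A>. \<forall>X\<in>\<A>. G \<subseteq> X \<longrightarrow> X = G"
  proof (rule subset_Zorn_nonempty)
    have "satisfies M' (nth []) \<phi> \<longleftrightarrow> satisfies M (nth []) \<phi>" if "\<phi> \<in> formulas M 0" for \<phi>
      using th[OF that] th[of "Neg \<phi>"] that by (auto simp: formulas_def)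
    then have "{} \<in> \<A>" by (auto simp: \<A>_def elementary_relation_def)
    then show "\<A> \<noteq> {}" by blast
  next
    fix \<C> assume C: "\<C> \<noteq> {}" "subset.chain \<A> \<C>"
    have sub: "\<C> \<subseteq> \<A>" using C(2) by (auto simp: subset.chain_def)
    have "elementary_relation M' M (\<Union>\<C>)"
      unfolding elementary_relation_def
    proof (intro allI impI)
      fix ps assume "set ps \<subseteq> \<Union>\<C>"
      then obtain G where "G \<in> \<C>" "set ps \<subseteq> G"
        using finite_subset_Union_chain[OF _ _ C] by (metis List.finite_set)
      then show "\<forall>\<phi> \<in> formulas M (length ps).
          satisfies M' (nth (map fst ps)) \<phi> \<longleftrightarrow> satisfies M (nth (map snd ps)) \<phi>"
        using sub by (auto simp: \<A>_def elementary_relation_def)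
    qed
    then show "\<Union>\<C> \<in> \<A>" using sub by (auto simp: \<A>_def)
  qed
  then obtain G where G0: "G \<in> \<A>" and max: "\<forall>X\<in>\<A>. G \<subseteq> X \<longrightarrow> X = G" by (rule bexE)
  have G: "G \<subseteq> A \<times> univ M" "elementary_relation M' M G" using G0 by (auto simp: \<A>_def)
  have single: "z = y" if "(x, y) \<in> G" "(x, z) \<in> G" for x y z
  proof -
    have "Eq (Var 0) (Var 1) \<in> formulas M (length [(x, y), (x, z)])" by (simp add: formulas_def)
    then have "satisfies M' (nth (map fst [(x, y), (x, z)])) (Eq (Var 0) (Var 1)) \<longleftrightarrow>
        satisfies M (nth (map snd [(x, y), (x, z)])) (Eq (Var 0) (Var 1))"
      by (intro G(2)[unfolded elementary_relation_def, rule_format]) (use that in auto)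
    then show ?thesis by simp
  qed
  define g where "g x = (SOME y. (x, y) \<in> G)" for x
  have g: "g x = y" if "(x, y) \<in> G" for x y
  proof -
    have "(x, g x) \<in> G" unfolding g_def by (rule someI[of _ y]) (rule that)
    then show ?thesis using single that by blast
  qed
  have "snd ` G \<subseteq> g ` A" using g G(1) by (force simp: image_iff)
  then have small: "|snd ` G| <o \<kappa>" by (rule small_subset[OF small_image[OF A(2)]])
  have total: "(x, g x) \<in> G" if x: "x \<in> A" for x
  proof -
    obtain b where b: "b \<in> univ M" "elementary_relation M' M (insert (x, b) G)"
      by (rule elementary_relation_extend[OF G(2) _ small sat, of x]) (use G(1) x A(1) in auto)
    then have "insert (x, b) G \<in> \<A>" using G x by (auto simp: \<A>_def)
    then have "(x, b) \<in> G" using max by blast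
    then show ?thesis using g by blast
  qed
  show ?thesis
  proof
    show "g ` A \<subseteq> univ M" using total G(1) by blast
  next
    fix as \<phi> assume as: "set as \<subseteq> A" "\<phi> \<in> formulas M (length as)"
    let ?ps = "map (\<lambda>x. (x, g x)) as"
    have 1: "map fst ?ps = as" "map snd ?ps = map g as" by (auto simp: comp_def)
    have "set ?ps \<subseteq> G" using total as(1) by auto
    then show "satisfies M' (nth as) \<phi> \<longleftrightarrow> satisfies M (nth (map g as)) \<phi>"
      using G(2)[unfolded elementary_relation_def, rule_format, of ?ps \<phi>] as(2) unfolding 1 by simp
  qed
qed

text \<open>A sequence in another model of the theory has fewer than \<open>\<kappa>\<close> entries, so together with the
  singleton it has an elementary copy in \<open>M\<close>.\<close>

lemma distal_if_in_model:
  fixes M :: "('f, 'r, 'a) struct" and \<kappa> :: "'k rel" and \<mu> :: "'m rel"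
  assumes \<kappa>: "Card_order \<kappa>" "natLeq <o \<kappa>" and inf: "infinite (univ M)"
    and sat: "saturated \<kappa> M"
    and ind: "\<And>(r :: 'k rel) I c J p a b. b \<in> univ M \<Longrightarrow> index_cut \<kappa> \<mu> r I c J \<Longrightarrow>
       (\<And>k. k \<in> I \<union> {c} \<union> J \<Longrightarrow> a k \<in> tuples p (univ M)) \<Longrightarrow> star_condition M r I c J a b \<Longrightarrow>
       indiscernible M r (I \<union> {c} \<union> J) a {b}"
  shows "distal \<kappa> \<mu> M"
  unfolding distal_def
proof (intro conjI allI impI ballI inf, elim conjE)
  fix M' :: "('f, 'r, 'a) struct" and r :: "'k rel" and I c J p a b
  assume tr: "lang.truncate M' = lang.truncate M" and mod: "models M' (Th M)"
    and b: "b \<in> univ M'" and cut: "index_cut \<kappa> \<mu> r I c J"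
    and a: "\<forall>k\<in>I \<union> {c} \<union> J. a k \<in> tuples p (univ M')" and star: "star_condition M' r I c J a b"
  let ?K = "I \<union> {c} \<union> J"
  define A where "A = insert b (\<Union>k \<in> ?K. set (a k))"
  have "|?K| <o \<kappa>" using cut by (simp add: index_cut_def)
  then have "|\<Union>k \<in> ?K. set (a k)| <o \<kappa>" by (intro small_UNION[OF \<kappa>]) auto
  then have "|{b} \<union> (\<Union>k \<in> ?K. set (a k))| <o \<kappa>" by (intro small_Un[OF \<kappa> small_finite[OF \<kappa>(2)]]) simp
  then have A: "A \<subseteq> univ M'" "|A| <o \<kappa>" using a b by (auto simp: A_def tuples_def)
  have F: "formulas M' n = formulas M n" for n using wf_fm_truncate[OF tr] by (simp add: formulas_def)
  obtain g where gU: "g ` A \<subseteq> univ M"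
    and g: "\<And>as \<phi>. set as \<subseteq> A \<Longrightarrow> \<phi> \<in> formulas M (length as) \<Longrightarrow>
       satisfies M' (nth as) \<phi> \<longleftrightarrow> satisfies M (nth (map g as)) \<phi>"
    by (rule elementary_embedding[of M' M \<kappa> A])
      (use tr mod sat A in \<open>auto simp: truncate_eq_iff models_def Th_def\<close>)
  have tp: "tp M' as B = tp M' bs B \<longleftrightarrow> tp M (map g as) (g ` B) = tp M (map g bs) (g ` B)"
    if "set as \<subseteq> A" "set bs \<subseteq> A" "length as = length bs" "B \<subseteq> A" for as bs B
  proof -
    have len: "length (map g as) = length (map g bs)" using that by simp
    have *: "satisfies M' (nth (xs @ cs)) \<phi> \<longleftrightarrow> satisfies M (nth (map g xs @ map g cs)) \<phi>"
      if "set cs \<subseteq> B" "\<phi> \<in> formulas M (length xs + length cs)" "set xs \<subseteq> A" for xs cs \<phi>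
      using g[of "xs @ cs" \<phi>] that \<open>B \<subseteq> A\<close> by auto
    have im: "(\<forall>cs. set cs \<subseteq> g ` B \<longrightarrow> Q cs) \<longleftrightarrow> (\<forall>cs. set cs \<subseteq> B \<longrightarrow> Q (map g cs))" for Q
    proof safe
      fix cs assume "\<forall>cs. set cs \<subseteq> B \<longrightarrow> Q (map g cs)" "set cs \<subseteq> g ` B"
      moreover have "\<exists>ds. cs = map g ds \<and> set ds \<subseteq> B"
      proof -
        have "cs \<in> map g ` lists B"
          unfolding lists_image[symmetric] using \<open>set cs \<subseteq> g ` B\<close> by (auto simp: in_lists_conv_set)
        then show ?thesis by (auto simp: in_lists_conv_set)
      qed
      ultimately show "Q cs" by blast
    qed (simp add: image_mono)
    show ?thesis
      unfolding tp_eq_iff[OF that(3)] tp_eq_iff[OF len] im F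
      using *[of _ _ as] *[of _ _ bs] that by auto
  qed
  have IND: "indiscernible M' r K a B \<longleftrightarrow> indiscernible M r K (map g \<circ> a) (g ` B)"
    if "K \<subseteq> ?K" "B \<subseteq> A" for K B
  proof -
    have 1: "set (concat (map a ks)) \<subseteq> A" if "set ks \<subseteq> K" for ks
      using that \<open>K \<subseteq> ?K\<close> by (auto simp: A_def)
    have 2: "length (concat (map a ks)) = length ks * p" if "set ks \<subseteq> K" for ks
      using that
    proof (induction ks)
      case (Cons k ks)
      then have "k \<in> ?K" using \<open>K \<subseteq> ?K\<close> by auto
      from a[rule_format, OF this] have "length (a k) = p" by (simp add: tuples_def)
      with Cons show ?case by simp
    qed simp
    have 3: "map g (concat (map a ks)) = concat (map (map g \<circ> a) ks)" for ks
      by (simp add: map_concat)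
    have 4: "tp M' (concat (map a ks)) B = tp M' (concat (map a ls)) B \<longleftrightarrow>
        tp M (concat (map (map g \<circ> a) ks)) (g ` B) = tp M (concat (map (map g \<circ> a) ls)) (g ` B)"
      if "set ks \<subseteq> K" "set ls \<subseteq> K" "length ks = length ls" for ks ls
      using tp[OF 1[OF that(1)] 1[OF that(2)] _ \<open>B \<subseteq> A\<close>] 2 that unfolding 3 by simp
    show ?thesis unfolding indiscernible_def
      by (intro iff_allI imp_cong refl, elim conjE) (rule 4)
  qed
  have s: "star_condition M r I c J (map g \<circ> a) (g b)"
    using star IND[of ?K "{}"] IND[of "I \<union> J" "{b}"] by (auto simp: star_condition_def A_def)
  have t: "(map g \<circ> a) k \<in> tuples p (univ M)" if "k \<in> ?K" for k
    using a that gU by (auto simp: tuples_def A_def)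
  have "g b \<in> univ M" using gU by (auto simp: A_def)
  from ind[OF this cut t s] have "indiscernible M r ?K (map g \<circ> a) {g b}" .
  then show "indiscernible M' r ?K a {b}" using IND[of ?K "{b}"] by (simp add: A_def)
qed

section \<open>Index sets and their segments\<close>

fun fm_vars :: "('f, 'r) fm \<Rightarrow> nat set" where
  "fm_vars (Eq t u) = tm_vars t \<union> tm_vars u"
| "fm_vars (Rel r ts) = (\<Union>t \<in> set ts. tm_vars t)"
| "fm_vars (Neg \<phi>) = fm_vars \<phi>"
| "fm_vars (Conj \<phi> \<psi>) = fm_vars \<phi> \<union> fm_vars \<psi>"
| "fm_vars (Ex x \<phi>) = insert x (fm_vars \<phi>)"

lemma finite_fm_vars [simp]: "finite (fm_vars \<phi>)"
  by (induction \<phi>) auto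

fun relativize :: "(nat \<Rightarrow> ('f, 'r) fm) \<Rightarrow> ('f, 'r) fm \<Rightarrow> ('f, 'r) fm" where
  "relativize \<gamma> (Neg \<phi>) = Neg (relativize \<gamma> \<phi>)"
| "relativize \<gamma> (Conj \<phi> \<psi>) = Conj (relativize \<gamma> \<phi>) (relativize \<gamma> \<psi>)"
| "relativize \<gamma> (Ex x \<phi>) = Ex x (Conj (\<gamma> x) (relativize \<gamma> \<phi>))"
| "relativize \<gamma> \<phi> = \<phi>"

lemma wf_relativize: "wf_fm L \<phi> \<Longrightarrow> (\<And>x. wf_fm L (\<gamma> x)) \<Longrightarrow> wf_fm L (relativize \<gamma> \<phi>)"
  by (induction \<phi>) auto

lemma free_relativize:
  "(\<And>x. fm_free (\<gamma> x) \<subseteq> {x, m}) \<Longrightarrow> fm_free (relativize \<gamma> \<phi>) \<subseteq> insert m (fm_free \<phi>)"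
proof (induction \<phi>)
  case (Ex x \<phi>)
  then have "fm_free (\<gamma> x) \<subseteq> {x, m}" "fm_free (relativize \<gamma> \<phi>) \<subseteq> insert m (fm_free \<phi>)" by simp_all
  then show ?case by auto
next
  case (Conj \<phi> \<psi>)
  then have "fm_free (relativize \<gamma> \<phi>) \<subseteq> insert m (fm_free \<phi>)"
    "fm_free (relativize \<gamma> \<psi>) \<subseteq> insert m (fm_free \<psi>)" by simp_all
  then show ?case by auto
qed auto

lemma wf_tm_no_symbols: "wf_tm {} ar t \<longleftrightarrow> (\<exists>i. t = Var i)"
  by (cases t) auto

lemma satisfies_relativize_order:
  assumes sub: "I0 \<subseteq> I" and ord: "\<And>x y. x \<in> I0 \<Longrightarrow> y \<in> I0 \<Longrightarrow> lt r0 x y \<longleftrightarrow> lt r x y"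
    and \<gamma>: "\<And>x s. s m = i0 \<Longrightarrow> s x \<in> I \<Longrightarrow> satisfies (order_struct r I) s (\<gamma> x) \<longleftrightarrow> s x \<in> I0"
    and "wf_fm (order_struct r0 I0) \<phi>" and "m \<notin> fm_vars \<phi>"
    and "\<And>i. i \<in> fm_free \<phi> \<Longrightarrow> s i \<in> I0" and "s m = i0"
  shows "satisfies (order_struct r I) s (relativize \<gamma> \<phi>) \<longleftrightarrow> satisfies (order_struct r0 I0) s \<phi>"
  using assms(4-)
proof (induction \<phi> arbitrary: s)
  case (Eq t u)
  then show ?case by (auto simp: order_struct_def wf_tm_no_symbols)
next
  case (Rel w ts)
  then have "length ts = 2" "\<forall>t \<in> set ts. \<exists>i. t = Var i"
    by (auto simp: order_struct_def wf_tm_no_symbols)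
  then obtain i j where "ts = [Var i, Var j]"
    by (auto simp: numeral_2_eq_2 length_Suc_conv)
  then show ?case using Rel ord by (auto simp: order_struct_def)
next
  case (Ex x \<phi>)
  have "x \<noteq> m" using Ex.prems by auto
  have "satisfies (order_struct r I) (s(x := a)) (Conj (\<gamma> x) (relativize \<gamma> \<phi>)) \<longleftrightarrow>
      a \<in> I0 \<and> satisfies (order_struct r0 I0) (s(x := a)) \<phi>" if "a \<in> I" for a
  proof -
    have 1: "satisfies (order_struct r I) (s(x := a)) (\<gamma> x) \<longleftrightarrow> a \<in> I0"
      using \<gamma>[of "s(x := a)" x] that Ex.prems \<open>x \<noteq> m\<close> by simp
    have 2: "satisfies (order_struct r I) (s(x := a)) (relativize \<gamma> \<phi>) \<longleftrightarrow>
        satisfies (order_struct r0 I0) (s(x := a)) \<phi>" if "a \<in> I0"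
      by (rule Ex.IH) (use Ex.prems \<open>x \<noteq> m\<close> that in auto)
    show ?thesis unfolding satisfies.simps using 1 2 by blast
  qed
  moreover have "univ (order_struct r I) = I" "univ (order_struct r0 I0) = I0"
    by (simp_all add: order_struct_def)
  ultimately show ?case using sub unfolding satisfies.simps relativize.simps by blast
qed auto

text \<open>A segment bounded by a point of a saturated order is definable from that point, so types
  over the segment are turned into types over the whole order by relativizing. The bounding
  point must become a parameter under a variable that does not occur in the formula; for this
  the list of parameters is padded with copies of it.\<close>

lemma saturated_segment:
  fixes r r0 :: "'k rel"
  assumes \<mu>: "Card_order \<mu>" "natLeq <o \<mu>"
    and sat: "saturated \<mu> (order_struct r I)" and i0: "i0 \<in> I"
    and I0: "I0 = {x \<in> I. if up then lt r i0 x else lt r x i0}"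
    and ord: "\<And>x y. x \<in> I0 \<Longrightarrow> y \<in> I0 \<Longrightarrow> lt r0 x y \<longleftrightarrow> lt r x y"
  shows "saturated \<mu> (order_struct r0 I0)"
  unfolding saturated_def
proof (intro allI impI, elim conjE)
  fix A and p :: "((unit, unit) fm \<times> 'k list) set"
  assume A: "A \<subseteq> univ (order_struct r0 I0)" "|A| <o \<mu>"
    and p: "p \<subseteq> {(\<phi>, cs). set cs \<subseteq> A \<and> \<phi> \<in> formulas (order_struct r0 I0) (1 + length cs)}"
    and fin: "\<forall>q. finite q \<and> q \<subseteq> p \<longrightarrow> (\<exists>b\<in>univ (order_struct r0 I0).
        \<forall>(\<phi>, cs)\<in>q. satisfies (order_struct r0 I0) (nth (b # cs)) \<phi>)"
  have U: "univ (order_struct r I) = I" "univ (order_struct r0 I0) = I0"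
    by (simp_all add: order_struct_def)
  define \<gamma> :: "nat \<Rightarrow> nat \<Rightarrow> (unit, unit) fm" where
    "\<gamma> m x = Rel () (if up then [Var m, Var x] else [Var x, Var m])" for m x
  have \<gamma>: "satisfies (order_struct r I) s (\<gamma> m x) \<longleftrightarrow> s x \<in> I0" if "s m = i0" "s x \<in> I" for s m x
    using that by (simp add: \<gamma>_def I0 order_struct_def)
  have \<gamma>wf: "wf_fm (order_struct r I) (\<gamma> m x)" "fm_free (\<gamma> m x) \<subseteq> {x, m}" for m x
    by (auto simp: \<gamma>_def order_struct_def)
  have wf: "wf_fm (order_struct r0 I0) \<phi> \<longleftrightarrow> wf_fm (order_struct r I) \<phi>" for \<phi>
    by (induction \<phi>) (auto simp: order_struct_def)
  define m where "m \<phi> cs = fresh (fm_vars \<phi> \<union> {..length cs})"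
    for \<phi> :: "(unit, unit) fm" and cs :: "'k list"
  have m: "m \<phi> cs \<notin> fm_vars \<phi>" "length cs < m \<phi> cs" for \<phi> cs
    using fresh[of "fm_vars \<phi> \<union> {..length cs}"] by (auto simp: m_def not_le)
  define H where "H = (\<lambda>(\<phi>, cs). (relativize (\<gamma> (m \<phi> cs)) \<phi>, cs @ replicate (m \<phi> cs - length cs) i0))"
  have H: "satisfies (order_struct r I) (nth (b # snd (H (\<phi>, cs)))) (fst (H (\<phi>, cs))) \<longleftrightarrow>
      satisfies (order_struct r0 I0) (nth (b # cs)) \<phi>"
    if z: "(\<phi>, cs) \<in> p" and b: "b \<in> I0" for \<phi> cs b
  proof -
    have \<phi>: "\<phi> \<in> formulas (order_struct r0 I0) (1 + length cs)" "set cs \<subseteq> I0" using p z A U by auto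
    let ?s = "nth (b # cs @ replicate (m \<phi> cs - length cs) i0)"
    have "satisfies (order_struct r I) ?s (relativize (\<gamma> (m \<phi> cs)) \<phi>) \<longleftrightarrow>
        satisfies (order_struct r0 I0) ?s \<phi>"
    proof (rule satisfies_relativize_order[OF _ ord \<gamma>])
      show "?s (m \<phi> cs) = i0" using m(2)[of cs \<phi>] by (cases "m \<phi> cs") (auto simp: nth_append)
      show "?s i \<in> I0" if "i \<in> fm_free \<phi>" for i
      proof -
        have "i < 1 + length cs" using that \<phi> by (auto simp: formulas_def)
        then have "?s i = (b # cs) ! i" by (auto simp: nth_Cons' nth_append)
        also have "\<dots> \<in> set (b # cs)" using \<open>i < 1 + length cs\<close> by (intro nth_mem) simp
        finally show ?thesis using \<phi>(2) b by auto
      qed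
    qed (use \<phi> m in \<open>auto simp: I0 formulas_def\<close>)
    also have "\<dots> \<longleftrightarrow> satisfies (order_struct r0 I0) (nth (b # cs)) \<phi>"
      by (rule satisfies_formulas_cong[OF \<phi>(1)]) (auto simp: nth_Cons' nth_append)
    finally show ?thesis by (simp add: H_def)
  qed
  define g where "g = (\<gamma> 1 0, [i0])"
  have g: "satisfies (order_struct r I) (nth (b # [i0])) (\<gamma> 1 0) \<longleftrightarrow> b \<in> I0" if "b \<in> I" for b
    using \<gamma>[of "nth (b # [i0])" 1 0] that by simp
  have sub: "insert g (H ` p) \<subseteq>
      {(\<phi>, cs). set cs \<subseteq> insert i0 A \<and> \<phi> \<in> formulas (order_struct r I) (1 + length cs)}"
  proof
    fix z assume "z \<in> insert g (H ` p)"
    then consider "z = g" | \<phi> cs where "(\<phi>, cs) \<in> p" "z = H (\<phi>, cs)" by auto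
    then show "z \<in> {(\<phi>, cs). set cs \<subseteq> insert i0 A \<and> \<phi> \<in> formulas (order_struct r I) (1 + length cs)}"
    proof cases
      case 1
      have "\<gamma> 1 0 \<in> formulas (order_struct r I) (1 + length [i0])"
        using \<gamma>wf[of 1 0] by (auto simp: formulas_def)
      then show ?thesis using 1 by (simp add: g_def)
    next
      case 2
      then have \<phi>: "wf_fm (order_struct r I) \<phi>" "fm_free \<phi> \<subseteq> {..<1 + length cs}" "set cs \<subseteq> A"
        using p wf by (auto simp: formulas_def)
      have "wf_fm (order_struct r I) (relativize (\<gamma> (m \<phi> cs)) \<phi>)"
        by (rule wf_relativize[OF \<phi>(1) \<gamma>wf(1)])
      moreover have "fm_free (relativize (\<gamma> (m \<phi> cs)) \<phi>) \<subseteq> {..<1 + m \<phi> cs}"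
        using free_relativize[of "\<gamma> (m \<phi> cs)" "m \<phi> cs" \<phi>, OF \<gamma>wf(2)] \<phi>(2) m(2)[of cs \<phi>] by force
      ultimately show ?thesis using \<phi>(3) m(2)[of cs \<phi>] 2
        by (auto simp: H_def formulas_def)
    qed
  qed
  have fin': "\<exists>b\<in>univ (order_struct r I). \<forall>(\<phi>, cs)\<in>q. satisfies (order_struct r I) (nth (b # cs)) \<phi>"
    if q: "finite q" "q \<subseteq> insert g (H ` p)" for q
  proof -
    have "finite (q - {g})" "q - {g} \<subseteq> H ` p" using q by auto
    then obtain q0 where q0: "finite q0" "q0 \<subseteq> p" "q - {g} = H ` q0"
      using finite_subset_image by metis
    have "\<exists>b\<in>univ (order_struct r0 I0). \<forall>(\<phi>, cs)\<in>q0. satisfies (order_struct r0 I0) (nth (b # cs)) \<phi>"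
      by (rule fin[THEN spec, THEN mp]) (use q0 in simp)
    then obtain b where b: "b \<in> I0" "\<forall>(\<phi>, cs)\<in>q0. satisfies (order_struct r0 I0) (nth (b # cs)) \<phi>"
      unfolding U by (rule bexE)
    have bI: "b \<in> I" using b(1) by (simp add: I0)
    have "satisfies (order_struct r I) (nth (b # snd z)) (fst z)" if z: "z \<in> q" for z
    proof (cases "z = g")
      case True
      then show ?thesis using g[OF bI] b(1) by (simp add: g_def)
    next
      case False
      then have "z \<in> H ` q0" using z q0(3) by blast
      then obtain \<phi> cs where "(\<phi>, cs) \<in> q0" "z = H (\<phi>, cs)" by auto
      then show ?thesis using H[of \<phi> cs b] b q0(2) by auto
    qed
    then show ?thesis using bI unfolding U by (intro bexI[of _ b]) auto
  qed
  have "\<exists>b\<in>univ (order_struct r I). \<forall>(\<phi>, cs)\<in>insert g (H ` p). satisfies (order_struct r I) (nth (b # cs)) \<phi>"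
  proof (rule sat[unfolded saturated_def, rule_format, of "insert i0 A"], intro conjI allI impI)
    show "insert i0 A \<subseteq> univ (order_struct r I)" using i0 A unfolding U by (auto simp: I0)
    have "|{i0} \<union> A| <o \<mu>" by (rule small_Un[OF \<mu> small_finite[OF \<mu>(2)] A(2)]) simp
    then show "|insert i0 A| <o \<mu>" by simp
    show "insert g (H ` p) \<subseteq>
      {(\<phi>, cs). set cs \<subseteq> insert i0 A \<and> \<phi> \<in> formulas (order_struct r I) (1 + length cs)}" by (rule sub)
  qed (use fin' in blast)
  then obtain b where b: "b \<in> I"
    "\<forall>(\<phi>, cs)\<in>insert g (H ` p). satisfies (order_struct r I) (nth (b # cs)) \<phi>"
    unfolding U by (rule bexE)
  have "b \<in> I0" using b g by (auto simp: g_def)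
  moreover have "satisfies (order_struct r0 I0) (nth (b # snd z)) (fst z)" if "z \<in> p" for z
  proof -
    have "satisfies (order_struct r I) (nth (b # snd (H z))) (fst (H z))"
      using b(2) that by (auto simp: case_prod_beta)
    then show ?thesis using H[of "fst z" "snd z" b] that \<open>b \<in> I0\<close> by simp
  qed
  ultimately show "\<exists>b\<in>univ (order_struct r0 I0). \<forall>(\<phi>, cs)\<in>p. satisfies (order_struct r0 I0) (nth (b # cs)) \<phi>"
    unfolding U by (intro bexI[of _ b]) auto
qed

lemma lt_trans: "trans r \<Longrightarrow> antisym r \<Longrightarrow> lt r x y \<Longrightarrow> lt r y z \<Longrightarrow> lt r x z"
  unfolding lt_def trans_def antisym_def by blast

lemma index_cut_orderD:
  assumes "index_cut \<kappa> \<mu> r I c J"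
  shows "trans r" "antisym r" "total_on (I \<union> {c} \<union> J) r"
    "i \<in> I \<Longrightarrow> lt r i c" "j \<in> J \<Longrightarrow> lt r c j"
    "dense_no_endpoints r I" "dense_no_endpoints r J"
    "|I \<union> {c} \<union> J| <o \<kappa>"
    "saturated \<mu> (order_struct r I)" "saturated \<mu> (order_struct r J)"
    "x \<in> I \<union> {c} \<union> J \<Longrightarrow> (x, x) \<in> r"
  using assms unfolding index_cut_def linear_order_on_def partial_order_on_def preorder_on_def refl_on_def
  by blast+

lemma lt_linear:
  assumes "index_cut \<kappa> \<mu> r I c J" "x \<in> I \<union> {c} \<union> J" "y \<in> I \<union> {c} \<union> J"
  shows "lt r x y \<or> x = y \<or> lt r y x"
  using index_cut_orderD(3)[OF assms(1)] assms(2,3) unfolding total_on_def lt_def by blast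

lemma lt_asym: "antisym r \<Longrightarrow> lt r x y \<Longrightarrow> \<not> lt r y x"
  unfolding lt_def antisym_def by blast

lemma index_cut_Dedekind: "index_cut \<kappa> \<mu> r I c J \<Longrightarrow> Dedekind_cut r I J"
  using index_cut_orderD(2,6,7)[of \<kappa> \<mu> r I c J]
  unfolding Dedekind_cut_def dense_no_endpoints_def lt_def antisym_def by metis

definition up_seg :: "'k rel \<Rightarrow> 'k set \<Rightarrow> 'k \<Rightarrow> 'k set" where
  "up_seg r I i = {x \<in> I. lt r i x}"

definition down_seg :: "'k rel \<Rightarrow> 'k set \<Rightarrow> 'k \<Rightarrow> 'k set" where
  "down_seg r J j = {x \<in> J. lt r x j}"

text \<open>The order is restricted as well, since an index cut is a linear order on nothing more than
  its index set.\<close>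

definition seg_rel :: "'k rel \<Rightarrow> 'k set \<Rightarrow> 'k \<Rightarrow> 'k set \<Rightarrow> 'k \<Rightarrow> 'k \<Rightarrow> 'k rel" where
  "seg_rel r I c J i j = Restr r (up_seg r I i \<union> {c} \<union> down_seg r J j)"

lemma lt_seg_rel:
  "x \<in> up_seg r I i \<union> {c} \<union> down_seg r J j \<Longrightarrow> y \<in> up_seg r I i \<union> {c} \<union> down_seg r J j \<Longrightarrow>
     lt (seg_rel r I c J i j) x y \<longleftrightarrow> lt r x y"
  by (auto simp: seg_rel_def lt_def)

lemma dense_up_seg:
  assumes "trans r" "antisym r" "dense_no_endpoints r I" "i \<in> I"
  shows "dense_no_endpoints r (up_seg r I i)"
  unfolding dense_no_endpoints_def
proof (intro conjI ballI impI)
  show "up_seg r I i \<noteq> {}" using assms(3,4) unfolding dense_no_endpoints_def up_seg_def by blast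
next
  fix x y assume "x \<in> up_seg r I i" "y \<in> up_seg r I i" "lt r x y"
  then show "\<exists>z\<in>up_seg r I i. lt r x z \<and> lt r z y"
    using assms(3) lt_trans[OF assms(1,2), of i x] unfolding dense_no_endpoints_def up_seg_def by blast
next
  fix x assume x: "x \<in> up_seg r I i"
  then show "\<exists>y\<in>up_seg r I i. lt r y x"
    using assms(3,4) unfolding dense_no_endpoints_def up_seg_def by blast
  show "\<exists>y\<in>up_seg r I i. lt r x y"
    using x assms(3) lt_trans[OF assms(1,2), of i x] unfolding dense_no_endpoints_def up_seg_def by blast
qed

lemma dense_down_seg:
  assumes "trans r" "antisym r" "dense_no_endpoints r J" "j \<in> J"
  shows "dense_no_endpoints r (down_seg r J j)"
  unfolding dense_no_endpoints_def
proof (intro conjI ballI impI)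
  show "down_seg r J j \<noteq> {}" using assms(3,4) unfolding dense_no_endpoints_def down_seg_def by blast
next
  fix x y assume "x \<in> down_seg r J j" "y \<in> down_seg r J j" "lt r x y"
  then show "\<exists>z\<in>down_seg r J j. lt r x z \<and> lt r z y"
    using assms(3) lt_trans[OF assms(1,2), of _ y j] unfolding dense_no_endpoints_def down_seg_def by blast
next
  fix x assume x: "x \<in> down_seg r J j"
  then show "\<exists>y\<in>down_seg r J j. lt r x y"
    using assms(3,4) unfolding dense_no_endpoints_def down_seg_def by blast
  show "\<exists>y\<in>down_seg r J j. lt r y x"
    using x assms(3) lt_trans[OF assms(1,2), of _ x j] unfolding dense_no_endpoints_def down_seg_def by blast
qed

lemma dense_no_endpoints_cong:
  "(\<And>x y. x \<in> I \<Longrightarrow> y \<in> I \<Longrightarrow> lt r0 x y \<longleftrightarrow> lt r x y) \<Longrightarrow> dense_no_endpoints r0 I \<longleftrightarrow> dense_no_endpoints r I"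
  unfolding dense_no_endpoints_def by (intro arg_cong2[of _ _ _ _ "(\<and>)"] ball_cong bex_cong imp_cong refl) auto

lemma index_cut_segment:
  assumes \<mu>: "Card_order \<mu>" "natLeq <o \<mu>" and cut: "index_cut \<kappa> \<mu> r I c J" and ij: "i \<in> I" "j \<in> J"
  shows "index_cut \<kappa> \<mu> (seg_rel r I c J i j) (up_seg r I i) c (down_seg r J j)"
proof -
  note D = index_cut_orderD[OF cut]
  let ?A = "up_seg r I i \<union> {c} \<union> down_seg r J j"
  let ?r = "seg_rel r I c J i j"
  have sub: "?A \<subseteq> I \<union> {c} \<union> J" by (auto simp: up_seg_def down_seg_def)
  have lt: "lt ?r x y \<longleftrightarrow> lt r x y" if "x \<in> ?A" "y \<in> ?A" for x y by (rule lt_seg_rel[OF that])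
  have "linear_order_on ?A ?r"
    unfolding linear_order_on_def partial_order_on_def preorder_on_def
  proof (intro conjI)
    show "?r \<subseteq> ?A \<times> ?A" by (auto simp: seg_rel_def)
    show "refl_on ?A ?r" using D(11) sub unfolding refl_on_def seg_rel_def by blast
    show "trans ?r" using D(1) unfolding trans_def seg_rel_def by blast
    show "antisym ?r" using D(2) unfolding antisym_def seg_rel_def by blast
    show "total_on ?A ?r" using D(3) sub unfolding total_on_def seg_rel_def by blast
  qed
  moreover have "|?A| <o \<kappa>" by (rule small_subset[OF D(8) sub])
  moreover have "\<forall>x \<in> up_seg r I i. lt ?r x c" using D(4) lt by (auto simp: up_seg_def)
  moreover have "\<forall>x \<in> down_seg r J j. lt ?r c x" using D(5) lt by (auto simp: down_seg_def)
  moreover have "dense_no_endpoints ?r (up_seg r I i)"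
    using dense_up_seg[OF D(1,2,6) ij(1)] by (subst dense_no_endpoints_cong[OF lt]) auto
  moreover have "dense_no_endpoints ?r (down_seg r J j)"
    using dense_down_seg[OF D(1,2,7) ij(2)] by (subst dense_no_endpoints_cong[OF lt]) auto
  moreover have "saturated \<mu> (order_struct ?r (up_seg r I i))"
    by (rule saturated_segment[OF \<mu> D(9) ij(1), of _ True]) (use lt in \<open>auto simp: up_seg_def\<close>)
  moreover have "saturated \<mu> (order_struct ?r (down_seg r J j))"
    by (rule saturated_segment[OF \<mu> D(10) ij(2), of _ False]) (use lt in \<open>auto simp: down_seg_def\<close>)
  ultimately show ?thesis unfolding index_cut_def by blast
qed

lemma finite_upper_bound:
  assumes ord: "trans r" "antisym r" and d: "dense_no_endpoints r I" and tot: "total_on I r"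
    and K: "finite K" "K \<subseteq> I"
  shows "\<exists>i \<in> I. \<forall>k \<in> K. lt r k i"
  using K
proof (induction K rule: finite_induct)
  case empty
  then show ?case using d by (auto simp: dense_no_endpoints_def)
next
  case (insert x K)
  then obtain i where i: "i \<in> I" "\<forall>k \<in> K. lt r k i" by auto
  define y where "y = (if lt r x i then i else x)"
  have y: "y \<in> I" "x = y \<or> lt r x y" "i = y \<or> lt r i y"
    using i insert.prems tot unfolding y_def total_on_def lt_def by auto
  obtain z where z: "z \<in> I" "lt r y z" using d y(1) unfolding dense_no_endpoints_def by blast
  have "lt r k z" if "k \<in> insert x K" for k
    using that y z i lt_trans[OF ord] by blast
  then show ?case using z(1) by blast
qed

text \<open>The type of a bound is finitely satisfiable, as the order has no endpoints. The flag \<open>up\<close>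
  chooses between upper and lower bounds.\<close>

lemma saturated_bound:
  fixes r :: "'k rel"
  defines "r' up \<equiv> if up then r else r\<inverse>"
  assumes ord: "trans r" "antisym r" and d: "dense_no_endpoints r I" and tot: "total_on I r"
    and sat: "saturated \<mu> (order_struct r I)" and K: "K \<subseteq> I" "|K| <o \<mu>"
  shows "\<exists>i \<in> I. \<forall>k \<in> K. lt (r' up) k i"
proof -
  have U: "univ (order_struct r I) = I" by (simp add: order_struct_def)
  have lt: "lt (r' True) x y \<longleftrightarrow> lt r x y" "lt (r' False) x y \<longleftrightarrow> lt r y x" for x y
    by (auto simp: r'_def lt_def)
  have r': "trans (r' up)" "antisym (r' up)" "dense_no_endpoints (r' up) I" "total_on I (r' up)"
  proof -
    show "dense_no_endpoints (r' up) I"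
      using d lt unfolding dense_no_endpoints_def by (cases up) (simp_all, blast)
  qed (use ord tot in \<open>auto simp: r'_def\<close>)
  let ?\<phi> = "Rel () (if up then [Var 1, Var 0] else [Var 0, Var 1]) :: (unit, unit) fm"
  have \<phi>: "satisfies (order_struct r I) (nth [b, k]) ?\<phi> \<longleftrightarrow> lt (r' up) k b" for b k
    using lt by (cases up) (simp_all add: order_struct_def)
  have "\<exists>b\<in>univ (order_struct r I). \<forall>(\<phi>, cs)\<in>(\<lambda>k. (?\<phi>, [k])) ` K. satisfies (order_struct r I) (nth (b # cs)) \<phi>"
  proof (rule sat[unfolded saturated_def, rule_format, of K], intro conjI allI impI)
    show "K \<subseteq> univ (order_struct r I)" "|K| <o \<mu>" using K U by auto
    show "(\<lambda>k. (?\<phi>, [k])) ` K \<subseteq>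
      {(\<phi>, cs). set cs \<subseteq> K \<and> \<phi> \<in> formulas (order_struct r I) (1 + length cs)}"
      by (auto simp: formulas_def order_struct_def)
  next
    fix q assume q: "finite q \<and> q \<subseteq> (\<lambda>k. (?\<phi>, [k])) ` K"
    then obtain K0 where K0: "finite K0" "K0 \<subseteq> K" "q = (\<lambda>k. (?\<phi>, [k])) ` K0"
      using finite_subset_image[of q] by metis
    obtain i where i: "i \<in> I" "\<forall>k \<in> K0. lt (r' up) k i"
      using finite_upper_bound[OF r' K0(1)] K0(2) K(1) by blast
    show "\<exists>b\<in>univ (order_struct r I). \<forall>(\<phi>, cs)\<in>q. satisfies (order_struct r I) (nth (b # cs)) \<phi>"
      unfolding U by (rule bexI[OF _ i(1)]) (use i(2) \<phi> in \<open>simp add: K0(3)\<close>)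
  qed
  then obtain b where "b \<in> I" "\<forall>(\<phi>, cs)\<in>(\<lambda>k. (?\<phi>, [k])) ` K. satisfies (order_struct r I) (nth (b # cs)) \<phi>"
    unfolding U by (rule bexE)
  then show ?thesis using \<phi> by (intro bexI[of _ b]) auto
qed

lemma saturated_segments_bound:
  assumes cut: "index_cut \<kappa> \<mu> r I c J" and K: "|K| <o \<mu>"
  obtains i j where "i \<in> I" "j \<in> J" "\<And>k. k \<in> K \<inter> I \<Longrightarrow> lt r k i" "\<And>k. k \<in> K \<inter> J \<Longrightarrow> lt r j k"
proof -
  note D = index_cut_orderD[OF cut]
  have tot: "total_on I r" "total_on J r" using D(3) unfolding total_on_def by blast+
  have K': "|K \<inter> I| <o \<mu>" "|K \<inter> J| <o \<mu>" using small_subset[OF K] by auto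
  obtain i where "i \<in> I" "\<forall>k \<in> K \<inter> I. lt r k i"
    using saturated_bound[OF D(1,2,6) tot(1) D(9) _ K'(1), of True] by auto
  moreover obtain j where "j \<in> J" "\<forall>k \<in> K \<inter> J. lt (r\<inverse>) k j"
    using saturated_bound[OF D(1,2,7) tot(2) D(10) _ K'(2), of False] by auto
  ultimately show ?thesis using that[of i j] by (auto simp: lt_def)
qed

lemma finite_sorted_list:
  assumes "index_cut \<kappa> \<mu> r I c J" "finite X" "X \<subseteq> I \<union> {c} \<union> J"
  shows "\<exists>xs. set xs = X \<and> sorted_wrt (lt r) xs"
  using assms(2,3)
proof (induction X rule: finite_induct)
  case (insert x X)
  then obtain xs where xs: "set xs = X" "sorted_wrt (lt r) xs" by auto
  let ?ys = "filter (\<lambda>y. lt r y x) xs @ [x] @ filter (\<lambda>y. lt r x y) xs"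
  have "lt r y x \<or> lt r x y" if "y \<in> X" for y
    using lt_linear[OF assms(1), of x y] that insert by blast
  then have "set ?ys = insert x X" using xs(1) by auto
  moreover have "sorted_wrt (lt r) ?ys"
    using xs(2) lt_trans[OF index_cut_orderD(1,2)[OF assms(1)], of _ x]
    by (auto simp: sorted_wrt_append intro!: sorted_wrt_filter)
  ultimately show ?case by blast
qed (auto intro: exI[of _ "[]"])

section \<open>Indiscernible sequences and automorphisms\<close>

text \<open>In the models considered here, this is indiscernibility over small sets. Conjugacy by
  automorphisms passes to definable structures and to images under definable functions without
  any manipulation of formulas.\<close>

definition aut_indiscernible ::
  "('f, 'r, 'a) struct \<Rightarrow> 'k rel \<Rightarrow> 'k set \<Rightarrow> ('k \<Rightarrow> 'a list) \<Rightarrow> 'a set \<Rightarrow> bool" where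
  "aut_indiscernible M r K a B \<longleftrightarrow>
     (\<forall>ks ls. set ks \<subseteq> K \<and> set ls \<subseteq> K \<and> length ks = length ls \<and>
        sorted_wrt (lt r) ks \<and> sorted_wrt (lt r) ls \<longrightarrow>
        (\<exists>\<sigma>. automorphism M \<sigma> \<and> (\<forall>x \<in> B. \<sigma> x = x) \<and> map (map \<sigma> \<circ> a) ks = map a ls))"

lemma set_concat_tuples:
  "(\<And>k. k \<in> K \<Longrightarrow> a k \<in> tuples p U) \<Longrightarrow> set ks \<subseteq> K \<Longrightarrow> set (concat (map a ks)) \<subseteq> U"
  by (induction ks) (auto simp: tuples_def)

lemma length_concat_tuples:
  "(\<And>k. k \<in> K \<Longrightarrow> a k \<in> tuples p U) \<Longrightarrow> set ks \<subseteq> K \<Longrightarrow> length (concat (map a ks)) = length ks * p"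
  by (induction ks) (auto simp: tuples_def)

lemma indiscernible_iff_automorphisms:
  assumes \<kappa>: "Card_order \<kappa>" "natLeq <o \<kappa>" and M: "structure_ok M" "strongly_homogeneous \<kappa> M"
    and B: "B \<subseteq> univ M" "|B| <o \<kappa>" and a: "\<And>k. k \<in> K \<Longrightarrow> a k \<in> tuples p (univ M)"
  shows "indiscernible M r K a B \<longleftrightarrow> aut_indiscernible M r K a B"
proof -
  have "tp M (concat (map a ks)) B = tp M (concat (map a ls)) B \<longleftrightarrow>
      (\<exists>\<sigma>. automorphism M \<sigma> \<and> (\<forall>x \<in> B. \<sigma> x = x) \<and> map (map \<sigma> \<circ> a) ks = map a ls)"
    if ks: "set ks \<subseteq> K" "set ls \<subseteq> K" "length ks = length ls" for ks ls
  proof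
    assume tp: "tp M (concat (map a ks)) B = tp M (concat (map a ls)) B"
    have small: "|B \<union> set (concat (map a ks))| <o \<kappa>"
      by (rule small_Un[OF \<kappa> B(2) small_finite[OF \<kappa>(2)]]) simp
    have len: "length (concat (map a ks)) = length (concat (map a ls))"
      using length_concat_tuples[OF a ks(1)] length_concat_tuples[OF a ks(2)] ks(3) by simp
    have "\<exists>\<sigma>. automorphism M \<sigma> \<and> (\<forall>x \<in> B. \<sigma> x = x) \<and> map \<sigma> (concat (map a ks)) = concat (map a ls)"
      by (rule tp_eq_automorphism[OF M(2) small len tp set_concat_tuples[OF a ks(1)]
            set_concat_tuples[OF a ks(2)] B(1)])
    then obtain \<sigma> where \<sigma>: "automorphism M \<sigma>" "\<forall>x \<in> B. \<sigma> x = x"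
      "map \<sigma> (concat (map a ks)) = concat (map a ls)" by blast
    have "map (map \<sigma> \<circ> a) ks = map a ls"
    proof (rule concat_tuples_inj[where n = p])
      show "concat (map (map \<sigma> \<circ> a) ks) = concat (map a ls)" using \<sigma>(3) by (simp add: map_concat)
    qed (use ks a in \<open>auto simp: tuples_def\<close>)
    then show "\<exists>\<sigma>. automorphism M \<sigma> \<and> (\<forall>x \<in> B. \<sigma> x = x) \<and> map (map \<sigma> \<circ> a) ks = map a ls"
      using \<sigma>(1,2) by blast
  next
    assume "\<exists>\<sigma>. automorphism M \<sigma> \<and> (\<forall>x \<in> B. \<sigma> x = x) \<and> map (map \<sigma> \<circ> a) ks = map a ls"
    then obtain \<sigma> where \<sigma>: "automorphism M \<sigma>" "\<forall>x \<in> B. \<sigma> x = x" "map (map \<sigma> \<circ> a) ks = map a ls"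
      by blast
    have m: "map \<sigma> (concat (map a ks)) = concat (map a ls)" using \<sigma>(3) by (simp add: map_concat)
    have "tp M (map \<sigma> (concat (map a ks))) B = tp M (concat (map a ks)) B"
      by (rule automorphism_tp[OF M(1) \<sigma>(1) set_concat_tuples[OF a ks(1)] B(1)]) (use \<sigma>(2) in blast)+
    then show "tp M (concat (map a ks)) B = tp M (concat (map a ls)) B" unfolding m by (rule sym)
  qed
  note eq = this
  show ?thesis unfolding indiscernible_def aut_indiscernible_def
    by (intro iff_allI imp_cong refl, elim conjE) (rule eq)
qed

lemma sorted_wrt_lt_cong:
  assumes "set ks \<subseteq> K" "\<And>x y. x \<in> K \<Longrightarrow> y \<in> K \<Longrightarrow> lt r' x y \<longleftrightarrow> lt r x y" "sorted_wrt (lt r') ks"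
  shows "sorted_wrt (lt r) ks"
  using assms(3) by (rule sorted_wrt_mono_rel[rotated]) (use assms(1,2) in auto)

lemma aut_indiscernibleD:
  assumes "aut_indiscernible M r K a B" "k \<in> K" "l \<in> K"
  shows "\<exists>\<sigma>. automorphism M \<sigma> \<and> (\<forall>x \<in> B. \<sigma> x = x) \<and> map \<sigma> (a k) = a l"
  using assms(1)[unfolded aut_indiscernible_def, rule_format, of "[k]" "[l]"] assms(2,3) by auto

lemma aut_indiscernible_transport:
  assumes "aut_indiscernible M r K a B" "K' \<subseteq> K" "\<And>x y. x \<in> K' \<Longrightarrow> y \<in> K' \<Longrightarrow> lt r' x y \<longleftrightarrow> lt r x y"
    "\<And>\<sigma> ks ls. automorphism M \<sigma> \<Longrightarrow> (\<forall>x \<in> B. \<sigma> x = x) \<Longrightarrow> set ks \<subseteq> K' \<Longrightarrow> set ls \<subseteq> K' \<Longrightarrow>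
      length ks = length ls \<Longrightarrow> map (map \<sigma> \<circ> a) ks = map a ls \<Longrightarrow>
      \<exists>\<tau>. automorphism M' \<tau> \<and> (\<forall>x \<in> B'. \<tau> x = x) \<and> map (map \<tau> \<circ> a') ks = map a' ls"
  shows "aut_indiscernible M' r' K' a' B'"
  unfolding aut_indiscernible_def
proof (intro allI impI, elim conjE)
  fix ks ls assume ks: "set ks \<subseteq> K'" "set ls \<subseteq> K'" "length ks = length ls"
    "sorted_wrt (lt r') ks" "sorted_wrt (lt r') ls"
  have "sorted_wrt (lt r) ks" "sorted_wrt (lt r) ls"
    using sorted_wrt_lt_cong[OF ks(1) assms(3) ks(4)] sorted_wrt_lt_cong[OF ks(2) assms(3) ks(5)]
    by simp_all
  then obtain \<sigma> where "automorphism M \<sigma>" "\<forall>x \<in> B. \<sigma> x = x" "map (map \<sigma> \<circ> a) ks = map a ls"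
    using assms(1)[unfolded aut_indiscernible_def, rule_format, of ks ls] ks assms(2) by auto
  then show "\<exists>\<tau>. automorphism M' \<tau> \<and> (\<forall>x \<in> B'. \<tau> x = x) \<and> map (map \<tau> \<circ> a') ks = map a' ls"
    using assms(4) ks by blast
qed

text \<open>An increasing tuple of indices from \<open>K0\<close> stays increasing when it is placed between \<open>pre\<close> and
  \<open>post\<close>, so an automorphism for the longer tuples fixes the appended entries.\<close>

lemma aut_indiscernible_append:
  assumes ind: "aut_indiscernible M r K a B" and sub: "set pre \<subseteq> K" "set post \<subseteq> K" "K0 \<subseteq> K"
    and sorted: "sorted_wrt (lt r) pre" "sorted_wrt (lt r) post"
    and less: "\<And>x k. x \<in> set pre \<Longrightarrow> k \<in> K0 \<Longrightarrow> lt r x k" "\<And>k y. k \<in> K0 \<Longrightarrow> y \<in> set post \<Longrightarrow> lt r k y"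
      "\<And>x y. x \<in> set pre \<Longrightarrow> y \<in> set post \<Longrightarrow> lt r x y"
    and ord: "\<And>x y. x \<in> K0 \<Longrightarrow> y \<in> K0 \<Longrightarrow> lt r0 x y \<longleftrightarrow> lt r x y"
    and ms: "set ms \<subseteq> set pre \<union> set post"
  shows "aut_indiscernible M r0 K0 (\<lambda>k. a k @ concat (map a ms)) B"
  unfolding aut_indiscernible_def
proof (intro allI impI, elim conjE)
  fix ks ls assume ks: "set ks \<subseteq> K0" "set ls \<subseteq> K0" "length ks = length ls"
    "sorted_wrt (lt r0) ks" "sorted_wrt (lt r0) ls"
  have "sorted_wrt (lt r) ks" "sorted_wrt (lt r) ls"
    using sorted_wrt_lt_cong[OF ks(1) ord ks(4)] sorted_wrt_lt_cong[OF ks(2) ord ks(5)]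
    by simp_all
  then have "sorted_wrt (lt r) (pre @ ks @ post)" "sorted_wrt (lt r) (pre @ ls @ post)"
    using sorted less ks(1,2) by (auto simp: sorted_wrt_append subset_iff)
  moreover have "set (pre @ ks @ post) \<subseteq> K" "set (pre @ ls @ post) \<subseteq> K" using ks(1,2) sub by auto
  moreover have "length (pre @ ks @ post) = length (pre @ ls @ post)" using ks(3) by simp
  ultimately have "\<exists>\<sigma>. automorphism M \<sigma> \<and> (\<forall>x \<in> B. \<sigma> x = x) \<and>
      map (map \<sigma> \<circ> a) (pre @ ks @ post) = map a (pre @ ls @ post)"
    by (intro ind[unfolded aut_indiscernible_def, rule_format] conjI)
  then obtain \<sigma> where \<sigma>: "automorphism M \<sigma>" "\<forall>x \<in> B. \<sigma> x = x"
    "map (map \<sigma> \<circ> a) (pre @ ks @ post) = map a (pre @ ls @ post)" by blast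
  then have eq: "map (map \<sigma> \<circ> a) pre = map a pre" "map (map \<sigma> \<circ> a) post = map a post"
    "map (map \<sigma> \<circ> a) ks = map a ls" using ks(3) by auto
  have "map \<sigma> (a m) = a m" if "m \<in> set ms" for m using that ms eq(1,2) by auto
  then have "map \<sigma> (concat (map a ms)) = concat (map a ms)" by (induction ms) auto
  then have "map (map \<sigma> \<circ> (\<lambda>k. a k @ concat (map a ms))) ks = map (\<lambda>k. a k @ concat (map a ms)) ls"
    using eq(3) ks(3) by (auto simp: list_eq_iff_nth_eq[of "map _ _"])
  with \<sigma> show "\<exists>\<sigma>. automorphism M \<sigma> \<and> (\<forall>x \<in> B. \<sigma> x = x) \<and>
      map (map \<sigma> \<circ> (\<lambda>k. a k @ concat (map a ms))) ks = map (\<lambda>k. a k @ concat (map a ms)) ls" by blast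
qed

section \<open>Closure under terms\<close>

lemma fun_terms_mono: "G \<subseteq> G' \<Longrightarrow> n \<le> n' \<Longrightarrow> t \<in> fun_terms G n \<Longrightarrow> t \<in> fun_terms G' n'"
proof -
  have "wf_tm G' fst t" if "G \<subseteq> G'" "wf_tm G fst t" for t
    using that by (induction t) auto
  then show "G \<subseteq> G' \<Longrightarrow> n \<le> n' \<Longrightarrow> t \<in> fun_terms G n \<Longrightarrow> t \<in> fun_terms G' n'"
    by (auto simp: fun_terms_def)
qed

lemma app_term_cong:
  "t \<in> fun_terms G n \<Longrightarrow> (\<And>i. i < n \<Longrightarrow> xs ! i = ys ! i) \<Longrightarrow> app_term t xs = app_term t ys"
  unfolding app_term_def by (rule eval_tm_cong) (auto simp: fun_terms_def)

lemma app_subst_term: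
  "app_term (subst_tm \<tau> t) xs = eval_tm snd (\<lambda>i. app_term (\<tau> i) xs) t"
  by (simp add: app_term_def eval_subst_tm)

lemma subst_fun_terms:
  "t \<in> fun_terms G n \<Longrightarrow> (\<And>i. i < n \<Longrightarrow> \<tau> i \<in> fun_terms G m) \<Longrightarrow> subst_tm \<tau> t \<in> fun_terms G m"
  unfolding fun_terms_def by (auto simp: tm_vars_subst intro!: wf_subst_tm)

lemma Var_fun_terms [simp]: "Var i \<in> fun_terms G n \<longleftrightarrow> i < n"
  by (auto simp: fun_terms_def)

lemma generated_mono: "G \<subseteq> G' \<Longrightarrow> X \<subseteq> Y \<Longrightarrow> generated G X \<subseteq> generated G' Y"
  unfolding generated_def using fun_terms_mono[OF _ order.refl] by blast

lemma generated_superset: "X \<subseteq> generated G X"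
proof
  fix x assume "x \<in> X"
  then show "x \<in> generated G X" unfolding generated_def
    by (intro CollectI exI[of _ "Var 0"] exI[of _ "[x]"]) (auto simp: app_term_def)
qed

text \<open>The lists of arguments of finitely many terms are concatenated, and the variables of the
  terms are shifted accordingly.\<close>

lemma generated_list:
  "set as \<subseteq> generated G X \<Longrightarrow>
     \<exists>bs qs. set bs \<subseteq> X \<and> set qs \<subseteq> fun_terms G (length bs) \<and> as = map (\<lambda>q. app_term q bs) qs"
proof (induction as)
  case Nil
  show ?case by (intro exI[of _ "[]"]) simp
next
  case (Cons a as)
  then obtain bs qs where IH: "set bs \<subseteq> X" "set qs \<subseteq> fun_terms G (length bs)"
    "as = map (\<lambda>q. app_term q bs) qs" by auto
  obtain t cs where t: "a = app_term t cs" "set cs \<subseteq> X" "t \<in> fun_terms G (length cs)"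
    using Cons.prems by (auto simp: generated_def)
  let ?sh = "subst_tm (\<lambda>j. Var (length cs + j))"
  have "app_term t (cs @ bs) = a" unfolding t(1)
    by (rule app_term_cong[OF t(3)]) (simp add: nth_append)
  moreover have "app_term (?sh q) (cs @ bs) = app_term q bs" if "q \<in> set qs" for q
    unfolding app_subst_term unfolding app_term_def by (simp add: nth_append)
  moreover have "t \<in> fun_terms G (length (cs @ bs))" by (rule fun_terms_mono[OF order.refl _ t(3)]) simp
  moreover have "?sh q \<in> fun_terms G (length (cs @ bs))" if "q \<in> set qs" for q
    by (rule subst_fun_terms) (use IH(2) that in auto)
  ultimately show ?case using IH t(2)
    by (intro exI[of _ "cs @ bs"] exI[of _ "t # map ?sh qs"]) auto
qed

lemma generated_term:
  assumes "t \<in> fun_terms G (length as)" "set as \<subseteq> generated G X"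
  shows "app_term t as \<in> generated G X"
proof -
  obtain bs qs where q: "set bs \<subseteq> X" "set qs \<subseteq> fun_terms G (length bs)" "as = map (\<lambda>q. app_term q bs) qs"
    using generated_list[OF assms(2)] by blast
  have t: "t \<in> fun_terms G (length qs)" using assms(1) q(3) by simp
  have "app_term (subst_tm (nth qs) t) bs = app_term t as"
    unfolding app_subst_term unfolding app_term_def
    by (rule eval_tm_cong) (use t in \<open>auto simp: q(3) fun_terms_def app_term_def\<close>)
  moreover have "subst_tm (nth qs) t \<in> fun_terms G (length bs)"
    by (rule subst_fun_terms[OF t]) (use q(2) nth_mem in blast)
  ultimately show ?thesis using q(1) unfolding generated_def by (metis (mono_tags, lifting) mem_Collect_eq)
qed

lemma generated_idem [simp]: "generated G (generated G X) = generated G X"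
proof
  show "generated G (generated G X) \<subseteq> generated G X"
  proof
    fix x assume "x \<in> generated G (generated G X)"
    then obtain t as where "x = app_term t as" "set as \<subseteq> generated G X" "t \<in> fun_terms G (length as)"
      unfolding generated_def[of G "generated G X"] by blast
    then show "x \<in> generated G X" using generated_term by blast
  qed
qed (rule generated_superset)

lemma generated_subset_iff: "generated G X \<subseteq> generated G Y \<longleftrightarrow> X \<subseteq> generated G Y"
  using generated_mono[of G G X "generated G Y"] generated_superset[of X G] by auto

lemma generated_finite:
  assumes "finite Z" "Z \<subseteq> generated G X"
  shows "\<exists>Y. finite Y \<and> Y \<subseteq> X \<and> Z \<subseteq> generated G Y"
proof -
  obtain as where as: "set as = Z" using finite_list[OF assms(1)] by blast
  obtain bs qs where q: "set bs \<subseteq> X" "set qs \<subseteq> fun_terms G (length bs)" "as = map (\<lambda>q. app_term q bs) qs"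
    using generated_list[of as G X] assms(2) as by blast
  have "Z \<subseteq> generated G (set bs)"
  proof
    fix z assume "z \<in> Z"
    then obtain q' where "q' \<in> set qs" "z = app_term q' bs" using as q(3) by auto
    then show "z \<in> generated G (set bs)"
      using q(2) generated_superset[of "set bs" G] by (auto intro!: generated_term)
  qed
  then show ?thesis using q(1) by blast
qed

lemma generated_set_list:
  assumes "set as \<subseteq> generated G (set xs)"
  shows "\<exists>qs. set qs \<subseteq> fun_terms G (length xs) \<and> as = map (\<lambda>q. app_term q xs) qs"
proof -
  obtain bs qs where q: "set bs \<subseteq> set xs" "set qs \<subseteq> fun_terms G (length bs)" "as = map (\<lambda>q. app_term q bs) qs"
    using generated_list[OF assms] by blast
  have "\<forall>i < length bs. \<exists>j < length xs. xs ! j = bs ! i" using q(1) nth_mem by (fastforce simp: in_set_conv_nth subset_iff)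
  then obtain j where j: "\<And>i. i < length bs \<Longrightarrow> j i < length xs \<and> xs ! j i = bs ! i" by metis
  let ?sh = "subst_tm (\<lambda>i. Var (j i))"
  have "app_term (?sh q) xs = app_term q bs" if "q \<in> set qs" for q
    unfolding app_subst_term unfolding app_term_def
    by (rule eval_tm_cong) (use q(2) that j in \<open>auto simp: fun_terms_def app_term_def subset_iff\<close>)
  moreover have "?sh q \<in> fun_terms G (length xs)" if "q \<in> set qs" for q
    by (rule subst_fun_terms) (use q(2) that j in auto)
  ultimately show ?thesis using q(3) by (intro exI[of _ "map ?sh qs"]) auto
qed

definition equivariant :: "('a \<Rightarrow> 'a) \<Rightarrow> 'a nfun set \<Rightarrow> 'a set \<Rightarrow> bool" where
  "equivariant \<sigma> G U \<longleftrightarrow> (\<forall>f \<in> G. \<forall>as \<in> tuples (fst f) U. \<sigma> (snd f as) = snd f (map \<sigma> as))"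

definition operations_on :: "'a nfun set \<Rightarrow> 'a set \<Rightarrow> bool" where
  "operations_on G U \<longleftrightarrow> (\<forall>f \<in> G. \<forall>as \<in> tuples (fst f) U. snd f as \<in> U)"

lemma app_term_in:
  assumes "operations_on G U" "t \<in> fun_terms G (length as)" "set as \<subseteq> U"
  shows "app_term t as \<in> U"
  unfolding app_term_def
proof (rule eval_tm_univ)
  show "wf_tm G fst t" using assms(2) by (simp add: fun_terms_def)
  show "as ! i \<in> U" if "i \<in> tm_vars t" for i
  proof -
    have "i < length as" using that assms(2) by (auto simp: fun_terms_def)
    then show ?thesis using assms(3) nth_mem by blast
  qed
qed (use assms(1) in \<open>auto simp: operations_on_def\<close>)

lemma app_term_equivariant:
  assumes "operations_on G U" "equivariant \<sigma> G U" "t \<in> fun_terms G (length as)" "set as \<subseteq> U"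
  shows "\<sigma> (app_term t as) = app_term t (map \<sigma> as)"
proof -
  have i: "i < length as" if "i \<in> tm_vars t" for i using that assms(3) by (auto simp: fun_terms_def)
  have "\<sigma> (eval_tm snd (nth as) t) = eval_tm snd (\<sigma> \<circ> nth as) (map_tm id t)"
  proof (rule eval_tm_hom)
    show "wf_tm G fst t" using assms(3) by (simp add: fun_terms_def)
    show "as ! i \<in> U" if "i \<in> tm_vars t" for i using i[OF that] assms(4) nth_mem by blast
  qed (use assms(1,2) in \<open>auto simp: operations_on_def equivariant_def\<close>)
  also have "\<dots> = eval_tm snd (nth (map \<sigma> as)) t"
    unfolding tm.map_id by (rule eval_tm_cong) (simp add: i)
  finally show ?thesis by (simp add: app_term_def)
qed

lemma generated_subset:
  assumes "operations_on G U" "X \<subseteq> U"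
  shows "generated G X \<subseteq> U"
  unfolding generated_def using app_term_in[OF assms(1)] assms(2) by blast

lemma generated_fixed:
  assumes "operations_on G U" "equivariant \<sigma> G U" "X \<subseteq> U" "\<forall>x \<in> X. \<sigma> x = x" "y \<in> generated G X"
  shows "\<sigma> y = y"
proof -
  obtain t as where t: "y = app_term t as" "set as \<subseteq> X" "t \<in> fun_terms G (length as)"
    using assms(5) by (auto simp: generated_def)
  have "map \<sigma> as = as" using t(2) assms(4) by (intro map_idI) auto
  then show ?thesis using app_term_equivariant[OF assms(1,2) t(3)] t(1,2) assms(3) by simp
qed

lemma definable_functions_equivariant:
  assumes S: "structure_ok S" and \<sigma>: "automorphism S \<sigma>"
  shows "operations_on (definable_functions S) (univ S)" "equivariant \<sigma> (definable_functions S) (univ S)"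
proof -
  have 1: "snd h as \<in> univ S" if "h \<in> definable_functions S" "as \<in> tuples (fst h) (univ S)" for h as
    using that by (auto simp: definable_functions_def)
  then show "operations_on (definable_functions S) (univ S)" by (simp add: operations_on_def)
  have "\<sigma> (snd h as) = snd h (map \<sigma> as)"
    if h: "h \<in> definable_functions S" "as \<in> tuples (fst h) (univ S)" for h as
  proof -
    have d: "definable S (fst h + 1) (graph (fst h) (univ S) (snd h))"
      using h(1) by (auto simp: definable_functions_def)
    have "as @ [snd h as] \<in> tuples (fst h + 1) (univ S)" using h 1 by (auto simp: tuples_def)
    from automorphism_definable[OF S \<sigma> d this]
    have "map \<sigma> (as @ [snd h as]) \<in> graph (fst h) (univ S) (snd h)"
      using h(2) by (auto simp: graph_def)
    then show ?thesis by (auto simp: graph_def)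
  qed
  then show "equivariant \<sigma> (definable_functions S) (univ S)" by (simp add: equivariant_def)
qed

section \<open>Functions and sequences in the expansion\<close>

locale expansion =
  fixes NN :: "('f, 'r, 'a) struct" and RR :: "('g, 's, 'a) struct"
    and N R :: "'a set" and FN FR F :: "'a nfun set" and lam :: "'a \<Rightarrow> 'a"
    and NR :: "('f, 'r option, 'a) struct"
    and \<kappa> :: "'k rel" and \<mu> :: "'m rel"
  assumes NN_ok: "structure_ok NN" and N_def: "N = univ NN" and R_sub: "R \<subseteq> N" and NR_def: "NR = expand NN R"
    and RR_ok: "structure_ok RR" and univ_RR: "univ RR = R" and RR_sym: "symbols_definable_in RR NR"
    and FN_def: "FN \<subseteq> definable_functions NN" and FR_def: "FR \<subseteq> definable_functions RR"
    and lam: "lam \<in> N \<rightarrow>\<^sub>E R" and lam_def: "definable NR 2 {[x, lam x] | x. x \<in> N}"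
    and F_def: "F = all_funs N lam FN FR"
    and mu: "Card_order \<mu>" "natLeq <o \<mu>" "|fsyms NN| <o \<mu>" "|rsyms NN| <o \<mu>"
    and kappa: "Card_order \<kappa>" "|Pow (Field \<mu>)| <o \<kappa>"
    and monster: "monster \<kappa> NR"
    and distal_NN: "distal \<kappa> \<mu> NN" and distal_RR: "distal \<kappa> \<mu> RR"
    and two: "\<And>M b b'. M \<subseteq> N \<Longrightarrow> |M| <o \<kappa> \<Longrightarrow> generated F M = M \<Longrightarrow> b \<in> R \<Longrightarrow> b' \<in> R \<Longrightarrow>
                tp RR [b] (M \<inter> R) = tp RR [b'] (M \<inter> R) \<Longrightarrow> tp NR [b] M = tp NR [b'] M"
    and three: "\<And>M b b'. M \<subseteq> N \<Longrightarrow> |M| <o \<kappa> \<Longrightarrow> generated F M = M \<Longrightarrow> b \<in> N \<Longrightarrow> b' \<in> N \<Longrightarrow>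
                tp NN [b] M = tp NN [b'] M \<Longrightarrow> (\<And>x. x \<in> generated FN (insert b M) \<Longrightarrow> lam x \<in> M) \<Longrightarrow>
                tp NR [b] M = tp NR [b'] M"
    and four: "variable_separation \<kappa> \<mu> NR R lam FN FR"
begin

lemma univ_NR [simp]: "univ NR = N"
  by (simp add: NR_def expand_def N_def)

lemma NR: "structure_ok NR" "saturated \<kappa> NR" "strongly_homogeneous \<kappa> NR"
  using monster by (simp_all add: monster_def)

lemma mu_less_kappa: "\<mu> <o \<kappa>"
proof -
  have "\<mu> =o |Field \<mu>|" by (rule ordIso_symmetric[OF card_of_Field_ordIso[OF mu(1)]])
  moreover have "|Field \<mu>| <o \<kappa>" by (rule ordLess_transitive[OF card_of_Pow kappa(2)])
  ultimately show ?thesis by (rule ordIso_ordLess_trans)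
qed

lemma kappa': "Card_order \<kappa>" "natLeq <o \<kappa>"
  using kappa(1) ordLess_transitive[OF mu(2) mu_less_kappa] by simp_all

lemma small_mu: "|A| <o \<mu> \<Longrightarrow> |A| <o \<kappa>"
  by (rule ordLess_transitive[OF _ mu_less_kappa])

lemma definable_NN: "definable_structure NN NR"
  unfolding NR_def by (rule definable_structure_reduct[OF NN_ok]) (use R_sub N_def in simp)

lemma definable_RR: "definable_structure RR NR"
proof -
  have "{[x] | x. x \<in> R} = {as \<in> tuples 1 (univ NR). satisfies NR (nth as) (Rel None [Var 0])}"
    using R_sub by (auto simp: tuples_def length_Suc_conv) (auto simp: NR_def expand_def)
  moreover have "Rel None [Var 0] \<in> formulas NR 1" by (auto simp: formulas_def NR_def expand_def)
  ultimately have "definable NR 1 {[x] | x. x \<in> R}" unfolding definable_def by blast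
  then show ?thesis using RR_ok univ_RR R_sub RR_sym by (simp add: definable_structure_def)
qed

lemma automorphism_NN: "automorphism NR \<sigma> \<Longrightarrow> automorphism NN \<sigma>"
  by (rule automorphism_definable_structure[OF NR(1) _ definable_NN])

lemma automorphism_RR: "automorphism NR \<sigma> \<Longrightarrow> automorphism RR \<sigma>"
  by (rule automorphism_definable_structure[OF NR(1) _ definable_RR])

lemma F_functions:
  assumes \<sigma>: "automorphism NR \<sigma>"
  shows "operations_on F N" "equivariant \<sigma> F N"
proof -
  note FN' = definable_functions_equivariant[OF NN_ok automorphism_NN[OF \<sigma>], folded N_def]
  note FR' = definable_functions_equivariant[OF RR_ok automorphism_RR[OF \<sigma>], unfolded univ_RR]
  have lamR: "lam x \<in> R" if "x \<in> N" for x using lam that by auto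
  have \<sigma>N: "\<sigma> x \<in> N" if "x \<in> N" for x using automorphism_univ[OF \<sigma>] that by simp
  have \<sigma>lam: "\<sigma> (lam x) = lam (\<sigma> x)" if x: "x \<in> N" for x
  proof -
    have "[x, lam x] \<in> tuples 2 (univ NR)" using x lamR[OF x] R_sub by (auto simp: tuples_def)
    from automorphism_definable[OF NR(1) \<sigma> lam_def this] x
    have "[\<sigma> x, \<sigma> (lam x)] \<in> {[x, lam x] | x. x \<in> N}" by auto
    then show ?thesis by auto
  qed
  have cases: "f \<in> FN \<or> f = lam_fun N lam \<or> (\<exists>h \<in> FR. f = lift_fun N lam h)" if "f \<in> F" for f
    using that by (auto simp: F_def all_funs_def R_funs_def)
  have one: "\<exists>x \<in> N. as = [x]" if "as \<in> tuples 1 N" for as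
    using that by (auto simp: tuples_def length_Suc_conv)
  have lam1: "snd (lam_fun N lam) [x] = lam x" if "x \<in> N" for x
    using that by (simp add: lam_fun_def tuples_def)
  have lift: "snd (lift_fun N lam h) as = snd h (map lam as)" "fst (lift_fun N lam h) = fst h"
    "map lam as \<in> tuples (fst h) R"
    if "as \<in> tuples (fst h) N" for h as
    using that lamR by (auto simp: lift_fun_def tuples_def)
  have fl: "fst (lift_fun N lam h) = fst h" "fst (lam_fun N lam) = 1" for h
    by (auto simp: lift_fun_def lam_fun_def)
  have tup: "map \<sigma> as \<in> tuples n N" if "as \<in> tuples n N" for as n
    using that \<sigma>N by (auto simp: tuples_def)
  have FRs: "h \<in> definable_functions RR" if "h \<in> FR" for h using that FR_def by blast
  have FNs: "h \<in> definable_functions NN" if "h \<in> FN" for h using that FN_def by blast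
  show "operations_on F N" unfolding operations_on_def
  proof (intro ballI)
    fix f as assume f: "f \<in> F" and as: "as \<in> tuples (fst f) N"
    from cases[OF f] consider "f \<in> FN" | "f = lam_fun N lam" | h where "h \<in> FR" "f = lift_fun N lam h" by blast
    then show "snd f as \<in> N"
    proof cases
      case 1
      then show ?thesis using FNs FN'(1) as unfolding operations_on_def by blast
    next
      case 2
      then obtain x where "x \<in> N" "as = [x]" using one as fl(2) by auto
      then show ?thesis using 2 lam1 lamR R_sub by auto
    next
      case 3
      then have as': "as \<in> tuples (fst h) N" using as fl(1) by simp
      have "snd h (map lam as) \<in> R"
        using lift(3)[OF as'] FRs[OF 3(1)] FR'(1) unfolding operations_on_def by blast
      then show ?thesis using lift(1)[OF as'] 3(2) R_sub by auto
    qed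
  qed
  show "equivariant \<sigma> F N" unfolding equivariant_def
  proof (intro ballI)
    fix f as assume f: "f \<in> F" and as: "as \<in> tuples (fst f) N"
    from cases[OF f] consider "f \<in> FN" | "f = lam_fun N lam" | h where "h \<in> FR" "f = lift_fun N lam h" by blast
    then show "\<sigma> (snd f as) = snd f (map \<sigma> as)"
    proof cases
      case 1
      then show ?thesis using FNs FN'(2) as unfolding equivariant_def by blast
    next
      case 2
      then obtain x where "x \<in> N" "as = [x]" using one as fl(2) by auto
      then show ?thesis using 2 lam1 \<sigma>N \<sigma>lam by simp
    next
      case 3
      then have as': "as \<in> tuples (fst h) N" using as fl(1) by simp
      have "\<sigma> (snd h (map lam as)) = snd h (map \<sigma> (map lam as))"
        using lift(3)[OF as'] FRs[OF 3(1)] FR'(2) unfolding equivariant_def by blast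
      also have "map \<sigma> (map lam as) = map lam (map \<sigma> as)"
        using as' \<sigma>lam by (auto simp: tuples_def)
      finally show ?thesis using lift(1)[OF as'] lift(1)[OF tup[OF as']] 3(2) by simp
    qed
  qed
qed

lemma F_operations: "operations_on F N"
  by (rule F_functions(1)[OF automorphism_id])

lemma small_F: "|F| <o \<mu>"
proof -
  have NRs: "|fsyms NR| <o \<mu>" "|rsyms NR| <o \<mu>"
  proof -
    have "|{None} \<union> Some ` rsyms NN| <o \<mu>"
      by (rule small_Un[OF mu(1,2) small_finite[OF mu(2)] small_image[OF mu(4)]]) simp
    then show "|rsyms NR| <o \<mu>" by (simp add: NR_def expand_def)
    show "|fsyms NR| <o \<mu>" using mu(3) by (simp add: NR_def expand_def)
  qed
  have "|FN| <o \<mu>"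
    by (rule small_subset[OF small_definable_functions[OF mu(1,2) NRs definable_NN] FN_def])
  moreover have "|FR| <o \<mu>"
    by (rule small_subset[OF small_definable_functions[OF mu(1,2) NRs definable_RR] FR_def])
  ultimately have "|FN \<union> ({lam_fun N lam} \<union> lift_fun N lam ` FR)| <o \<mu>"
    by (intro small_Un[OF mu(1,2)] small_finite[OF mu(2), of "{lam_fun N lam}"] small_image) simp_all
  then show ?thesis by (simp add: F_def all_funs_def R_funs_def)
qed

lemma small_generated_F: "|X| <o \<kappa> \<Longrightarrow> |generated F X| <o \<kappa>"
  by (rule small_generated[OF kappa' small_mu[OF small_F]])

text \<open>The hypotheses of distality on a sequence, with indiscernibility expressed by automorphisms.
  The cut is automatically Dedekind, since the index sets have no endpoints.\<close>

definition Star :: "'k rel \<Rightarrow> 'k set \<Rightarrow> 'k \<Rightarrow> 'k set \<Rightarrow> ('k \<Rightarrow> 'a list) \<Rightarrow> 'a \<Rightarrow> nat \<Rightarrow> bool" where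
  "Star r I c J a b p \<longleftrightarrow> index_cut \<kappa> \<mu> r I c J \<and> (\<forall>k \<in> I \<union> {c} \<union> J. a k \<in> tuples p N) \<and> b \<in> N \<and>
     aut_indiscernible NR r (I \<union> {c} \<union> J) a {} \<and> aut_indiscernible NR r (I \<union> J) a {b}"

lemma StarD:
  assumes "Star r I c J a b p"
  shows "index_cut \<kappa> \<mu> r I c J" "k \<in> I \<union> {c} \<union> J \<Longrightarrow> a k \<in> tuples p N" "b \<in> N"
     "aut_indiscernible NR r (I \<union> {c} \<union> J) a {}" "aut_indiscernible NR r (I \<union> J) a {b}"
  using assms unfolding Star_def by blast+

lemma indiscernible_NR:
  assumes "\<And>k. k \<in> K \<Longrightarrow> a k \<in> tuples p N" "finite B" "B \<subseteq> N"
  shows "indiscernible NR r K a B \<longleftrightarrow> aut_indiscernible NR r K a B"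
  by (rule indiscernible_iff_automorphisms[OF kappa' NR(1,3)])
    (use assms small_finite[OF kappa'(2)] in simp_all)

lemma Star_iff:
  assumes "index_cut \<kappa> \<mu> r I c J" "\<And>k. k \<in> I \<union> {c} \<union> J \<Longrightarrow> a k \<in> tuples p N" "b \<in> N"
  shows "Star r I c J a b p \<longleftrightarrow> star_condition NR r I c J a b"
proof -
  have "indiscernible NR r (I \<union> {c} \<union> J) a {} \<longleftrightarrow> aut_indiscernible NR r (I \<union> {c} \<union> J) a {}"
    by (rule indiscernible_NR[OF assms(2)]) auto
  moreover have "indiscernible NR r (I \<union> J) a {b} \<longleftrightarrow> aut_indiscernible NR r (I \<union> J) a {b}"
    by (rule indiscernible_NR) (use assms in auto)
  ultimately show ?thesis using assms index_cut_Dedekind[OF assms(1)]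
    unfolding Star_def star_condition_def by blast
qed

text \<open>Entries away from the cut become constants, at the price of shrinking the index sets past
  their indices.\<close>

lemma Star_segment:
  assumes S: "Star r I c J a b p" and ij: "i \<in> I" "j \<in> J"
    and ms: "\<And>m. m \<in> set ms \<Longrightarrow> m \<in> I \<and> (m, i) \<in> r \<or> m \<in> J \<and> (j, m) \<in> r"
  shows "Star (seg_rel r I c J i j) (up_seg r I i) c (down_seg r J j)
           (\<lambda>k. a k @ concat (map a ms)) b (p + length ms * p)"
proof -
  note cut = StarD(1)[OF S]
  note D = index_cut_orderD[OF cut]
  let ?r = "seg_rel r I c J i j" and ?I = "up_seg r I i" and ?J = "down_seg r J j"
  have sub: "?I \<subseteq> I" "?J \<subseteq> J" by (auto simp: up_seg_def down_seg_def)
  let ?X = "{m \<in> set ms. m \<in> I \<and> (m, i) \<in> r}" and ?Y = "{m \<in> set ms. m \<in> J \<and> (j, m) \<in> r}"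
  obtain pre where pre: "set pre = ?X" "sorted_wrt (lt r) pre"
    using finite_sorted_list[OF cut, of ?X] by auto
  obtain post where post: "set post = ?Y" "sorted_wrt (lt r) post"
    using finite_sorted_list[OF cut, of ?Y] by auto
  have le_lt: "lt r x z" if "(x, y) \<in> r" "lt r y z" for x y z
    using that D(1,2) unfolding lt_def trans_def antisym_def by blast
  have lt_le: "lt r x z" if "lt r x y" "(y, z) \<in> r" for x y z
    using that D(1,2) unfolding lt_def trans_def antisym_def by blast
  note tr = lt_trans[OF D(1,2)]
  have less1: "lt r x k" if "x \<in> set pre" "k \<in> ?I \<union> {c} \<union> ?J" for x k
    using that pre(1) D(4,5) tr[of x c k] le_lt[of x i k] sub by (auto simp: up_seg_def)
  have less2: "lt r k y" if "y \<in> set post" "k \<in> ?I \<union> {c} \<union> ?J" for k y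
    using that post(1) D(4,5) tr[of k c y] lt_le[of k j y] sub by (auto simp: down_seg_def)
  have less3: "lt r x y" if "x \<in> set pre" "y \<in> set post" for x y
    using that pre(1) post(1) D(4,5) tr[of x c y] by auto
  have ms': "set ms \<subseteq> set pre \<union> set post" using ms unfolding pre(1) post(1) by blast
  have pps: "set pre \<subseteq> I \<union> J" "set post \<subseteq> I \<union> J" unfolding pre(1) post(1) by auto
  have "aut_indiscernible NR ?r (?I \<union> {c} \<union> ?J) (\<lambda>k. a k @ concat (map a ms)) {}"
    by (rule aut_indiscernible_append[OF StarD(4)[OF S] _ _ _ pre(2) post(2) less1 less2 less3 lt_seg_rel ms'])
      (use pps sub in auto)
  moreover have "aut_indiscernible NR ?r (?I \<union> ?J) (\<lambda>k. a k @ concat (map a ms)) {b}"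
    by (rule aut_indiscernible_append[OF StarD(5)[OF S] pps _ pre(2) post(2) less1 less2 less3 lt_seg_rel ms'])
      (use sub in auto)
  moreover have "a k @ concat (map a ms) \<in> tuples (p + length ms * p) N" if "k \<in> ?I \<union> {c} \<union> ?J" for k
  proof -
    have "a k \<in> tuples p N" using that sub by (intro StarD(2)[OF S]) auto
    moreover have msK: "set ms \<subseteq> I \<union> {c} \<union> J" using ms by auto
    have "length (concat (map a ms)) = length ms * p"
      by (rule length_concat_tuples[OF _ msK]) (rule StarD(2)[OF S])
    moreover have "set (concat (map a ms)) \<subseteq> N"
      by (rule set_concat_tuples[OF _ msK]) (rule StarD(2)[OF S])
    ultimately show ?thesis by (simp add: tuples_def)
  qed
  ultimately show ?thesis
    using index_cut_segment[OF mu(1,2) cut ij] StarD(3)[OF S] unfolding Star_def by blast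
qed

lemma univ_definable_iff:
  assumes "definable_structure S NR" "automorphism NR \<sigma>" "x \<in> N"
  shows "\<sigma> x \<in> univ S \<longleftrightarrow> x \<in> univ S"
  using automorphism_definable[OF NR(1) assms(2), of 1 "{[x] | x. x \<in> univ S}" "[x]"] assms
  by (auto simp: definable_structure_def tuples_def)

text \<open>Distality of a definable structure is applied to the values of terms, which form an
  indiscernible sequence of that structure because they are moved along by automorphisms.\<close>

lemma distal_terms:
  fixes S :: "('x, 'y, 'a) struct"
  assumes S: "definable_structure S NR" "distal \<kappa> \<mu> S" and star: "Star r I c J a b p" and b: "b \<in> univ S"
    and qs: "set qs \<subseteq> fun_terms F p" "\<And>q. q \<in> set qs \<Longrightarrow> app_term q (a c) \<in> univ S"
    and d: "d \<in> I \<union> J"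
  shows "\<exists>\<rho>. automorphism S \<rho> \<and> \<rho> b = b \<and>
     map \<rho> (map (\<lambda>q. app_term q (a d)) qs) = map (\<lambda>q. app_term q (a c)) qs"
proof -
  let ?K = "I \<union> {c} \<union> J"
  define e where "e k = map (\<lambda>q. app_term q (a k)) qs" for k
  have mS: "monster \<kappa> S" by (rule monster_definable_structure[OF S(1) monster])
  then have Sok: "structure_ok S" "strongly_homogeneous \<kappa> S" by (simp_all add: monster_def)
  have move: "map \<sigma> (e k) = e l"
    if \<sigma>: "automorphism NR \<sigma>" and k: "k \<in> ?K" and "map \<sigma> (a k) = a l" for \<sigma> k l
  proof -
    have ak: "length (a k) = p" "set (a k) \<subseteq> N" using StarD(2)[OF star k] by (auto simp: tuples_def)
    have "\<sigma> (app_term q (a k)) = app_term q (a l)" if "q \<in> set qs" for q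
      using app_term_equivariant[OF F_functions[OF \<sigma>], of q "a k"] qs(1) that ak \<open>map \<sigma> (a k) = a l\<close> by auto
    then show ?thesis by (simp add: e_def)
  qed
  have eN: "set (e k) \<subseteq> N" if k: "k \<in> ?K" for k
  proof -
    have "length (a k) = p" "set (a k) \<subseteq> N" using StarD(2)[OF star k] by (auto simp: tuples_def)
    then show ?thesis using app_term_in[OF F_operations, of _ "a k"] qs(1) by (auto simp: e_def)
  qed
  have eS: "e k \<in> tuples (length qs) (univ S)" if k: "k \<in> ?K" for k
  proof -
    obtain \<sigma> where \<sigma>: "automorphism NR \<sigma>" "map \<sigma> (a k) = a c"
      using aut_indiscernibleD[OF StarD(4)[OF star] k, of c] by auto
    have "map \<sigma> (e k) = e c" by (rule move[OF \<sigma>(1) k \<sigma>(2)])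
    moreover have "set (e c) \<subseteq> univ S" using qs(2) by (auto simp: e_def)
    ultimately have "\<sigma> x \<in> univ S" if "x \<in> set (e k)" for x
      using that by (metis image_eqI list.set_map subsetD)
    then have "set (e k) \<subseteq> univ S" using univ_definable_iff[OF S(1) \<sigma>(1)] eN[OF k] by blast
    then show ?thesis by (simp add: tuples_def e_def)
  qed
  have ind: "aut_indiscernible S r K e B" if "aut_indiscernible NR r K a B" "K \<subseteq> ?K" for K B
  proof (rule aut_indiscernible_transport[OF that(1) order.refl refl])
    fix \<sigma> ks ls assume \<sigma>: "automorphism NR \<sigma>" "\<forall>x \<in> B. \<sigma> x = x"
      and ks: "set ks \<subseteq> K" "length ks = length ls" "map (map \<sigma> \<circ> a) ks = map a ls"
    have "map (map \<sigma> \<circ> e) ks = map e ls"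
    proof (rule nth_equalityI)
      fix i assume "i < length (map (map \<sigma> \<circ> e) ks)"
      then have i: "i < length ks" by simp
      have "map (map \<sigma> \<circ> a) ks ! i = map a ls ! i" using ks(3) by simp
      then have "map \<sigma> (a (ks ! i)) = a (ls ! i)" using i ks(2) by simp
      moreover have "ks ! i \<in> ?K" using i ks(1) that(2) nth_mem by blast
      ultimately have "map \<sigma> (e (ks ! i)) = e (ls ! i)" using move[OF \<sigma>(1)] by blast
      then show "map (map \<sigma> \<circ> e) ks ! i = map e ls ! i" using i ks(2) by simp
    qed (simp add: ks(2))
    then show "\<exists>\<tau>. automorphism S \<tau> \<and> (\<forall>x \<in> B. \<tau> x = x) \<and> map (map \<tau> \<circ> e) ks = map e ls"
      using automorphism_definable_structure[OF NR(1) \<sigma>(1) S(1)] \<sigma>(2) by blast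
  qed
  have iff: "indiscernible S r K e B \<longleftrightarrow> aut_indiscernible S r K e B"
    if "K \<subseteq> ?K" "finite B" "B \<subseteq> univ S" for K B
    by (rule indiscernible_iff_automorphisms[OF kappa' Sok])
      (use that eS small_finite[OF kappa'(2)] in auto)
  have "aut_indiscernible S r ?K e {}" by (rule ind[OF StarD(4)[OF star]]) simp
  moreover have "aut_indiscernible S r (I \<union> J) e {b}" by (rule ind[OF StarD(5)[OF star]]) auto
  ultimately have sc: "star_condition S r I c J e b"
    unfolding star_condition_def using index_cut_Dedekind[OF StarD(1)[OF star]] iff[of ?K "{}"] iff[of "I \<union> J" "{b}"] b
    by auto
  have "indiscernible S r ?K e {b}"
  proof (rule S(2)[unfolded distal_def, THEN conjunct2, rule_format])
    show "lang.truncate S = lang.truncate S \<and> models S (Th S) \<and> monster \<kappa> S"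
      using Sok(1) mS by (simp add: models_def)
    show "index_cut \<kappa> \<mu> r I c J \<and> (\<forall>k \<in> ?K. e k \<in> tuples (length qs) (univ S)) \<and>
        star_condition S r I c J e b"
      using StarD(1)[OF star] eS sc by blast
  qed (rule b)
  then have "aut_indiscernible S r ?K e {b}" using iff[of ?K "{b}"] b by simp
  from aut_indiscernibleD[OF this, of d c] d show ?thesis unfolding e_def by auto
qed

text \<open>A formula satisfied by \<open>b\<close> and term values at \<open>c\<close> is moved to the values at \<open>d\<close> by an
  automorphism of \<open>S\<close> that fixes \<open>b\<close>, which distality provides, and then back to the values at
  \<open>c\<close> by \<open>\<sigma>\<close>, which replaces \<open>b\<close> by \<open>\<sigma> b\<close>. Only finitely many elements of \<open>W\<close> occur in the
  formula, so it is enough that these can be appended to the sequence.\<close>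

lemma distal_same_type:
  fixes S :: "('x, 'y, 'a) struct"
  assumes S: "definable_structure S NR" "distal \<kappa> \<mu> S" and b: "b \<in> univ S"
    and \<sigma>: "automorphism NR \<sigma>" "map \<sigma> (a d) = a c" "\<forall>x \<in> W. \<sigma> x = x" and ac: "set (a c) \<subseteq> N"
    and fin: "\<And>X. finite X \<Longrightarrow> X \<subseteq> W \<Longrightarrow> \<exists>ws r I J p. set ws \<subseteq> W \<and> X \<subseteq> set ws \<and>
       Star r I c J (\<lambda>k. a k @ ws) b p \<and> d \<in> I \<union> J"
  shows "tp S [b] (generated F (set (a c) \<union> W) \<inter> univ S) = tp S [\<sigma> b] (generated F (set (a c) \<union> W) \<inter> univ S)"
proof (subst tp_eq_iff, simp, intro allI impI ballI)
  fix cs \<phi> assume cs: "set cs \<subseteq> generated F (set (a c) \<union> W) \<inter> univ S" and \<phi>: "\<phi> \<in> formulas S (length [b] + length cs)"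
  have Sok: "structure_ok S" using S(1) by (simp add: definable_structure_def)
  obtain Y where Y: "finite Y" "Y \<subseteq> set (a c) \<union> W" "set cs \<subseteq> generated F Y"
    using generated_finite[of "set cs" F "set (a c) \<union> W"] cs by auto
  obtain ws r I J p where ws: "set ws \<subseteq> W" "Y \<inter> W \<subseteq> set ws" and star: "Star r I c J (\<lambda>k. a k @ ws) b p"
    and d: "d \<in> I \<union> J" using fin[of "Y \<inter> W"] Y(1) by blast
  have "Y \<subseteq> set (a c @ ws)" using Y(2) ws(2) by auto
  then have "set cs \<subseteq> generated F (set (a c @ ws))" using Y(3) generated_mono[OF order.refl] by blast
  then obtain qs where qs: "set qs \<subseteq> fun_terms F (length (a c @ ws))" "cs = map (\<lambda>q. app_term q (a c @ ws)) qs"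
    using generated_set_list by blast
  have p: "length (a c @ ws) = p" "length (a d @ ws) = p" "set (a d @ ws) \<subseteq> N"
    using StarD(2)[OF star, of c] StarD(2)[OF star, of d] d by (auto simp: tuples_def)
  let ?e = "map (\<lambda>q. app_term q (a d @ ws)) qs"
  have "\<exists>\<rho>. automorphism S \<rho> \<and> \<rho> b = b \<and>
     map \<rho> (map (\<lambda>q. app_term q (a d @ ws)) qs) = map (\<lambda>q. app_term q (a c @ ws)) qs"
    by (rule distal_terms[OF S star b _ _ d]) (use qs p(1) cs in auto)
  then obtain \<rho> where \<rho>: "automorphism S \<rho>" "\<rho> b = b" "map \<rho> ?e = cs" unfolding qs(2) by blast
  have \<sigma>ws: "map \<sigma> (a d @ ws) = a c @ ws" using \<sigma>(2,3) ws(1) by (auto intro!: map_idI)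
  have "\<sigma> (app_term q (a d @ ws)) = app_term q (a c @ ws)" if "q \<in> set qs" for q
    using app_term_equivariant[OF F_functions[OF \<sigma>(1)], of q "a d @ ws"] \<sigma>ws qs(1) that p by auto
  then have \<sigma>e: "map \<sigma> ?e = cs" by (simp add: qs(2))
  have "set ?e \<subseteq> N" using app_term_in[OF F_operations, of _ "a d @ ws"] qs(1) p by auto
  moreover have "\<sigma> x \<in> univ S" if "x \<in> set ?e" for x
    using \<sigma>e cs that by (metis image_eqI list.set_map subsetD inf.boundedE)
  ultimately have eS: "set (b # ?e) \<subseteq> univ S" using univ_definable_iff[OF S(1) \<sigma>(1)] b by auto
  have \<phi>': "\<phi> \<in> formulas S (length (b # ?e))" using \<phi> by (simp add: qs(2))
  have "satisfies S (nth (b # cs)) \<phi> \<longleftrightarrow> satisfies S (nth (b # ?e)) \<phi>"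
    using automorphism_satisfies_list[OF Sok \<rho>(1) eS \<phi>'] unfolding list.map \<rho>(2) \<rho>(3) .
  moreover have "satisfies S (nth (\<sigma> b # cs)) \<phi> \<longleftrightarrow> satisfies S (nth (b # ?e)) \<phi>"
    using automorphism_satisfies_list[OF Sok automorphism_definable_structure[OF NR(1) \<sigma>(1) S(1)] eS \<phi>']
    unfolding list.map \<sigma>e .
  ultimately show "satisfies S (nth ([b] @ cs)) \<phi> \<longleftrightarrow> satisfies S (nth ([\<sigma> b] @ cs)) \<phi>" by simp
qed

text \<open>After \<open>\<sigma>\<close>, an automorphism over \<open>M\<close> moves \<open>\<sigma> b\<close> back to \<open>b\<close>.\<close>

lemma conjugate_if_same_type:
  assumes tp: "tp NR [b] M = tp NR [\<sigma> b] M" and M: "M \<subseteq> N" "|M| <o \<kappa>" and b: "b \<in> N"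
    and \<sigma>: "automorphism NR \<sigma>" "map \<sigma> as = bs" and bs: "set bs \<subseteq> M"
  shows "\<exists>\<tau>. automorphism NR \<tau> \<and> \<tau> b = b \<and> map \<tau> as = bs"
proof -
  have \<sigma>b: "\<sigma> b \<in> N" using automorphism_univ[OF \<sigma>(1)] b by simp
  have small: "|M \<union> set [\<sigma> b]| <o \<kappa>" by (rule small_Un[OF kappa' M(2) small_finite[OF kappa'(2)]]) simp
  have "\<exists>\<rho>. automorphism NR \<rho> \<and> (\<forall>x \<in> M. \<rho> x = x) \<and> map \<rho> [\<sigma> b] = [b]"
    by (rule tp_eq_automorphism[OF NR(3) small _ tp[symmetric]]) (use b \<sigma>b M in auto)
  then obtain \<rho> where \<rho>: "automorphism NR \<rho>" "\<forall>x \<in> M. \<rho> x = x" "\<rho> (\<sigma> b) = b" by auto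
  have "map (\<rho> \<circ> \<sigma>) as = map \<rho> bs" using \<sigma>(2) by auto
  also have "\<dots> = bs" using \<rho>(2) bs by (intro map_idI) auto
  finally show ?thesis using automorphism_comp[OF \<sigma>(1) \<rho>(1)] \<rho>(3) by (intro exI[of _ "\<rho> \<circ> \<sigma>"]) simp
qed

section \<open>Reduction to one point at the cut\<close>

text \<open>It suffices to compare the point at the cut with one point nearby, provided that this is
  done for all sequences: the remaining entries of a tuple can be appended to the sequence as
  constants.\<close>

lemma indiscernible_if_one_point:
  assumes local: "\<And>r I c J a p. Star r I c J a b p \<Longrightarrow>
      \<exists>d \<in> I \<union> J. \<exists>\<tau>. automorphism NR \<tau> \<and> \<tau> b = b \<and> map \<tau> (a d) = a c"
    and S: "Star r I c J a b p"
  shows "aut_indiscernible NR r (I \<union> {c} \<union> J) a {b}"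
proof -
  let ?K = "I \<union> {c} \<union> J"
  note cut = StarD(1)[OF S] and a = StarD(2)[OF S] and b = StarD(3)[OF S]
  note D = index_cut_orderD[OF cut]
  have shift: "\<exists>ks'. set ks' \<subseteq> I \<union> J \<and> length ks' = length ks \<and> sorted_wrt (lt r) ks' \<and>
      tp NR (concat (map a ks')) {b} = tp NR (concat (map a ks)) {b}"
    if ks: "set ks \<subseteq> ?K" "sorted_wrt (lt r) ks" for ks
  proof (cases "c \<in> set ks")
    case False
    then show ?thesis using ks by (intro exI[of _ ks]) auto
  next
    case True
    then obtain pre post where pp: "ks = pre @ [c] @ post" using split_list by fastforce
    have lts: "\<forall>x \<in> set pre. lt r x c" "\<forall>y \<in> set post. lt r c y"
      "\<forall>x \<in> set pre. \<forall>y \<in> set post. lt r x y" "sorted_wrt (lt r) pre" "sorted_wrt (lt r) post"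
      using ks(2) unfolding pp by (auto simp: sorted_wrt_append)
    have pre: "set pre \<subseteq> I"
    proof
      fix x assume x: "x \<in> set pre"
      then have "lt r x c" using lts by blast
      then have "x \<noteq> c" "x \<notin> J" using D(5) lt_asym[OF D(2)] by (auto simp: lt_def)
      then show "x \<in> I" using x ks(1) unfolding pp by auto
    qed
    have post: "set post \<subseteq> J"
    proof
      fix x assume x: "x \<in> set post"
      then have "lt r c x" using lts by blast
      then have "x \<noteq> c" "x \<notin> I" using D(4) lt_asym[OF D(2)] by (auto simp: lt_def)
      then show "x \<in> J" using x ks(1) unfolding pp by auto
    qed
    obtain i j where ij: "i \<in> I" "j \<in> J" "\<And>k. k \<in> set (pre @ post) \<inter> I \<Longrightarrow> lt r k i"
      "\<And>k. k \<in> set (pre @ post) \<inter> J \<Longrightarrow> lt r j k"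
      using saturated_segments_bound[OF cut small_finite[OF mu(2)], of "set (pre @ post)"] by auto
    have "m \<in> I \<and> (m, i) \<in> r \<or> m \<in> J \<and> (j, m) \<in> r" if "m \<in> set (pre @ post)" for m
      using that pre post ij(3,4)[of m] by (auto simp: lt_def)
    from local[OF Star_segment[OF S ij(1,2) this]]
    obtain d \<tau> where d: "d \<in> up_seg r I i \<union> down_seg r J j" and \<tau>: "automorphism NR \<tau>" "\<tau> b = b"
      "map \<tau> (a d @ concat (map a (pre @ post))) = a c @ concat (map a (pre @ post))" by blast
    have dIJ: "d \<in> I \<union> J" using d by (auto simp: up_seg_def down_seg_def)
    have "length (a d) = length (a c)" using a[of d] a[of c] dIJ by (auto simp: tuples_def)
    then have \<tau>1: "map \<tau> (a d) = a c" "map \<tau> (concat (map a pre)) = concat (map a pre)"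
      "map \<tau> (concat (map a post)) = concat (map a post)"
      using \<tau>(3) by auto
    have "map \<tau> (concat (map a (pre @ [d] @ post))) = concat (map a ks)"
      unfolding pp using \<tau>1 by simp
    moreover have "set (concat (map a (pre @ [d] @ post))) \<subseteq> univ NR"
      unfolding univ_NR by (rule set_concat_tuples[where K = ?K]) (use a pre post dIJ in auto)
    then have "tp NR (map \<tau> (concat (map a (pre @ [d] @ post)))) {b} = tp NR (concat (map a (pre @ [d] @ post))) {b}"
      by (rule automorphism_tp[OF NR(1) \<tau>(1)]) (use b \<tau>(2) in auto)
    moreover have "lt r x d" if "x \<in> set pre" for x
    proof (cases "d \<in> up_seg r I i")
      case True
      then show ?thesis using ij(3)[of x] that pre lt_trans[OF D(1,2), of x i d] by (auto simp: up_seg_def)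
    next
      case False
      then have "d \<in> J" using d by (auto simp: down_seg_def)
      then show ?thesis using lts(1) that D(5) lt_trans[OF D(1,2), of x c d] by auto
    qed
    moreover have "lt r d y" if "y \<in> set post" for y
    proof (cases "d \<in> up_seg r I i")
      case True
      then have "d \<in> I" by (auto simp: up_seg_def)
      then show ?thesis using lts(2) that D(4) lt_trans[OF D(1,2), of d c y] by auto
    next
      case False
      then have "lt r d j" using d by (auto simp: down_seg_def)
      then show ?thesis using ij(4)[of y] that post lt_trans[OF D(1,2), of d j y] by auto
    qed
    ultimately show ?thesis using pre post dIJ lts
      by (intro exI[of _ "pre @ [d] @ post"]) (auto simp: pp sorted_wrt_append)
  qed
  have iff: "indiscernible NR r L a {b} \<longleftrightarrow> aut_indiscernible NR r L a {b}" if "L \<subseteq> ?K" for L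
    by (rule indiscernible_NR[of L a p]) (use a b that in auto)
  have IJ: "indiscernible NR r (I \<union> J) a {b}"
    using StarD(5)[OF S] iff[of "I \<union> J"] by auto
  have "indiscernible NR r ?K a {b}"
    unfolding indiscernible_def
  proof (intro allI impI, elim conjE)
    fix ks ls assume ks: "set ks \<subseteq> ?K" "set ls \<subseteq> ?K" "length ks = length ls"
      "sorted_wrt (lt r) ks" "sorted_wrt (lt r) ls"
    obtain ks' where ks': "set ks' \<subseteq> I \<union> J" "length ks' = length ks" "sorted_wrt (lt r) ks'"
      "tp NR (concat (map a ks')) {b} = tp NR (concat (map a ks)) {b}" using shift[OF ks(1,4)] by blast
    obtain ls' where ls': "set ls' \<subseteq> I \<union> J" "length ls' = length ls" "sorted_wrt (lt r) ls'"
      "tp NR (concat (map a ls')) {b} = tp NR (concat (map a ls)) {b}" using shift[OF ks(2,5)] by blast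
    have "tp NR (concat (map a ks')) {b} = tp NR (concat (map a ls')) {b}"
      by (rule IJ[unfolded indiscernible_def, rule_format]) (use ks' ls' ks(3) in simp)
    then show "tp NR (concat (map a ks)) {b} = tp NR (concat (map a ls)) {b}"
      by (simp only: ks'(4) ls'(4))
  qed
  then show ?thesis using iff[of ?K] by simp
qed

section \<open>Singletons in \<open>R\<close>\<close>

text \<open>Hypothesis \<open>two\<close> is used for the closure of \<open>a c\<close>; distality of \<open>RR\<close> supplies the equality of
  types in \<open>RR\<close>.\<close>

lemma indiscernible_over_R:
  assumes b: "b \<in> R" and S: "Star r I c J a b p"
  shows "aut_indiscernible NR r (I \<union> {c} \<union> J) a {b}"
proof (rule indiscernible_if_one_point[OF _ S])
  fix r I c J a p assume S: "Star r I c J a b p"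
  let ?M = "generated F (set (a c))"
  have ac: "set (a c) \<subseteq> N" using StarD(2)[OF S, of c] by (simp add: tuples_def)
  have bN: "b \<in> N" by (rule StarD(3)[OF S])
  obtain d where d: "d \<in> I" using index_cut_orderD(6)[OF StarD(1)[OF S]] unfolding dense_no_endpoints_def by blast
  obtain \<sigma> where \<sigma>: "automorphism NR \<sigma>" "map \<sigma> (a d) = a c"
    using aut_indiscernibleD[OF StarD(4)[OF S], of d c] d by blast
  have M: "?M \<subseteq> N" "|?M| <o \<kappa>"
    using generated_subset[OF F_operations ac] small_generated_F[OF small_finite[OF kappa'(2)], of "set (a c)"] by auto
  have "tp RR [b] (generated F (set (a c) \<union> {}) \<inter> univ RR) = tp RR [\<sigma> b] (generated F (set (a c) \<union> {}) \<inter> univ RR)"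
  proof (rule distal_same_type[where a = a and d = d, OF definable_RR distal_RR _ \<sigma> _ ac])
    fix X assume "X \<subseteq> ({} :: 'a set)"
    then show "\<exists>ws r I J p. set ws \<subseteq> {} \<and> X \<subseteq> set ws \<and> Star r I c J (\<lambda>k. a k @ ws) b p \<and> d \<in> I \<union> J"
      using S d by (intro exI[of _ "[]"] exI[of _ r] exI[of _ I] exI[of _ J] exI[of _ p]) simp
  qed (use b univ_RR in auto)
  moreover have "\<sigma> b \<in> R"
    using automorphism_univ[OF automorphism_RR[OF \<sigma>(1)]] b univ_RR by simp
  ultimately have "tp NR [b] ?M = tp NR [\<sigma> b] ?M"
    by (intro two M b generated_idem) (simp_all add: univ_RR)
  from conjugate_if_same_type[OF this M bN \<sigma> generated_superset] d
  show "\<exists>d \<in> I \<union> J. \<exists>\<tau>. automorphism NR \<tau> \<and> \<tau> b = b \<and> map \<tau> (a d) = a c" by blast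
qed

section \<open>Arbitrary singletons\<close>

text \<open>Elements of \<open>R\<close> that are generated from \<open>b\<close> and the constants can be appended: over
  them the sequence is indiscernible by the case just proved.\<close>

lemma Star_adjoin_one:
  assumes S: "Star r I c J (\<lambda>k. a k @ ws) b p" and y: "y \<in> R" "y \<in> generated F (insert b (set ws))"
    and len: "\<And>k. k \<in> I \<union> {c} \<union> J \<Longrightarrow> length (a k) = length (a c)"
  shows "Star r I c J (\<lambda>k. a k @ ws @ [y]) b (Suc p)"
proof -
  let ?K = "I \<union> {c} \<union> J"
  have ws: "set ws \<subseteq> N" using StarD(2)[OF S, of c] by (auto simp: tuples_def)
  have yN: "y \<in> N" using y(1) R_sub by blast
  have fix_ws: "map \<sigma> ws = ws"
    if eq: "map (map \<sigma> \<circ> (\<lambda>k. a k @ ws)) ks = map (\<lambda>k. a k @ ws) ls"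
      and sub: "set ks \<subseteq> ?K" "set ls \<subseteq> ?K" and "ks \<noteq> []"
    for \<sigma> ks ls
  proof -
    obtain k ks' where k: "ks = k # ks'" using \<open>ks \<noteq> []\<close> by (cases ks) auto
    then obtain l ls' where l: "ls = l # ls'" using eq k by (cases ls) auto
    have "map \<sigma> (a k @ ws) = a l @ ws" using eq by (simp add: k l)
    moreover have "length (a k) = length (a l)" using sub len[of k] len[of l] by (simp add: k l)
    ultimately show ?thesis by simp
  qed
  have fix_y: "\<sigma> y = y" if "automorphism NR \<sigma>" "\<sigma> b = b" "map \<sigma> ws = ws" for \<sigma>
  proof (rule generated_fixed[OF F_functions[OF that(1)] _ _ y(2)])
    show "insert b (set ws) \<subseteq> N" using ws StarD(3)[OF S] by simp
    show "\<forall>x\<in>insert b (set ws). \<sigma> x = x" using that(2,3) by (simp add: map_eq_conv[of _ _ id, simplified])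
  qed
  have app: "map (map \<sigma> \<circ> (\<lambda>k. a k @ ws @ [y])) ks = map (\<lambda>k. a k @ ws @ [y]) ls"
    if "map (map \<sigma> \<circ> (\<lambda>k. a k @ ws)) ks = map (\<lambda>k. a k @ ws) ls" "length ks = length ls" "\<sigma> y = y" for \<sigma> ks ls
  proof (rule nth_equalityI)
    fix i assume "i < length (map (map \<sigma> \<circ> (\<lambda>k. a k @ ws @ [y])) ks)"
    then have i: "i < length ks" by simp
    have "map (map \<sigma> \<circ> (\<lambda>k. a k @ ws)) ks ! i = map (\<lambda>k. a k @ ws) ls ! i" using that(1) by simp
    then have "map \<sigma> (a (ks ! i) @ ws) = a (ls ! i) @ ws" using i that(2) by simp
    then have "map \<sigma> ((a (ks ! i) @ ws) @ [y]) = (a (ls ! i) @ ws) @ [y]"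
      using that(3) by (simp del: append_assoc add: map_append[of _ _ "[y]"])
    then show "map (map \<sigma> \<circ> (\<lambda>k. a k @ ws @ [y])) ks ! i = map (\<lambda>k. a k @ ws @ [y]) ls ! i"
      using i that(2) by simp
  qed (simp add: that(2))
  have "aut_indiscernible NR r (I \<union> J) (\<lambda>k. a k @ ws) {y}"
  proof (rule aut_indiscernible_transport[OF StarD(5)[OF S] order.refl refl])
    fix \<sigma> ks ls assume \<sigma>: "automorphism NR \<sigma>" "\<forall>x \<in> {b}. \<sigma> x = x" and ks: "set ks \<subseteq> I \<union> J" "set ls \<subseteq> I \<union> J"
      "length ks = length ls" "map (map \<sigma> \<circ> (\<lambda>k. a k @ ws)) ks = map (\<lambda>k. a k @ ws) ls"
    show "\<exists>\<tau>. automorphism NR \<tau> \<and> (\<forall>x\<in>{y}. \<tau> x = x) \<and> map (map \<tau> \<circ> (\<lambda>k. a k @ ws)) ks = map (\<lambda>k. a k @ ws) ls"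
    proof (cases "ks = []")
      case True
      then show ?thesis using automorphism_id ks(3) by (intro exI[of _ id]) auto
    next
      case False
      have "map \<sigma> ws = ws" by (rule fix_ws[OF ks(4) _ _ False]) (use ks in auto)
      then have "\<sigma> y = y" using fix_y \<sigma> by blast
      then show ?thesis using \<sigma>(1) ks(4) by blast
    qed
  qed
  then have "Star r I c J (\<lambda>k. a k @ ws) y p" using S yN unfolding Star_def by blast
  then have "aut_indiscernible NR r ?K (\<lambda>k. a k @ ws) {y}" by (rule indiscernible_over_R[OF y(1)])
  then have "aut_indiscernible NR r ?K (\<lambda>k. a k @ ws @ [y]) {}"
    by (rule aut_indiscernible_transport[OF _ order.refl refl]) (use app in blast)
  moreover have "aut_indiscernible NR r (I \<union> J) (\<lambda>k. a k @ ws @ [y]) {b}"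
  proof (rule aut_indiscernible_transport[OF StarD(5)[OF S] order.refl refl])
    fix \<sigma> ks ls assume \<sigma>: "automorphism NR \<sigma>" "\<forall>x \<in> {b}. \<sigma> x = x" and ks: "set ks \<subseteq> I \<union> J" "set ls \<subseteq> I \<union> J"
      "length ks = length ls" "map (map \<sigma> \<circ> (\<lambda>k. a k @ ws)) ks = map (\<lambda>k. a k @ ws) ls"
    show "\<exists>\<tau>. automorphism NR \<tau> \<and> (\<forall>x\<in>{b}. \<tau> x = x) \<and>
        map (map \<tau> \<circ> (\<lambda>k. a k @ ws @ [y])) ks = map (\<lambda>k. a k @ ws @ [y]) ls"
    proof (cases "ks = []")
      case True
      then show ?thesis using \<sigma> ks(3) by (intro exI[of _ \<sigma>]) auto
    next
      case False
      have "map \<sigma> ws = ws" by (rule fix_ws[OF ks(4) _ _ False]) (use ks in auto)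
      then have "\<sigma> y = y" using fix_y \<sigma> by blast
      then show ?thesis using \<sigma> app[OF ks(4,3)] by blast
    qed
  qed
  moreover have "a k @ ws @ [y] \<in> tuples (Suc p) N" if "k \<in> ?K" for k
    using StarD(2)[OF S that] yN by (simp add: tuples_def)
  ultimately show ?thesis using StarD(1,3)[OF S] unfolding Star_def by blast
qed

lemma Star_adjoin:
  assumes S: "Star r I c J (\<lambda>k. a k @ ws) b p" and ds: "set ds \<subseteq> R \<inter> generated F (insert b (set ws))"
    and len: "\<And>k. k \<in> I \<union> {c} \<union> J \<Longrightarrow> length (a k) = length (a c)"
  shows "Star r I c J (\<lambda>k. a k @ ws @ ds) b (p + length ds)"
  using ds
proof (induction ds rule: rev_induct)
  case Nil
  then show ?case using S by simp
next
  case (snoc y ds)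
  then have IH: "Star r I c J (\<lambda>k. a k @ ws @ ds) b (p + length ds)" by simp
  have "generated F (insert b (set ws)) \<subseteq> generated F (insert b (set (ws @ ds)))"
    by (rule generated_mono) auto
  then have "y \<in> R" "y \<in> generated F (insert b (set (ws @ ds)))" using snoc.prems by auto
  from Star_adjoin_one[OF IH this len] show ?case by simp
qed

text \<open>The entries at \<open>ks\<close> are appended to the sequence, and variable separation is applied to the
  term that takes \<open>lam\<close> of \<open>t\<close>. Its outermost function is \<open>lam\<close>, so the terms in \<open>b\<close> have values
  in \<open>R\<close>. The parameters are entries at finitely many indices, listed in \<open>qs\<close>.\<close>

lemma variable_separation_at_cut:
  assumes S: "Star r I c J a b p" and ks: "set ks \<subseteq> I \<union> J"
    and t: "t \<in> fun_terms F (p + length ks * p + 1)"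
  shows "\<exists>qs. set qs \<subseteq> I \<union> J \<and> lam (app_term t (a c @ concat (map a ks) @ [b])) \<in>
     generated F (set (a c) \<union> set (concat (map a qs)) \<union>
       R \<inter> generated F (insert b (set (concat (map a qs)))))"
proof -
  let ?p = "p + length ks * p"
  note cut = StarD(1)[OF S]
  obtain i j where ij: "i \<in> I" "j \<in> J" "\<And>k. k \<in> set ks \<inter> I \<Longrightarrow> lt r k i"
      "\<And>k. k \<in> set ks \<inter> J \<Longrightarrow> lt r j k"
    using saturated_segments_bound[OF cut small_finite[OF mu(2)], of "set ks"] by auto
  let ?r = "seg_rel r I c J i j" and ?I = "up_seg r I i" and ?J = "down_seg r J j"
  define e where "e k = a k @ concat (map a ks)" for k
  have "m \<in> I \<and> (m, i) \<in> r \<or> m \<in> J \<and> (j, m) \<in> r" if "m \<in> set ks" for m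
    using that ks ij(3,4)[of m] by (auto simp: lt_def)
  from Star_segment[OF S ij(1,2) this] have Se: "Star ?r ?I c ?J e b ?p"
    unfolding e_def by simp
  have ec: "e c \<in> tuples ?p N" using StarD(2)[OF Se] by simp
  have bN: "b \<in> N" by (rule StarD(3)[OF S])
  let ?t = "Fn (lam_fun N lam) [t]"
  have lamF: "lam_fun N lam \<in> F" "fst (lam_fun N lam) = 1"
    by (simp_all add: F_def all_funs_def R_funs_def lam_fun_def)
  have t': "?t \<in> fun_terms (all_funs (univ NR) lam FN FR) (?p + 1)"
    using t lamF by (auto simp: fun_terms_def F_def)
  have sc: "star_condition NR ?r ?I c ?J e b"
    by (rule iffD1[OF Star_iff[OF StarD(1)[OF Se] StarD(2)[OF Se] bN] Se])
  have "\<exists>I' J' P ps rs ss. \<exists>u \<in> fun_terms FN (length rs + length ss).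
           truncation ?r I' J' ?I ?J \<and>
           P \<subseteq> e ` ((?I - I') \<union> (?J - J')) \<and> |P| <o \<kappa> \<and> set ps \<subseteq> (\<Union>x \<in> P. set x) \<and>
           set rs \<subseteq> fun_terms (all_funs (univ NR) lam FN FR) (?p + length ps) \<and>
           set ss \<subseteq> fun_terms (all_funs (univ NR) lam FN FR) (1 + length ps) \<and>
           (\<forall>k \<in> I' \<union> {c} \<union> J'.
              app_term ?t (e k @ [b]) =
              app_term u (map (\<lambda>q. app_term q (e k @ ps)) rs @
                          map (\<lambda>q. app_term q (b # ps)) ss)) \<and>
           ((\<exists>h ts. h \<in> R_funs (univ NR) lam FR \<and> ?t = Fn h ts) \<longrightarrow>
              (\<forall>q \<in> set ss. app_term q (b # ps) \<in> R))"
  proof (rule four[unfolded variable_separation_def, rule_format])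
    show "index_cut \<kappa> \<mu> ?r ?I c ?J \<and> (\<forall>k\<in>?I \<union> {c} \<union> ?J. e k \<in> tuples ?p (univ NR)) \<and>
        star_condition NR ?r ?I c ?J e b"
      using StarD(1)[OF Se] StarD(2)[OF Se] sc by simp
  qed (use t' bN in simp_all)
  then obtain I' J' P ps rs ss u where u: "u \<in> fun_terms FN (length rs + length ss)"
    and P: "P \<subseteq> e ` ((?I - I') \<union> (?J - J'))" "set ps \<subseteq> (\<Union>x \<in> P. set x)"
    and rs': "set rs \<subseteq> fun_terms (all_funs (univ NR) lam FN FR) (?p + length ps)"
    and ss': "set ss \<subseteq> fun_terms (all_funs (univ NR) lam FN FR) (1 + length ps)"
    and eqs: "\<forall>k \<in> I' \<union> {c} \<union> J'. app_term ?t (e k @ [b]) =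
          app_term u (map (\<lambda>q. app_term q (e k @ ps)) rs @ map (\<lambda>q. app_term q (b # ps)) ss)"
    and imp: "(\<exists>h ts. h \<in> R_funs (univ NR) lam FR \<and> ?t = Fn h ts) \<longrightarrow>
          (\<forall>q \<in> set ss. app_term q (b # ps) \<in> R)"
    by (elim exE bexE conjE) blast
  have rs: "set rs \<subseteq> fun_terms F (?p + length ps)" and ss: "set ss \<subseteq> fun_terms F (1 + length ps)"
    using rs' ss' by (simp_all add: F_def)
  have eq: "app_term ?t (e c @ [b]) =
      app_term u (map (\<lambda>q. app_term q (e c @ ps)) rs @ map (\<lambda>q. app_term q (b # ps)) ss)"
    by (rule bspec[OF eqs]) simp
  have "\<exists>h ts. h \<in> R_funs (univ NR) lam FR \<and> ?t = Fn h ts"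
    by (intro exI[of _ "lam_fun N lam"] exI[of _ "[t]"]) (simp add: R_funs_def)
  then have ssR: "\<forall>q \<in> set ss. app_term q (b # ps) \<in> R" by (rule mp[OF imp])
  have "\<forall>x \<in> set ps. \<exists>k \<in> I \<union> J. x \<in> set (e k)"
    using P by (fastforce simp: up_seg_def down_seg_def)
  then obtain f where f: "\<And>x. x \<in> set ps \<Longrightarrow> f x \<in> I \<union> J \<and> x \<in> set (e (f x))" by metis
  define qs where "qs = ks @ map f ps"
  let ?E = "set (concat (map a qs))"
  have qs: "set qs \<subseteq> I \<union> J" using ks f by (auto simp: qs_def)
  have psE: "set ps \<subseteq> ?E" using f by (fastforce simp: qs_def e_def)
  have ecE: "set (e c) \<subseteq> set (a c) \<union> ?E" by (auto simp: e_def qs_def)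
  let ?X = "set (a c) \<union> ?E \<union> R \<inter> generated F (insert b ?E)"
  have r: "app_term q (e c @ ps) \<in> generated F ?X" if "q \<in> set rs" for q
  proof (rule generated_term)
    show "q \<in> fun_terms F (length (e c @ ps))" using that rs ec by (auto simp: tuples_def)
    have "set (e c @ ps) \<subseteq> ?X" using psE ecE by auto
    then show "set (e c @ ps) \<subseteq> generated F ?X" by (rule order_trans[OF _ generated_superset])
  qed
  have s: "app_term q (b # ps) \<in> generated F ?X" if "q \<in> set ss" for q
  proof -
    have "app_term q (b # ps) \<in> generated F (insert b ?E)"
    proof (rule generated_term)
      show "q \<in> fun_terms F (length (b # ps))" using that ss by auto
      have "set (b # ps) \<subseteq> insert b ?E" using psE by auto
      then show "set (b # ps) \<subseteq> generated F (insert b ?E)" by (rule order_trans[OF _ generated_superset])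
    qed
    then have "app_term q (b # ps) \<in> ?X" using ssR that by blast
    then show ?thesis using generated_superset[of ?X F] by blast
  qed
  have "app_term u (map (\<lambda>q. app_term q (e c @ ps)) rs @ map (\<lambda>q. app_term q (b # ps)) ss) \<in> generated F ?X"
  proof (rule generated_term)
    show "u \<in> fun_terms F (length (map (\<lambda>q. app_term q (e c @ ps)) rs @ map (\<lambda>q. app_term q (b # ps)) ss))"
      using fun_terms_mono[OF _ order.refl u, of F] by (simp add: F_def all_funs_def)
  qed (use r s in auto)
  moreover have "app_term ?t (e c @ [b]) = lam (app_term t (e c @ [b]))"
  proof -
    have "app_term t (e c @ [b]) \<in> N"
      by (rule app_term_in[OF F_operations]) (use t ec bN in \<open>auto simp: tuples_def\<close>)
    then show ?thesis by (simp add: app_term_def lam_fun_def tuples_def)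
  qed
  ultimately have "lam (app_term t (e c @ [b])) \<in> generated F ?X" using eq by simp
  then show ?thesis using qs unfolding e_def by (intro exI[of _ qs]) simp
qed

text \<open>Each use of variable separation introduces finitely many new indices. Their closure \<open>K\<close>
  stays below \<open>\<mu>\<close> since there are fewer than \<open>\<mu>\<close> terms; closing under finitary operations is
  evaluating terms whose symbols are these operations.\<close>

lemma closed_index_set:
  assumes S: "Star r I c J a b p"
  obtains K where "K \<subseteq> I \<union> J" "|K| <o \<mu>"
    "\<And>ks t. set ks \<subseteq> K \<Longrightarrow> t \<in> fun_terms F (p + length ks * p + 1) \<Longrightarrow>
       \<exists>qs. set qs \<subseteq> K \<and> lam (app_term t (a c @ concat (map a ks) @ [b])) \<in>
         generated F (set (a c) \<union> set (concat (map a qs)) \<union>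
           R \<inter> generated F (insert b (set (concat (map a qs)))))"
proof -
  let ?P = "\<lambda>ks t qs. set qs \<subseteq> I \<union> J \<and> lam (app_term t (a c @ concat (map a ks) @ [b])) \<in>
         generated F (set (a c) \<union> set (concat (map a qs)) \<union>
           R \<inter> generated F (insert b (set (concat (map a qs)))))"
  define Q where "Q ks t = (SOME qs. ?P ks t qs)" for ks t
  have Q: "?P ks t (Q ks t)" if "set ks \<subseteq> I \<union> J" "t \<in> fun_terms F (p + length ks * p + 1)" for ks t
    unfolding Q_def by (rule someI_ex) (rule variable_separation_at_cut[OF S that])
  obtain i where i: "i \<in> I" using index_cut_orderD(6)[OF StarD(1)[OF S]] unfolding dense_no_endpoints_def by blast
  define op where "op = (\<lambda>(t, n) ks. if set ks \<subseteq> I \<union> J \<and> t \<in> fun_terms F (p + length ks * p + 1) \<and>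
      n < length (Q ks t) then Q ks t ! n else i)"
  have op: "op tn ks \<in> I \<union> J" for tn ks
  proof -
    obtain t n where tn: "tn = (t, n)" by (cases tn)
    show ?thesis
    proof (cases "set ks \<subseteq> I \<union> J \<and> t \<in> fun_terms F (p + length ks * p + 1) \<and> n < length (Q ks t)")
      case True
      then have "set (Q ks t) \<subseteq> I \<union> J" using Q by blast
      then have "Q ks t ! n \<in> I \<union> J" using True nth_mem by blast
      then show ?thesis using True by (simp add: op_def tn)
    next
      case False
      then show ?thesis using i by (auto simp: op_def tn)
    qed
  qed
  let ?T = "{s. set_tm s \<subseteq> {t. set_tm t \<subseteq> F} \<times> (UNIV :: nat set)}"
  let ?ev = "eval_tm op (\<lambda>_. i)"
  define K where "K = ?ev ` ?T"
  show ?thesis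
  proof (rule that[of K])
    have "?ev s \<in> I \<union> J" for s using op i by (cases s) auto
    then show KIJ: "K \<subseteq> I \<union> J" by (auto simp: K_def)
    have "|{t. set_tm t \<subseteq> F} \<times> (UNIV :: nat set)| <o \<mu>"
      by (intro small_Times[OF mu(1,2)] small_tm[OF mu(1,2) small_F] small_countable[OF mu(2)])
    then show "|K| <o \<mu>" unfolding K_def by (intro small_image small_tm[OF mu(1,2)])
    fix ks t assume ks: "set ks \<subseteq> K" and t: "t \<in> fun_terms F (p + length ks * p + 1)"
    have "ks \<in> map ?ev ` lists ?T"
      unfolding lists_image[symmetric] K_def[symmetric] using ks by (auto simp: in_lists_conv_set)
    then obtain ss where ss: "set ss \<subseteq> ?T" "ks = map ?ev ss" by (auto simp: in_lists_conv_set)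
    have ks': "set ks \<subseteq> I \<union> J" using ks KIJ by blast
    have "set (Q ks t) \<subseteq> K"
    proof
      fix q assume "q \<in> set (Q ks t)"
      then obtain n where n: "n < length (Q ks t)" "Q ks t ! n = q" by (auto simp: in_set_conv_nth)
      have "?ev (Fn (t, n) ss) = op (t, n) ks" by (simp add: ss(2))
      also have "op (t, n) ks = q" using n t ks' by (simp add: op_def)
      finally have "?ev (Fn (t, n) ss) = q" .
      moreover have "set_tm t \<subseteq> F" using t set_tm_wf[of F fst t] by (simp add: fun_terms_def)
      then have "Fn (t, n) ss \<in> ?T" using ss(1) by auto
      ultimately show "q \<in> K" unfolding K_def by blast
    qed
    then show "\<exists>qs. set qs \<subseteq> K \<and> lam (app_term t (a c @ concat (map a ks) @ [b])) \<in>
         generated F (set (a c) \<union> set (concat (map a qs)) \<union>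
           R \<inter> generated F (insert b (set (concat (map a qs)))))"
      using Q[OF ks' t] by blast
  qed
qed

lemma cover_list:
  assumes "finite Y" "Y \<subseteq> (\<Union>k \<in> K. set (a k))"
  shows "\<exists>ms. set ms \<subseteq> K \<and> Y \<subseteq> set (concat (map a ms))"
  using assms
proof (induction Y rule: finite_induct)
  case empty
  show ?case by (rule exI[of _ "[]"]) simp
next
  case (insert y Y)
  then obtain ms k where "set ms \<subseteq> K" "Y \<subseteq> set (concat (map a ms))" "k \<in> K" "y \<in> set (a k)" by auto
  then show ?case by (intro exI[of _ "k # ms"]) auto
qed

text \<open>Hypothesis \<open>three\<close> is used for the closure \<open>M\<close> of \<open>a c\<close> and a set \<open>W\<close> that an automorphism from \<open>a d\<close> to
  \<open>a c\<close> can fix.\<close>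

lemma conjugate_point:
  assumes S: "Star r I c J a b p"
  shows "\<exists>d \<in> I \<union> J. \<exists>\<tau>. automorphism NR \<tau> \<and> \<tau> b = b \<and> map \<tau> (a d) = a c"
proof -
  note cut = StarD(1)[OF S] and tup = StarD(2)[OF S] and bN = StarD(3)[OF S]
  obtain K where K: "K \<subseteq> I \<union> J" "|K| <o \<mu>"
    and sep: "\<And>ks t. set ks \<subseteq> K \<Longrightarrow> t \<in> fun_terms F (p + length ks * p + 1) \<Longrightarrow>
       \<exists>qs. set qs \<subseteq> K \<and> lam (app_term t (a c @ concat (map a ks) @ [b])) \<in>
         generated F (set (a c) \<union> set (concat (map a qs)) \<union>
           R \<inter> generated F (insert b (set (concat (map a qs)))))"
    by (rule closed_index_set[OF S]) blast
  obtain i j where ij: "i \<in> I" "j \<in> J" "\<And>k. k \<in> K \<inter> I \<Longrightarrow> lt r k i" "\<And>k. k \<in> K \<inter> J \<Longrightarrow> lt r j k"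
    using saturated_segments_bound[OF cut K(2)] by metis
  let ?r = "seg_rel r I c J i j" and ?I = "up_seg r I i" and ?J = "down_seg r J j"
  define E where "E = (\<Union>k \<in> K. set (a k))"
  define W where "W = E \<union> R \<inter> generated F (insert b E)"
  define M where "M = generated F (set (a c) \<union> W)"
  have ac: "set (a c) \<subseteq> N" "length (a c) = p" using tup[of c] by (auto simp: tuples_def)
  have EN: "E \<subseteq> N"
  proof
    fix x assume "x \<in> E"
    then obtain k where "k \<in> K" "x \<in> set (a k)" by (auto simp: E_def)
    then show "x \<in> N" using tup[of k] K(1) by (auto simp: tuples_def)
  qed
  have WN: "W \<subseteq> N" using EN R_sub by (auto simp: W_def)
  have smallE: "|E| <o \<kappa>" unfolding E_def by (intro small_UNION[OF kappa' small_mu[OF K(2)]]) simp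
  have "|{b} \<union> E| <o \<kappa>" by (rule small_Un[OF kappa' small_finite[OF kappa'(2)] smallE]) simp
  then have "|insert b E| <o \<kappa>" by simp
  from small_subset[OF small_generated_F[OF this] Int_lower2]
  have "|R \<inter> generated F (insert b E)| <o \<kappa>" .
  then have smallW: "|W| <o \<kappa>" unfolding W_def by (rule small_Un[OF kappa' smallE])
  have "|set (a c) \<union> W| <o \<kappa>" by (rule small_Un[OF kappa' small_finite[OF kappa'(2)] smallW]) simp
  then have M: "M \<subseteq> N" "|M| <o \<kappa>" "generated F M = M"
    unfolding M_def using small_generated_F generated_subset[OF F_operations] ac(1) WN by auto
  \<comment> \<open>An element of \<open>R\<close> in \<open>W\<close> can only be appended after the entries that generate it together
    with \<open>b\<close>, so \<open>ms\<close> covers these as well.\<close>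
  have star_fin: "\<exists>ws p'. set ws \<subseteq> W \<and> X \<subseteq> set ws \<and> Star ?r ?I c ?J (\<lambda>k. a k @ ws) b p'"
    if X: "finite X" "X \<subseteq> W" for X
  proof -
    let ?D = "X \<inter> (R \<inter> generated F (insert b E))"
    obtain Y where Y: "finite Y" "Y \<subseteq> insert b E" "?D \<subseteq> generated F Y"
      using generated_finite[of ?D F "insert b E"] X(1) by auto
    obtain ms where ms: "set ms \<subseteq> K" "X \<inter> E \<union> Y \<inter> E \<subseteq> set (concat (map a ms))"
      using cover_list[of "X \<inter> E \<union> Y \<inter> E" a K] X(1) Y(1) unfolding E_def by auto
    obtain ds where ds: "set ds = ?D" using finite_list[of ?D] X(1) by auto
    let ?ws = "concat (map a ms)"
    have "m \<in> I \<and> (m, i) \<in> r \<or> m \<in> J \<and> (j, m) \<in> r" if "m \<in> set ms" for m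
      using that ms(1) K(1) ij(3,4)[of m] by (auto simp: lt_def)
    note S1 = Star_segment[OF S ij(1,2) this]
    have "Y \<subseteq> insert b (set ?ws)" using Y(2) ms(2) by auto
    then have "set ds \<subseteq> R \<inter> generated F (insert b (set ?ws))"
      using Y(3) ds generated_mono[OF order.refl, of Y "insert b (set ?ws)" F] by auto
    moreover have "length (a k) = length (a c)" if "k \<in> ?I \<union> {c} \<union> ?J" for k
      using that tup[of k] ac(2) by (auto simp: tuples_def up_seg_def down_seg_def)
    ultimately have "Star ?r ?I c ?J (\<lambda>k. a k @ ?ws @ ds) b (p + length ms * p + length ds)"
      by (intro Star_adjoin[OF S1])
    moreover have "set (?ws @ ds) \<subseteq> W" using ms(1) ds by (auto simp: W_def E_def)
    moreover have "X \<subseteq> set (?ws @ ds)" using X(2) ms(2) ds by (auto simp: W_def)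
    ultimately show ?thesis by blast
  qed
  obtain d where d: "d \<in> ?I"
    using dense_up_seg[OF index_cut_orderD(1,2,6)[OF cut] ij(1)] unfolding dense_no_endpoints_def by blast
  have dI: "d \<in> I" using d by (simp add: up_seg_def)
  have ad: "set (a d) \<subseteq> N" "length (a d) = length (a c)" using tup[of d] dI ac(2) by (auto simp: tuples_def)
  have "\<exists>\<sigma>. automorphism NR \<sigma> \<and> (\<forall>x \<in> W. \<sigma> x = x) \<and> map \<sigma> (a d) = a c"
  proof (rule automorphism_from_finite[OF NR(1,3)])
    show "|W \<union> set (a d)| <o \<kappa>" by (rule small_Un[OF kappa' smallW small_finite[OF kappa'(2)]]) simp
    fix X assume "finite X" "X \<subseteq> W"
    from star_fin[OF this] obtain ws p' where ws: "X \<subseteq> set ws" "Star ?r ?I c ?J (\<lambda>k. a k @ ws) b p'" by blast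
    obtain \<sigma> where \<sigma>: "automorphism NR \<sigma>" "map \<sigma> (a d @ ws) = a c @ ws"
      using aut_indiscernibleD[OF StarD(4)[OF ws(2)], of d c] d by blast
    have eq: "map \<sigma> (a d) = a c" "map \<sigma> ws = ws" using \<sigma>(2) ad(2) by auto
    have "\<sigma> x = x" if "x \<in> set ws" for x using eq(2) that by (metis list.map_ident map_eq_conv)
    then show "\<exists>\<sigma>. automorphism NR \<sigma> \<and> (\<forall>x \<in> X. \<sigma> x = x) \<and> map \<sigma> (a d) = a c"
      using \<sigma>(1) eq(1) ws(1) by blast
  qed (use ad WN in auto)
  then obtain \<sigma> where \<sigma>: "automorphism NR \<sigma>" "\<forall>x \<in> W. \<sigma> x = x" "map \<sigma> (a d) = a c" by blast
  have "tp NN [b] (generated F (set (a c) \<union> W) \<inter> univ NN) = tp NN [\<sigma> b] (generated F (set (a c) \<union> W) \<inter> univ NN)"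
  proof (rule distal_same_type[where a = a and d = d, OF definable_NN distal_NN _ \<sigma>(1,3,2) ac(1)])
    fix X assume "finite X" "X \<subseteq> W"
    from star_fin[OF this] d
    show "\<exists>ws r I J p. set ws \<subseteq> W \<and> X \<subseteq> set ws \<and> Star r I c J (\<lambda>k. a k @ ws) b p \<and> d \<in> I \<union> J" by blast
  qed (use bN N_def in simp)
  moreover have "M \<inter> univ NN = M" using M(1) N_def by blast
  ultimately have tpNN: "tp NN [b] M = tp NN [\<sigma> b] M" by (simp add: M_def)
  have closed: "lam x \<in> M" if x: "x \<in> generated FN (insert b M)" for x
  proof -
    let ?Z = "insert b (set (a c) \<union> E)"
    \<comment> \<open>\<open>x\<close> is the value of one \<open>F\<close>-term at \<open>a c\<close>, entries at \<open>K\<close> and \<open>b\<close>, since the elements of \<open>R\<close>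
      in \<open>W\<close> are themselves generated by \<open>b\<close> and such entries.\<close>
    have FNF: "FN \<subseteq> F" by (auto simp: F_def all_funs_def)
    have "E \<subseteq> generated F ?Z" "set (a c) \<subseteq> generated F ?Z" "b \<in> generated F ?Z"
      using generated_superset[of ?Z F] by auto
    moreover have "generated F (insert b E) \<subseteq> generated F ?Z" by (rule generated_mono) auto
    ultimately have "set (a c) \<union> W \<subseteq> generated F ?Z" "b \<in> generated F ?Z" by (auto simp: W_def)
    then have "insert b M \<subseteq> generated F ?Z" unfolding M_def by (simp add: generated_subset_iff)
    then have "generated F (insert b M) \<subseteq> generated F ?Z" by (simp add: generated_subset_iff)
    then have "x \<in> generated F ?Z" using x generated_mono[OF FNF order.refl, of "insert b M"] by blast
    then obtain Y where Y: "finite Y" "Y \<subseteq> ?Z" "x \<in> generated F Y"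
      using generated_finite[of "{x}" F ?Z] by auto
    obtain ks where ks: "set ks \<subseteq> K" "Y \<inter> E \<subseteq> set (concat (map a ks))"
      using cover_list[of "Y \<inter> E" a K] Y(1) unfolding E_def by auto
    let ?L = "a c @ concat (map a ks) @ [b]"
    have "Y \<subseteq> set ?L" using Y(2) ks(2) by auto
    then have "set [x] \<subseteq> generated F (set ?L)" using Y(3) generated_mono[OF order.refl, of Y "set ?L" F] by auto
    from generated_set_list[OF this]
    obtain t where t: "t \<in> fun_terms F (length ?L)" "x = app_term t ?L" by auto
    have "length (concat (map a ks)) = length ks * p"
      by (rule length_concat_tuples[where K = "I \<union> {c} \<union> J"]) (use tup ks(1) K(1) in auto)
    then have "t \<in> fun_terms F (p + length ks * p + 1)" using t(1) ac(2) by simp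
    from sep[OF ks(1) this] obtain qs where qs: "set qs \<subseteq> K"
      "lam x \<in> generated F (set (a c) \<union> set (concat (map a qs)) \<union>
           R \<inter> generated F (insert b (set (concat (map a qs)))))" unfolding t(2) by blast
    have qE: "set (concat (map a qs)) \<subseteq> E" using qs(1) by (auto simp: E_def)
    then have "generated F (insert b (set (concat (map a qs)))) \<subseteq> generated F (insert b E)"
      by (intro generated_mono) auto
    then have "set (a c) \<union> set (concat (map a qs)) \<union> R \<inter> generated F (insert b (set (concat (map a qs))))
        \<subseteq> set (a c) \<union> W" using qE by (auto simp: W_def)
    then show ?thesis unfolding M_def using qs(2) generated_mono[OF order.refl] by blast
  qed
  have \<sigma>b: "\<sigma> b \<in> N" using automorphism_univ[OF \<sigma>(1)] bN by simp
  have tpNR: "tp NR [b] M = tp NR [\<sigma> b] M" by (rule three[OF M bN \<sigma>b tpNN closed])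
  have "set (a c) \<subseteq> M" unfolding M_def by (rule order_trans[OF _ generated_superset]) simp
  from conjugate_if_same_type[OF tpNR M(1,2) bN \<sigma>(1,3) this] dI show ?thesis by blast
qed

lemma distal_NR: "distal \<kappa> \<mu> NR"
proof (rule distal_if_in_model[OF kappa' _ NR(2)])
  show "infinite (univ NR)" using distal_NN by (simp add: distal_def N_def)
  fix r :: "'k rel" and I c J p a b
  assume b: "b \<in> univ NR" and cut: "index_cut \<kappa> \<mu> r I c J"
    and a: "\<And>k. k \<in> I \<union> {c} \<union> J \<Longrightarrow> a k \<in> tuples p (univ NR)" and star: "star_condition NR r I c J a b"
  have "Star r I c J a b p"
    using Star_iff[OF cut, of a p b] a b star by simp
  from indiscernible_if_one_point[OF conjugate_point this]
  have "aut_indiscernible NR r (I \<union> {c} \<union> J) a {b}" by simp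
  then show "indiscernible NR r (I \<union> {c} \<union> J) a {b}"
    using indiscernible_NR[of "I \<union> {c} \<union> J" a p "{b}" r] a b by simp
qed

end

theorem theorem2p10:
  fixes NN :: "('f, 'r, 'a) struct" and RR :: "('g, 's, 'a) struct"
    and N R :: "'a set" and FN FR F :: "'a nfun set" and lam :: "'a \<Rightarrow> 'a"
    and NR :: "('f, 'r option, 'a) struct"
    and \<kappa> :: "'k rel" and \<mu> :: "'m rel"
  assumes "structure_ok NN" and "N = univ NN" and "R \<subseteq> N" and "NR = expand NN R"
    and "structure_ok RR" and "univ RR = R" and "symbols_definable_in RR NR"
    and "FN \<subseteq> definable_functions NN" and "FR \<subseteq> definable_functions RR"
    and "lam \<in> N \<rightarrow>\<^sub>E R" and "definable NR 2 {[x, lam x] | x. x \<in> N}"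
    and "F = all_funs N lam FN FR"
    and mu: "Card_order \<mu>" "natLeq <o \<mu>" "|fsyms NN| <o \<mu>" "|rsyms NN| <o \<mu>"
    and kappa: "Card_order \<kappa>" "|Pow (Field \<mu>)| <o \<kappa>"
    and "monster \<kappa> NR"
    and one: "distal \<kappa> \<mu> NN" "distal \<kappa> \<mu> RR"
    and two: "\<And>M b b'. M \<subseteq> N \<Longrightarrow> |M| <o \<kappa> \<Longrightarrow> generated F M = M \<Longrightarrow> b \<in> R \<Longrightarrow> b' \<in> R \<Longrightarrow>
                tp RR [b] (M \<inter> R) = tp RR [b'] (M \<inter> R) \<Longrightarrow> tp NR [b] M = tp NR [b'] M"
    and three: "\<And>M b b'. M \<subseteq> N \<Longrightarrow> |M| <o \<kappa> \<Longrightarrow> generated F M = M \<Longrightarrow> b \<in> N \<Longrightarrow> b' \<in> N \<Longrightarrow>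
                tp NN [b] M = tp NN [b'] M \<Longrightarrow> (\<And>x. x \<in> generated FN (insert b M) \<Longrightarrow> lam x \<in> M) \<Longrightarrow>
                tp NR [b] M = tp NR [b'] M"
    and four: "variable_separation \<kappa> \<mu> NR R lam FN FR"
  shows "distal \<kappa> \<mu> NR"
proof -
  interpret expansion NN RR N R FN FR F lam NR \<kappa> \<mu>
    by (rule expansion.intro) (fact assms)+
  show ?thesis by (rule distal_NR)
qed

end
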